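(* Let $\gamma=(\gamma_1,\dots,\gamma_N)$ be a self-similar map on a compact metric space $K$ satisfying Assumption A, and let $\mu_H$ be the Hutchinson measure on $K$. Then there exists a unique finite trace $\tau^{\infty}$ on $\mathcal{F}^{(\infty)}$ such that $\tau^\infty(a)=\int a\,d\mu_H$ for $a\in A=C(K)$ and $$\tau^\infty(\theta_{x,y})=\frac{1}{N^i}\,\mu_H((y|x)_A)\qquad\text{for } x,y\in X^{\otimes i}\ (i\ge 1).$$
   Context: Self-similar maps. $(K,d)$ is a compact metric space, $N\ge 2$, and $\gamma=(\gamma_1,\dots,\gamma_N)$ is a self-similar map on $K$: each $\gamma_j:K\to K$ is a proper contraction (there are constants $0<c'\le c<1$ with $c'd(x,y)\le d(\gamma_j(x),\gamma_j(y))\le c\,d(x,y)$ for all $x,y\in K$) and $K=\bigcup_{j=1}^N\gamma_j(K)$. Put $\Sigma=\{1,\dots,N\}$, $B_\gamma=\{b\in K: b=\gamma_i(a)=\gamma_j(a)\text{ for some }a\in K,\ i\ne j\}$, $P_\gamma=\{a\in K:\gamma_{j_1}\circ\cdots\circ\gamma_{j_k}(a)\in B_\gamma\text{ for some }k\ge1,\ (j_1,\dots,j_k)\in\Sigma^k\}$, and $O_{b,k}=\{\gamma_{j_1}\circ\cdots\circ\gamma_{j_k}(b):(j_1,\dots,j_k)\in\Sigma^k\}$ for $k\ge 1$. Assumption A: (1) there is a continuous map $h:K\to K$ with $h(\gamma_j(y))=y$ for all $y\in K$, $j=1,\dots,N$, and $h^{-1}(y)=\{\gamma_1(y),\dots,\gamma_N(y)\}$;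 (2) $B_\gamma$ and $P_\gamma$ are finite; (3) $B_\gamma\cap\bigcup_{b\in B_\gamma}\bigcup_{k\ge1}O_{b,k}=\emptyset$. The correspondence and the core. $A=C(K)$, $\mathcal{C}=\bigcup_{j=1}^N\{(\gamma_j(y),y):y\in K\}$, $X=C(\mathcal{C})$, with $(a\cdot f\cdot b)(\gamma_j(y),y)=a(\gamma_j(y))f(\gamma_j(y),y)b(y)$, $(f|g)_A(y)=\sum_{j=1}^N\overline{f(\gamma_j(y),y)}g(\gamma_j(y),y)$, and left action $\phi(a)f=a\cdot f$; this is a $C^*$-correspondence over $A$. For a Hilbert module $Y$, $\mathcal{L}(Y)$ is the algebra of adjointable operators, $\theta_{x,y}(z)=x(y|z)_A$, and $\mathcal{K}(Y)$ is the $C^*$-algebra generated by the $\theta_{x,y}$. $X^{\otimes n}$ is the $n$-fold inner tensor product. Put $\mathcal{F}^{(n)}=A\otimes I+\mathcal{K}(X)\otimes I+\cdots+\mathcal{K}(X^{\otimes n})\subset\mathcal{L}(X^{\otimes n})$, embedded in $\mathcal{F}^{(n+1)}$ by $T\mapsto T\otimes I$, and $\mathcal{F}^{(\infty)}=\overline{\bigcup_n\mathcal{F}^{(n)}}$ (the core); each $\mathcal{K}(X^{\otimes i})$ is thereby viewed inside $\mathcal{F}^{(\infty)}$. A finite trace is a bounded positive linear functional with $\tau(xy)=\tau(yx)$. A finite Borel measure $\mu$ on $K$ is identified with the functional $a\mapsto\int a\,d\mu$ on $C(K)$. The Hutchinson measure $\mu_H$ is the unique Borel probability measure on $K$ with $\int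 a\,d\mu_H=\frac1N\sum_{j=1}^N\int a\circ\gamma_j\,d\mu_H$ for all $a\in C(K)$. *)

theory Defs
  imports "HOL-Probability.Probability" "HOL-Library.Poly_Mapping"
begin

section \<open>Self-similar maps\<close>

text \<open>The compact metric space \<open>K\<close> is a type \<^typ>\<open>'k\<close> with compact universe.
  A composition \<open>\<gamma>\<^sub>j\<^sub>1 \<circ> \<dots> \<circ> \<gamma>\<^sub>j\<^sub>k\<close> applied to \<open>a\<close> is \<^term>\<open>foldr \<gamma> js a\<close> with
  \<open>js = [j\<^sub>1, \<dots>, j\<^sub>k]\<close>.\<close>

definition self_similar_map :: "nat \<Rightarrow> (nat \<Rightarrow> 'k::metric_space \<Rightarrow> 'k) \<Rightarrow> bool" where
  "self_similar_map N \<gamma> \<longleftrightarrow>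
     (\<forall>j\<in>{1..N}. \<exists>c' c. 0 < c' \<and> c' \<le> c \<and> c < 1 \<and>
        (\<forall>x y. c' * dist x y \<le> dist (\<gamma> j x) (\<gamma> j y) \<and> dist (\<gamma> j x) (\<gamma> j y) \<le> c * dist x y)) \<and>
     (\<Union>j\<in>{1..N}. range (\<gamma> j)) = UNIV"

definition branch_set :: "nat \<Rightarrow> (nat \<Rightarrow> 'k \<Rightarrow> 'k) \<Rightarrow> 'k set" where
  "branch_set N \<gamma> =
     {b. \<exists>a. \<exists>i\<in>{1..N}. \<exists>j\<in>{1..N}. i \<noteq> j \<and> b = \<gamma> i a \<and> b = \<gamma> j a}"

definition postbranch_set :: "nat \<Rightarrow> (nat \<Rightarrow> 'k \<Rightarrow> 'k) \<Rightarrow> 'k set" where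
  "postbranch_set N \<gamma> =
     {a. \<exists>k\<ge>1. \<exists>js. length js = k \<and> set js \<subseteq> {1..N} \<and> foldr \<gamma> js a \<in> branch_set N \<gamma>}"

definition orbit_set :: "nat \<Rightarrow> (nat \<Rightarrow> 'k \<Rightarrow> 'k) \<Rightarrow> 'k \<Rightarrow> nat \<Rightarrow> 'k set" where
  "orbit_set N \<gamma> b k = {foldr \<gamma> js b | js. length js = k \<and> set js \<subseteq> {1..N}}"

definition assumption_A :: "nat \<Rightarrow> (nat \<Rightarrow> 'k::metric_space \<Rightarrow> 'k) \<Rightarrow> bool" where
  "assumption_A N \<gamma> \<longleftrightarrow>
     (\<exists>h. continuous_on UNIV h \<and> (\<forall>j\<in>{1..N}. \<forall>y. h (\<gamma> j y) = y) \<and>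
          (\<forall>y. h -` {y} = (\<lambda>j. \<gamma> j y) ` {1..N})) \<and>
     finite (branch_set N \<gamma>) \<and> finite (postbranch_set N \<gamma>) \<and>
     branch_set N \<gamma> \<inter> (\<Union>b\<in>branch_set N \<gamma>. \<Union>k\<in>{1..}. orbit_set N \<gamma> b k) = {}"

definition CK :: "('k::topological_space \<Rightarrow> complex) set" where
  "CK = {a. continuous_on UNIV a}"

definition hutchinson_measure ::
    "nat \<Rightarrow> (nat \<Rightarrow> 'k::metric_space \<Rightarrow> 'k) \<Rightarrow> 'k measure \<Rightarrow> bool" where
  "hutchinson_measure N \<gamma> \<mu> \<longleftrightarrow> prob_space \<mu> \<and> sets \<mu> = sets borel \<and>
     (\<forall>a\<in>CK. (LINT x|\<mu>. a x) = (1 / of_nat N) * (\<Sum>j=1..N. LINT x|\<mu>. a (\<gamma> j x)))"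


section \<open>Star algebras and traces\<close>

record 'b star_alg =
  scarrier :: "'b set"
  sadd :: "'b \<Rightarrow> 'b \<Rightarrow> 'b"
  sscale :: "complex \<Rightarrow> 'b \<Rightarrow> 'b"
  smult :: "'b \<Rightarrow> 'b \<Rightarrow> 'b"
  sstar :: "'b \<Rightarrow> 'b"
  snorm :: "'b \<Rightarrow> real"

definition sdist :: "'b star_alg \<Rightarrow> 'b \<Rightarrow> 'b \<Rightarrow> real" where
  "sdist B x y = snorm B (sadd B x (sscale B (-1) y))"

definition closed_star_subalgebra :: "'b star_alg \<Rightarrow> 'b set \<Rightarrow> bool" where
  "closed_star_subalgebra B D \<longleftrightarrow>
     D \<noteq> {} \<and> D \<subseteq> scarrier B \<and>
     (\<forall>x\<in>D. \<forall>y\<in>D. sadd B x y \<in> D \<and> smult B x y \<in> D) \<and>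
     (\<forall>c. \<forall>x\<in>D. sscale B c x \<in> D) \<and> (\<forall>x\<in>D. sstar B x \<in> D) \<and>
     (\<forall>f. \<forall>x\<in>scarrier B. (\<forall>n::nat. f n \<in> D) \<and> (\<lambda>n. sdist B (f n) x) \<longlonglongrightarrow> 0 \<longrightarrow> x \<in> D)"

definition cstar_generated :: "'b star_alg \<Rightarrow> 'b set \<Rightarrow> 'b set" where
  "cstar_generated B S = \<Inter>{D. closed_star_subalgebra B D \<and> S \<subseteq> D}"

definition finite_trace :: "'b star_alg \<Rightarrow> ('b \<Rightarrow> complex) \<Rightarrow> bool" where
  "finite_trace B \<tau> \<longleftrightarrow>
     (\<forall>x\<in>scarrier B. \<forall>y\<in>scarrier B. \<tau> (sadd B x y) = \<tau> x + \<tau> y) \<and>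
     (\<forall>c. \<forall>x\<in>scarrier B. \<tau> (sscale B c x) = c * \<tau> x) \<and>
     (\<exists>C. \<forall>x\<in>scarrier B. cmod (\<tau> x) \<le> C * snorm B x) \<and>
     (\<forall>x\<in>scarrier B. \<tau> (smult B (sstar B x) x) \<in> \<real>\<^sub>\<ge>\<^sub>0) \<and>
     (\<forall>x\<in>scarrier B. \<forall>y\<in>scarrier B. \<tau> (smult B x y) = \<tau> (smult B y x))"


section \<open>Hausdorff completion\<close>

text \<open>The completion of \<open>S\<close> for the pseudometric \<open>d\<close>: Cauchy sequences modulo sequences at
  distance tending to \<open>0\<close>. Uniformly continuous operations and functionals on \<open>S\<close> are
  extended by applying them termwise to representatives.\<close>

definition cauchy_seqs :: "'s set \<Rightarrow> ('s \<Rightarrow> 's \<Rightarrow> real) \<Rightarrow> (nat \<Rightarrow> 's) set" where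
  "cauchy_seqs S d =
     {s. range s \<subseteq> S \<and> (\<forall>e>0. \<exists>M. \<forall>k\<ge>M. \<forall>l\<ge>M. d (s k) (s l) < e)}"

definition completion_rel :: "'s set \<Rightarrow> ('s \<Rightarrow> 's \<Rightarrow> real) \<Rightarrow> ((nat \<Rightarrow> 's) \<times> (nat \<Rightarrow> 's)) set" where
  "completion_rel S d =
     {(s, t). s \<in> cauchy_seqs S d \<and> t \<in> cauchy_seqs S d \<and> (\<lambda>k. d (s k) (t k)) \<longlonglongrightarrow> 0}"

definition completion :: "'s set \<Rightarrow> ('s \<Rightarrow> 's \<Rightarrow> real) \<Rightarrow> (nat \<Rightarrow> 's) set set" where
  "completion S d = cauchy_seqs S d // completion_rel S d"

definition cclass :: "'s set \<Rightarrow> ('s \<Rightarrow> 's \<Rightarrow> real) \<Rightarrow> (nat \<Rightarrow> 's) \<Rightarrow> (nat \<Rightarrow> 's) set" where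
  "cclass S d s = completion_rel S d `` {s}"

definition clift1 ::
    "'t set \<Rightarrow> ('t \<Rightarrow> 't \<Rightarrow> real) \<Rightarrow> ('s \<Rightarrow> 't) \<Rightarrow> (nat \<Rightarrow> 's) set \<Rightarrow> (nat \<Rightarrow> 't) set" where
  "clift1 S d f P = (\<Union>s\<in>P. cclass S d (\<lambda>k. f (s k)))"

definition clift2 ::
    "'s set \<Rightarrow> ('s \<Rightarrow> 's \<Rightarrow> real) \<Rightarrow> ('s \<Rightarrow> 's \<Rightarrow> 's) \<Rightarrow>
     (nat \<Rightarrow> 's) set \<Rightarrow> (nat \<Rightarrow> 's) set \<Rightarrow> (nat \<Rightarrow> 's) set" where
  "clift2 S d f P Q = (\<Union>s\<in>P. \<Union>t\<in>Q. cclass S d (\<lambda>k. f (s k) (t k)))"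


section \<open>Correspondences over \<open>C(K)\<close>\<close>

text \<open>Since \<open>C(K)\<close> is unital, complex scalars act through \<^term>\<open>mact\<close> by constant functions.\<close>

record ('v, 'k) corr =
  mcarrier :: "'v set"
  madd :: "'v \<Rightarrow> 'v \<Rightarrow> 'v"
  mact :: "'v \<Rightarrow> ('k \<Rightarrow> complex) \<Rightarrow> 'v"
  mleft :: "('k \<Rightarrow> complex) \<Rightarrow> 'v \<Rightarrow> 'v"
  minner :: "'v \<Rightarrow> 'v \<Rightarrow> 'k \<Rightarrow> complex"

definition mnorm :: "('v, 'k) corr \<Rightarrow> 'v \<Rightarrow> real" where
  "mnorm E x = sqrt (SUP y. cmod (minner E x x y))"

definition is_adjoint :: "('v, 'k) corr \<Rightarrow> ('v \<Rightarrow> 'v) \<Rightarrow> ('v \<Rightarrow> 'v) \<Rightarrow> bool" where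
  "is_adjoint E T S \<longleftrightarrow>
     T \<in> mcarrier E \<rightarrow>\<^sub>E mcarrier E \<and> S \<in> mcarrier E \<rightarrow>\<^sub>E mcarrier E \<and>
     (\<forall>x\<in>mcarrier E. \<forall>y\<in>mcarrier E. minner E (T x) y = minner E x (S y))"

definition adjointables :: "('v, 'k) corr \<Rightarrow> ('v \<Rightarrow> 'v) star_alg" where
  "adjointables E = \<lparr>
     scarrier = {T. \<exists>S. is_adjoint E T S},
     sadd = (\<lambda>T S. \<lambda>x\<in>mcarrier E. madd E (T x) (S x)),
     sscale = (\<lambda>c T. \<lambda>x\<in>mcarrier E. mact E (T x) (\<lambda>_. c)),
     smult = (\<lambda>T S. \<lambda>x\<in>mcarrier E. T (S x)),
     sstar = (\<lambda>T. THE S. is_adjoint E T S),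
     snorm = (\<lambda>T. SUP x\<in>{x\<in>mcarrier E. mnorm E x \<le> 1}. mnorm E (T x)) \<rparr>"

definition theta :: "('v, 'k) corr \<Rightarrow> 'v \<Rightarrow> 'v \<Rightarrow> 'v \<Rightarrow> 'v" where
  "theta E x y = (\<lambda>z\<in>mcarrier E. mact E x (minner E y z))"

definition compacts :: "('v, 'k) corr \<Rightarrow> ('v \<Rightarrow> 'v) set" where
  "compacts E = cstar_generated (adjointables E)
     {theta E x y | x y. x \<in> mcarrier E \<and> y \<in> mcarrier E}"

definition left_op :: "('v, 'k) corr \<Rightarrow> ('k \<Rightarrow> complex) \<Rightarrow> 'v \<Rightarrow> 'v" where
  "left_op E a = (\<lambda>x\<in>mcarrier E. mleft E a x)"


section \<open>Inner tensor powers\<close>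

text \<open>For \<open>n \<ge> 1\<close> the \<open>n\<close>-fold inner tensor product is the Hausdorff completion of the algebraic
  tensor product for the semi-inner product determined by
  \<open>(x\<^sub>1 \<otimes> \<xi> | y\<^sub>1 \<otimes> \<eta>) = (\<xi> | (x\<^sub>1 | y\<^sub>1) \<cdot> \<eta>)\<close>.
  We start from the free complex vector space on words of length \<open>n\<close>, the word
  \<open>[x\<^sub>1, \<dots>, x\<^sub>n]\<close> standing for \<open>x\<^sub>1 \<otimes> \<dots> \<otimes> x\<^sub>n\<close>; the multilinearity and balancing relations
  are null vectors of the semi-inner product, so they hold in the completion. For \<open>n = 1\<close>
  the completion is \<open>E\<close> itself, up to the canonical isomorphism. The case \<open>n = 0\<close> is not used
  (it would give the complex numbers and not \<open>C(K)\<close>).\<close>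

type_synonym 'v ptensor = "'v list \<Rightarrow>\<^sub>0 complex"
type_synonym 'v tensor = "(nat \<Rightarrow> 'v ptensor) set"

fun word_inner ::
    "('v, 'k) corr \<Rightarrow> ('k \<Rightarrow> complex) \<Rightarrow> 'v list \<Rightarrow> 'v list \<Rightarrow> 'k \<Rightarrow> complex" where
  "word_inner E a (v # vs) (w # ws) = word_inner E (minner E v (mleft E a w)) vs ws"
| "word_inner E a _ _ = a"

definition pt_carrier :: "('v, 'k) corr \<Rightarrow> nat \<Rightarrow> 'v ptensor set" where
  "pt_carrier E n = {s. \<forall>w\<in>Poly_Mapping.keys s. length w = n \<and> set w \<subseteq> mcarrier E}"

definition pt_inner :: "('v, 'k) corr \<Rightarrow> 'v ptensor \<Rightarrow> 'v ptensor \<Rightarrow> 'k \<Rightarrow> complex" where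
  "pt_inner E s t y =
     (\<Sum>v\<in>Poly_Mapping.keys s. \<Sum>w\<in>Poly_Mapping.keys t.
        cnj (Poly_Mapping.lookup s v) * Poly_Mapping.lookup t w * word_inner E (\<lambda>_. 1) v w y)"

definition pt_dist :: "('v, 'k) corr \<Rightarrow> 'v ptensor \<Rightarrow> 'v ptensor \<Rightarrow> real" where
  "pt_dist E s t = sqrt (SUP y. cmod (pt_inner E (s - t) (s - t) y))"

text \<open>Linear extension of a map on words.\<close>

definition pt_map :: "('v list \<Rightarrow> 'v list) \<Rightarrow> 'v ptensor \<Rightarrow> 'v ptensor" where
  "pt_map f s = (\<Sum>w\<in>Poly_Mapping.keys s. Poly_Mapping.single (f w) (Poly_Mapping.lookup s w))"

definition tensor_power :: "('v, 'k) corr \<Rightarrow> nat \<Rightarrow> ('v tensor, 'k) corr" where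
  "tensor_power E n = (let S = pt_carrier E n; d = pt_dist E in \<lparr>
     mcarrier = completion S d,
     madd = clift2 S d (+),
     mact = (\<lambda>P b. clift1 S d (pt_map (\<lambda>w. butlast w @ [mact E (last w) b])) P),
     mleft = (\<lambda>a. clift1 S d (pt_map (\<lambda>w. mleft E a (hd w) # tl w))),
     minner = (\<lambda>P Q y. THE z. \<forall>s\<in>P. \<forall>t\<in>Q. (\<lambda>k. pt_inner E (s k) (t k) y) \<longlonglongrightarrow> z) \<rparr>)"

text \<open>\<open>P \<otimes> x\<close> for \<open>P\<close> in the \<open>n\<close>-th tensor power and \<open>x\<close> in \<open>E\<close>.\<close>

definition tensor_snoc :: "('v, 'k) corr \<Rightarrow> nat \<Rightarrow> 'v tensor \<Rightarrow> 'v \<Rightarrow> 'v tensor" where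
  "tensor_snoc E n P x =
     clift1 (pt_carrier E (Suc n)) (pt_dist E) (pt_map (\<lambda>w. w @ [x])) P"

text \<open>\<open>T \<otimes> I\<close>, from the \<open>n\<close>-th to the \<open>(n+1)\<close>-st tensor power, and its iterates.\<close>

definition amplify ::
    "('v, 'k) corr \<Rightarrow> nat \<Rightarrow> ('v tensor \<Rightarrow> 'v tensor) \<Rightarrow> 'v tensor \<Rightarrow> 'v tensor" where
  "amplify E n T =
     (THE S. S \<in> scarrier (adjointables (tensor_power E (Suc n))) \<and>
        (\<forall>P\<in>mcarrier (tensor_power E n). \<forall>x\<in>mcarrier E.
           S (tensor_snoc E n P x) = tensor_snoc E n (T P) x))"

primrec amplify_by ::
    "('v, 'k) corr \<Rightarrow> nat \<Rightarrow> nat \<Rightarrow> ('v tensor \<Rightarrow> 'v tensor) \<Rightarrow> 'v tensor \<Rightarrow> 'v tensor" where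
  "amplify_by E n 0 T = T"
| "amplify_by E n (Suc k) T = amplify E (n + k) (amplify_by E n k T)"


section \<open>The core\<close>

text \<open>\<open>F\<^sup>(\<^sup>n\<^sup>) = A \<otimes> I + K(E) \<otimes> I + \<dots> + K(E\<^sup>\<otimes>\<^sup>n)\<close> for \<open>n \<ge> 1\<close>. The level \<open>F\<^sup>(\<^sup>0\<^sup>) = A\<close> is contained
  in \<open>F\<^sup>(\<^sup>1\<^sup>)\<close> through the left action and is therefore omitted from the union below.\<close>

definition core_level :: "('v, 'k::topological_space) corr \<Rightarrow> nat \<Rightarrow> ('v tensor \<Rightarrow> 'v tensor) set" where
  "core_level E n =
     {foldr (sadd (adjointables (tensor_power E n)))
        (map (\<lambda>i. amplify_by E i (n - i) (T i)) [1..<Suc n])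
        (amplify_by E 1 (n - 1) (left_op (tensor_power E 1) a)) | a T.
      a \<in> CK \<and> (\<forall>i\<in>{1..n}. T i \<in> compacts (tensor_power E i))}"

text \<open>An element of the union of the levels is given by a pair \<open>(n, T)\<close> with \<open>T\<close> in the \<open>n\<close>-th
  level. Pairs are moved to a common level before operating on them; pairs that become equal there
  are at distance \<open>0\<close> and are identified in the completion.\<close>

type_synonym 'v cpair = "nat \<times> ('v tensor \<Rightarrow> 'v tensor)"

definition cp_carrier :: "('v, 'k::topological_space) corr \<Rightarrow> 'v cpair set" where
  "cp_carrier E = {(n, T). n \<ge> 1 \<and> T \<in> core_level E n}"

definition cp_raise :: "('v, 'k) corr \<Rightarrow> nat \<Rightarrow> 'v cpair \<Rightarrow> 'v tensor \<Rightarrow> 'v tensor" where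
  "cp_raise E m p = amplify_by E (fst p) (m - fst p) (snd p)"

definition cp_dist :: "('v, 'k) corr \<Rightarrow> 'v cpair \<Rightarrow> 'v cpair \<Rightarrow> real" where
  "cp_dist E p q = (let m = max (fst p) (fst q) in
     sdist (adjointables (tensor_power E m)) (cp_raise E m p) (cp_raise E m q))"

definition cp_add :: "('v, 'k) corr \<Rightarrow> 'v cpair \<Rightarrow> 'v cpair \<Rightarrow> 'v cpair" where
  "cp_add E p q = (let m = max (fst p) (fst q) in
     (m, sadd (adjointables (tensor_power E m)) (cp_raise E m p) (cp_raise E m q)))"

definition cp_mult :: "('v, 'k) corr \<Rightarrow> 'v cpair \<Rightarrow> 'v cpair \<Rightarrow> 'v cpair" where
  "cp_mult E p q = (let m = max (fst p) (fst q) in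
     (m, smult (adjointables (tensor_power E m)) (cp_raise E m p) (cp_raise E m q)))"

definition cp_scale :: "('v, 'k) corr \<Rightarrow> complex \<Rightarrow> 'v cpair \<Rightarrow> 'v cpair" where
  "cp_scale E c p = (fst p, sscale (adjointables (tensor_power E (fst p))) c (snd p))"

definition cp_star :: "('v, 'k) corr \<Rightarrow> 'v cpair \<Rightarrow> 'v cpair" where
  "cp_star E p = (fst p, sstar (adjointables (tensor_power E (fst p))) (snd p))"

definition cp_norm :: "('v, 'k) corr \<Rightarrow> 'v cpair \<Rightarrow> real" where
  "cp_norm E p = snorm (adjointables (tensor_power E (fst p))) (snd p)"

definition core :: "('v, 'k::topological_space) corr \<Rightarrow> (nat \<Rightarrow> 'v cpair) set star_alg" where
  "core E = (let S = cp_carrier E; d = cp_dist E in \<lparr>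
     scarrier = completion S d,
     sadd = clift2 S d (cp_add E),
     sscale = (\<lambda>c. clift1 S d (cp_scale E c)),
     smult = clift2 S d (cp_mult E),
     sstar = clift1 S d (cp_star E),
     snorm = (\<lambda>P. THE r. \<forall>s\<in>P. (\<lambda>k. cp_norm E (s k)) \<longlonglongrightarrow> r) \<rparr>)"

text \<open>The image in the core of an operator of the \<open>n\<close>-th level.\<close>

definition core_embed ::
    "('v, 'k::topological_space) corr \<Rightarrow> nat \<Rightarrow> ('v tensor \<Rightarrow> 'v tensor) \<Rightarrow> (nat \<Rightarrow> 'v cpair) set" where
  "core_embed E n T = cclass (cp_carrier E) (cp_dist E) (\<lambda>_. (n, T))"


section \<open>The correspondence of a self-similar map\<close>

definition cograph :: "nat \<Rightarrow> (nat \<Rightarrow> 'k \<Rightarrow> 'k) \<Rightarrow> ('k \<times> 'k) set" where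
  "cograph N \<gamma> = (\<Union>j\<in>{1..N}. {(\<gamma> j y, y) | y. True})"

definition self_similar_corr ::
    "nat \<Rightarrow> (nat \<Rightarrow> 'k::metric_space \<Rightarrow> 'k) \<Rightarrow> ('k \<times> 'k \<Rightarrow> complex, 'k) corr" where
  "self_similar_corr N \<gamma> = \<lparr>
     mcarrier = {f \<in> extensional (cograph N \<gamma>). continuous_on (cograph N \<gamma>) f},
     madd = (\<lambda>f g. \<lambda>p\<in>cograph N \<gamma>. f p + g p),
     mact = (\<lambda>f b. \<lambda>p\<in>cograph N \<gamma>. f p * b (snd p)),
     mleft = (\<lambda>a f. \<lambda>p\<in>cograph N \<gamma>. a (fst p) * f p),
     minner = (\<lambda>f g y. \<Sum>j=1..N. cnj (f (\<gamma> j y, y)) * g (\<gamma> j y, y)) \<rparr>"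

end

theory Submission
  imports Defs
begin

text \<open>
  The map \<open>x \<mapsto> (x, h x)\<close> identifies \<open>K\<close> with the cograph, and with it \<open>X\<close>, and then every tensor power
  \<open>X\<^sup>\<otimes>\<^sup>n\<close>, with \<open>C(K)\<close>. Let \<open>E f (y)\<close> be the sum of the \<open>f (\<gamma>\<^sub>j y)\<close> (\<open>transfer\<close>). In this model the inner
  product is \<open>(f|g)\<^sub>n = E\<^sup>n (f\<^sup>* g)\<close>, the right action of \<open>b\<close> is multiplication by \<open>b \<circ> h\<^sup>n\<close>, and \<open>T \<otimes> I\<close> is
  \<open>T\<close> itself, because \<open>f \<otimes> x\<close> is \<open>f \<cdot> (x \<circ> h\<^sup>n)\<close> and \<open>T\<close> is a module map. The algebras \<open>\<L>(X\<^sup>\<otimes>\<^sup>n)\<close> thus form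
  an increasing sequence of algebras of operators on \<open>C(K)\<close>, with compatible adjoints and norms
  (\<open>is_adjoint_Suc\<close>, \<open>nrm_Suc\<close>), and the core is the completion of the union of subalgebras \<open>FF n\<close>.

  An adjointable \<open>T\<close> acts on the functions on each fibre of \<open>h\<^sup>n\<close> (\<open>L_fibre_zero\<close>), so it has a diagonal
  \<open>D T\<close>, a function on \<open>K\<close>: its value at \<open>x\<close> is \<open>T f (x)\<close> for any \<open>f\<close> that is \<open>1\<close> at \<open>x\<close> and \<open>0\<close> on the rest of
  the fibre of \<open>x\<close>. The diagonal does not depend on the level \<open>n\<close>. The trace is
  \<open>\<tau> T = \<integral> D T d\<mu>\<close>. For a multiplication operator \<open>D a = a\<close>. For a rank-one operator \<open>D \<theta>\<^bsub>u,v\<^esub>\<close> is \<open>u v\<^sup>*\<close>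
  times the multiplicity of \<open>x\<close> in its \<open>n\<close>-fold fibre, and \<open>\<integral> u v\<^sup>* d\<mu> = N\<^bsup>-n\<^esup> \<integral> (v|u)\<^sub>n d\<mu>\<close> by invariance of \<open>\<mu>\<close>. So
  the two prescriptions are compatible once the points of higher multiplicity are \<open>\<mu>\<close>-null. These are
  the points whose orbit under \<open>h\<close> meets the finite branch set, a countable set, and \<open>\<mu>\<close> has no atoms:
  an atom of nearly maximal mass would be a branch point with a branch point as its image under \<open>h\<close>,
  against Assumption A (\<open>no_atoms\<close>).

  Positivity and the bound \<open>\<bar>\<tau> T\<bar> \<le> \<parallel>T\<parallel>\<close> hold pointwise for the diagonal. The trace property is clear if
  one factor is a multiplication operator; for \<open>\<theta>\<^bsub>u,v\<^esub>\<close> it is the identity \<open>(v|Tu) = (T\<^sup>*v|u)\<close>, and an induction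
  principle for compact operators (\<open>KK_induct\<close>) extends it to all of them. Uniqueness follows from the same
  principle, as the given values determine the trace on a set with dense linear span.

  It remains to carry this over to the tensor powers and the core, which are completions of free
  constructions: evaluation of formal tensors as functions identifies the \<open>n\<close>-th tensor power with the
  model (\<open>cls\<close>), and every operation of the core becomes the corresponding operation on \<open>C(K)\<close>.
\<close>

section \<open>Continuous functions on a compact space\<close>

lemma CK_const [simp]: "(\<lambda>_. c) \<in> CK"
  and CK_add: "f \<in> CK \<Longrightarrow> g \<in> CK \<Longrightarrow> (\<lambda>x. f x + g x) \<in> CK"
  and CK_diff: "f \<in> CK \<Longrightarrow> g \<in> CK \<Longrightarrow> (\<lambda>x. f x - g x) \<in> CK"
  and CK_mult: "f \<in> CK \<Longrightarrow> g \<in> CK \<Longrightarrow> (\<lambda>x. f x * g x) \<in> CK"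
  and CK_cnj: "f \<in> CK \<Longrightarrow> (\<lambda>x. cnj (f x)) \<in> CK"
  by (auto simp: CK_def intro!: continuous_intros)

lemma CK_sum: "(\<And>i. i \<in> I \<Longrightarrow> f i \<in> CK) \<Longrightarrow> (\<lambda>x. \<Sum>i\<in>I. f i x) \<in> CK"
  by (auto simp: CK_def intro!: continuous_intros)

lemma CK_comp: "f \<in> CK \<Longrightarrow> continuous_on UNIV g \<Longrightarrow> (\<lambda>x. f (g x)) \<in> CK"
  unfolding CK_def by (auto intro: continuous_on_compose2)

lemma CK_bounded:
  fixes f :: "'k::topological_space \<Rightarrow> complex"
  assumes "compact (UNIV :: 'k set)" "f \<in> CK"
  shows "\<exists>C\<ge>0. \<forall>x. cmod (f x) \<le> C"
proof -
  have "compact (range f)"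
    using assms by (auto simp: CK_def intro: compact_continuous_image)
  then have "bounded (range f)" by (rule compact_imp_bounded)
  then obtain C where "\<And>x. cmod (f x) \<le> C" by (auto simp: bounded_iff)
  then show ?thesis by (intro exI[of _ "max C 0"]) (auto intro: le_max_iff_disj[THEN iffD2])
qed

lemma CK_uniform_limit:
  fixes f :: "nat \<Rightarrow> 'k::topological_space \<Rightarrow> complex"
  assumes "\<And>k. f k \<in> CK" "uniform_limit UNIV f g sequentially"
  shows "g \<in> CK"
  unfolding CK_def mem_Collect_eq
  by (rule uniform_limit_theorem[OF _ assms(2)]) (use assms(1) in \<open>auto simp: CK_def\<close>)

section \<open>The transfer operators\<close>

text \<open>Under Assumption A the correspondence is governed by a continuous left inverse \<open>h\<close> common to
  all the branches; the branches are precisely the local inverses of \<open>h\<close>.\<close>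

locale branch_system =
  fixes N :: nat and \<gamma> :: "nat \<Rightarrow> 'k::metric_space \<Rightarrow> 'k" and h :: "'k \<Rightarrow> 'k"
  assumes cpt: "compact (UNIV :: 'k set)"
    and N_pos: "N \<ge> 1"
    and cont_h: "continuous_on UNIV h"
    and cont_\<gamma>: "j \<in> {1..N} \<Longrightarrow> continuous_on UNIV (\<gamma> j)"
    and h_\<gamma>: "j \<in> {1..N} \<Longrightarrow> h (\<gamma> j y) = y"
    and cover: "\<exists>j\<in>{1..N}. \<gamma> j (h x) = x"
begin

definition words :: "nat \<Rightarrow> nat list set" where
  "words n = {w. set w \<subseteq> {1..N} \<and> length w = n}"

lemma finite_words [simp]: "finite (words n)"
  unfolding words_def by (rule finite_lists_length_eq) simp

lemma words_0 [simp]: "words 0 = {[]}"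
  by (auto simp: words_def)

lemma card_words: "card (words n) = N ^ n"
  unfolding words_def by (subst card_lists_length_eq) auto

lemma sum_words_Cons:
  "(\<Sum>w\<in>words (Suc n). g w) = (\<Sum>w\<in>words n. \<Sum>j=1..N. g (j # w))"
proof -
  have "bij_betw (\<lambda>(w, j). j # w) (words n \<times> {1..N}) (words (Suc n))"
    by (rule bij_betw_byWitness[where f' = "\<lambda>w. (tl w, hd w)"])
      (auto simp: words_def length_Suc_conv)
  then have "(\<Sum>w\<in>words (Suc n). g w) = (\<Sum>(w, j)\<in>words n \<times> {1..N}. g (j # w))"
    by (subst sum.reindex_bij_betw[symmetric]) (auto simp: case_prod_unfold)
  then show ?thesis by (simp add: sum.cartesian_product)
qed

lemma sum_words_snoc:
  "(\<Sum>w\<in>words (Suc n). g w) = (\<Sum>j=1..N. \<Sum>w\<in>words n. g (w @ [j]))"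
proof -
  have 1: "w \<in> words (Suc n) \<Longrightarrow> w \<noteq> []" for w by (auto simp: words_def)
  have "bij_betw (\<lambda>(j, w). w @ [j]) ({1..N} \<times> words n) (words (Suc n))"
  proof (rule bij_betw_byWitness[where f' = "\<lambda>w. (last w, butlast w)"])
    show "\<forall>a'\<in>words (Suc n). (case (last a', butlast a') of (j, w) \<Rightarrow> w @ [j]) = a'"
      using 1 by auto
    have "last w \<in> {1..N} \<and> butlast w \<in> words n" if "w \<in> words (Suc n)" for w
      using that by (cases w rule: rev_cases) (auto simp: words_def)
    then show "(\<lambda>w. (last w, butlast w)) ` words (Suc n) \<subseteq> {1..N} \<times> words n"
      by blast
  qed (auto simp: words_def)
  then have "(\<Sum>w\<in>words (Suc n). g w) = (\<Sum>(j, w)\<in>{1..N} \<times> words n. g (w @ [j]))"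
    by (subst sum.reindex_bij_betw[symmetric]) (auto simp: case_prod_unfold)
  then show ?thesis by (simp add: sum.cartesian_product)
qed

lemma h_word: "w \<in> words n \<Longrightarrow> (h ^^ n) (foldr \<gamma> w y) = y"
proof (induction n arbitrary: w)
  case (Suc n)
  then obtain j v where w: "w = j # v" "j \<in> {1..N}" "v \<in> words n"
    by (auto simp: words_def length_Suc_conv)
  then show ?case using Suc.IH[of v] h_\<gamma>[of j] by (simp add: funpow_Suc_right del: funpow.simps)
qed auto

lemma word_cover: "\<exists>w\<in>words n. foldr \<gamma> w ((h ^^ n) x) = x"
proof (induction n arbitrary: x)
  case (Suc n)
  obtain w where w: "w \<in> words n" "foldr \<gamma> w ((h ^^ n) (h x)) = h x" using Suc by blast
  obtain j where j: "j \<in> {1..N}" "\<gamma> j (h x) = x" using cover by blast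
  show ?case using w j
    by (intro bexI[of _ "j # w"]) (auto simp: words_def funpow_Suc_right simp del: funpow.simps)
qed auto

lemma cont_hn: "continuous_on UNIV (h ^^ n)"
proof (induction n)
  case (Suc n)
  then have "continuous_on UNIV (\<lambda>x. h ((h ^^ n) x))"
    by (rule continuous_on_compose2[OF cont_h]) auto
  then show ?case by (simp add: o_def)
qed (auto simp: continuous_on_id)

lemma cont_word: "w \<in> words n \<Longrightarrow> continuous_on UNIV (foldr \<gamma> w)"
proof (induction n arbitrary: w)
  case (Suc n)
  then obtain j v where w: "w = j # v" "j \<in> {1..N}" "v \<in> words n"
    by (auto simp: words_def length_Suc_conv)
  have "continuous_on UNIV (\<lambda>x. \<gamma> j (foldr \<gamma> v x))"
    by (rule continuous_on_compose2[OF cont_\<gamma>[OF w(2)] Suc.IH[OF w(3)]]) auto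
  then show ?case using w by (simp add: o_def)
qed (auto simp: continuous_on_id id_def)

text \<open>The \<open>n\<close>-th power of the transfer operator of \<open>h\<close>: summation over the \<open>n\<close>-fold fibres, where
  points at which branches meet are counted with multiplicity.\<close>

definition transfer :: "nat \<Rightarrow> ('k \<Rightarrow> 'a::comm_monoid_add) \<Rightarrow> 'k \<Rightarrow> 'a" where
  "transfer n f y = (\<Sum>w\<in>words n. f (foldr \<gamma> w y))"

lemma transfer_0 [simp]: "transfer 0 f = f"
  by (auto simp: transfer_def fun_eq_iff)

lemma transfer_Suc: "transfer (Suc n) f y = (\<Sum>j=1..N. transfer n f (\<gamma> j y))"
  by (simp add: transfer_def sum_words_snoc)

lemma transfer_Suc': "transfer (Suc n) f = transfer n (\<lambda>x. \<Sum>j=1..N. f (\<gamma> j x))"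
  by (simp add: transfer_def sum_words_Cons fun_eq_iff)

lemma transfer_cong:
  "(\<And>x. (h ^^ n) x = y \<Longrightarrow> f x = g x) \<Longrightarrow> transfer n f y = transfer n g y"
  unfolding transfer_def by (rule sum.cong) (auto simp: h_word)

text \<open>Functions of the form \<open>b \<circ> h\<^sup>n\<close> are constant on \<open>n\<close>-fold fibres, so they act as scalars under the transfer operator.\<close>

lemma transfer_pull:
  fixes f b :: "'k \<Rightarrow> 'a::comm_semiring_0"
  shows "transfer n (\<lambda>x. f x * b ((h ^^ n) x)) y = transfer n f y * b y"
  by (simp add: transfer_def h_word sum_distrib_right)

lemma transfer_add: "transfer n (\<lambda>x. f x + g x) y = transfer n f y + transfer n g y"
  by (simp add: transfer_def sum.distrib)

lemma transfer_cmult: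
  fixes c :: "'a::comm_semiring_0"
  shows "transfer n (\<lambda>x. c * f x) y = c * transfer n f y"
  by (simp add: transfer_def sum_distrib_left)

lemma transfer_sum: "transfer n (\<lambda>x. \<Sum>i\<in>I. f i x) y = (\<Sum>i\<in>I. transfer n (f i) y)"
  unfolding transfer_def by (rule sum.swap)

lemma transfer_mono:
  fixes f g :: "'k \<Rightarrow> real"
  shows "(\<And>x. f x \<le> g x) \<Longrightarrow> transfer n f y \<le> transfer n g y"
  unfolding transfer_def by (rule sum_mono) auto

lemma transfer_nonneg:
  fixes f :: "'k \<Rightarrow> real"
  shows "(\<And>x. 0 \<le> f x) \<Longrightarrow> 0 \<le> transfer n f y"
  unfolding transfer_def by (rule sum_nonneg) auto

lemma transfer_ge_point:
  fixes f :: "'k \<Rightarrow> real"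
  assumes "\<And>x. 0 \<le> f x"
  shows "f x \<le> transfer n f ((h ^^ n) x)"
proof -
  obtain w where w: "w \<in> words n" "foldr \<gamma> w ((h ^^ n) x) = x" using word_cover by blast
  have "f (foldr \<gamma> w ((h ^^ n) x)) \<le> (\<Sum>w\<in>words n. f (foldr \<gamma> w ((h ^^ n) x)))"
    by (rule member_le_sum) (use assms w in auto)
  then show ?thesis using w by (simp add: transfer_def)
qed

lemma transfer_const: "transfer n (\<lambda>_. c :: real) y = real N ^ n * c"
  by (simp add: transfer_def card_words)

lemma transfer_of_real: "transfer n (\<lambda>x. complex_of_real (f x)) y = of_real (transfer n f y)"
  by (simp add: transfer_def)

lemma transfer_CK: "f \<in> CK \<Longrightarrow> transfer n f \<in> CK"
  unfolding transfer_def [abs_def] by (rule CK_sum, rule CK_comp[OF _ cont_word])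

section \<open>The model of the tensor powers on continuous functions\<close>

text \<open>Since \<open>x \<mapsto> (x, h x)\<close> is a homeomorphism of \<open>K\<close> onto the cograph, elements of \<open>X\<close>, and in fact
  of all its tensor powers, are continuous functions on \<open>K\<close>: an elementary tensor
  \<open>x\<^sub>1 \<otimes> \<dots> \<otimes> x\<^sub>n\<close> becomes the product of the \<open>x\<^sub>i \<circ> h\<^bsup>i-1\<^esup>\<close>. Only the right action and the inner
  product depend on \<open>n\<close>.\<close>

definition model :: "nat \<Rightarrow> ('k \<Rightarrow> complex, 'k) corr" where
  "model n = \<lparr>
     mcarrier = CK,
     madd = (\<lambda>f g x. f x + g x),
     mact = (\<lambda>f b x. f x * b ((h ^^ n) x)),
     mleft = (\<lambda>a f x. a x * f x),
     minner = (\<lambda>f g. transfer n (\<lambda>x. cnj (f x) * g x)) \<rparr>"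

lemma model_simps [simp]:
  "mcarrier (model n) = CK"
  "madd (model n) f g = (\<lambda>x. f x + g x)"
  "mact (model n) f b = (\<lambda>x. f x * b ((h ^^ n) x))"
  "mleft (model n) a f = (\<lambda>x. a x * f x)"
  "minner (model n) f g = transfer n (\<lambda>x. cnj (f x) * g x)"
  by (simp_all add: model_def)

text \<open>The function \<open>(f|f)\<close> of the \<open>n\<close>-th inner product, as a real-valued function.\<close>

definition sqnorm :: "nat \<Rightarrow> ('k \<Rightarrow> complex) \<Rightarrow> 'k \<Rightarrow> real" where
  "sqnorm n f = transfer n (\<lambda>x. (cmod (f x))\<^sup>2)"

lemma minner_self: "transfer n (\<lambda>x. cnj (f x) * f x) y = of_real (sqnorm n f y)"
  unfolding sqnorm_def transfer_of_real[symmetric]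
  by (simp add: complex_norm_square mult.commute del: of_real_power)

lemma sqnorm_nonneg [simp]: "0 \<le> sqnorm n f y"
  unfolding sqnorm_def by (rule transfer_nonneg) simp

lemma sqnorm_ge: "(cmod (f x))\<^sup>2 \<le> sqnorm n f ((h ^^ n) x)"
  unfolding sqnorm_def by (rule transfer_ge_point) simp

lemma sqnorm_mult: "sqnorm n (\<lambda>x. f x * b ((h ^^ n) x)) y = sqnorm n f y * (cmod (b y))\<^sup>2"
  unfolding sqnorm_def norm_mult power_mult_distrib
  by (rule transfer_pull[of n _ "\<lambda>y. (cmod (b y))\<^sup>2"])

lemma sqnorm_Suc: "sqnorm (Suc n) f y = (\<Sum>j=1..N. sqnorm n f (\<gamma> j y))"
  by (simp add: sqnorm_def transfer_Suc)

lemma sqnorm_L2: "sqrt (sqnorm n f y) = L2_set (\<lambda>w. cmod (f (foldr \<gamma> w y))) (words n)"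
  by (simp add: sqnorm_def transfer_def L2_set_def)

lemma sqnorm_triangle:
  "sqrt (sqnorm n (\<lambda>x. f x + g x) y) \<le> sqrt (sqnorm n f y) + sqrt (sqnorm n g y)"
  unfolding sqnorm_L2
  by (rule order_trans[OF L2_set_mono L2_set_triangle_ineq]) (auto intro: norm_triangle_ineq)

lemma sqnorm_cauchy_schwarz:
  "cmod (transfer n (\<lambda>x. cnj (f x) * g x) y) \<le> sqrt (sqnorm n f y) * sqrt (sqnorm n g y)"
proof -
  have "cmod (transfer n (\<lambda>x. cnj (f x) * g x) y) \<le>
      (\<Sum>w\<in>words n. \<bar>cmod (f (foldr \<gamma> w y))\<bar> * \<bar>cmod (g (foldr \<gamma> w y))\<bar>)"
    unfolding transfer_def by (rule order_trans[OF norm_sum]) (simp add: norm_mult)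
  also have "\<dots> \<le> sqrt (sqnorm n f y) * sqrt (sqnorm n g y)"
    unfolding sqnorm_L2 by (rule L2_set_mult_ineq)
  finally show ?thesis .
qed

lemma sqnorm_scale: "sqnorm n (\<lambda>x. f x * c) y = (cmod c)\<^sup>2 * sqnorm n f y"
  using sqnorm_mult[of n f "\<lambda>_. c" y] by simp

lemma sqnorm_cont: "f \<in> CK \<Longrightarrow> (\<lambda>y. complex_of_real (sqnorm n f y)) \<in> CK"
  unfolding minner_self[symmetric] by (intro transfer_CK CK_mult CK_cnj)

lemma sqnorm_le: "(\<And>x. cmod (f x) \<le> c) \<Longrightarrow> 0 \<le> c \<Longrightarrow> sqnorm n f y \<le> real N ^ n * c\<^sup>2"
  unfolding sqnorm_def transfer_const[symmetric, of n _ y]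
  by (rule transfer_mono) (simp add: power_mono)

lemma sqnorm_bdd: "f \<in> CK \<Longrightarrow> bdd_above (range (\<lambda>y. cmod (minner (model n) f f y)))"
  using CK_bounded[OF cpt sqnorm_cont[of f n]] by (auto simp: bdd_above_def minner_self)

lemma mnorm_le_iff:
  assumes "f \<in> CK" "0 \<le> c"
  shows "mnorm (model n) f \<le> c \<longleftrightarrow> (\<forall>y. sqnorm n f y \<le> c\<^sup>2)"
proof -
  have "mnorm (model n) f \<le> c \<longleftrightarrow> (SUP y. cmod (minner (model n) f f y)) \<le> c\<^sup>2"
    unfolding mnorm_def using assms(2) by (metis real_sqrt_le_iff real_sqrt_unique)
  also have "\<dots> \<longleftrightarrow> (\<forall>y. cmod (minner (model n) f f y) \<le> c\<^sup>2)"
    by (subst cSUP_le_iff) (use sqnorm_bdd[OF assms(1)] in auto)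
  finally show ?thesis by (simp add: minner_self)
qed

lemma mnorm_nonneg: "f \<in> CK \<Longrightarrow> 0 \<le> mnorm (model n) f"
  unfolding mnorm_def real_sqrt_ge_0_iff by (rule cSUP_upper2[OF sqnorm_bdd]) auto

lemma sqnorm_le_mnorm: "f \<in> CK \<Longrightarrow> sqnorm n f y \<le> (mnorm (model n) f)\<^sup>2"
  using mnorm_le_iff[of f "mnorm (model n) f" n] mnorm_nonneg by auto

lemma sqrt_sqnorm_le_mnorm: "f \<in> CK \<Longrightarrow> sqrt (sqnorm n f y) \<le> mnorm (model n) f"
  using sqnorm_le_mnorm mnorm_nonneg real_le_lsqrt by auto

lemma mnorm_leI:
  assumes "f \<in> CK" "0 \<le> c" "\<And>y. sqrt (sqnorm n f y) \<le> c"
  shows "mnorm (model n) f \<le> c"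
  using assms by (simp add: mnorm_le_iff sqrt_le_D)

lemma cmod_le_mnorm: "f \<in> CK \<Longrightarrow> cmod (f x) \<le> mnorm (model n) f"
  using order_trans[OF sqnorm_ge[of f x n] sqnorm_le_mnorm[of f n]] mnorm_nonneg[of f n]
  by (simp add: power2_le_iff_abs_le)

lemma mnorm_triangle:
  assumes "f \<in> CK" "g \<in> CK"
  shows "mnorm (model n) (\<lambda>x. f x + g x) \<le> mnorm (model n) f + mnorm (model n) g"
  by (rule mnorm_leI)
    (use assms in \<open>auto intro: CK_add add_nonneg_nonneg mnorm_nonneg
       order_trans[OF sqnorm_triangle add_mono] sqrt_sqnorm_le_mnorm\<close>)

lemma mnorm_le_sup:
  assumes "f \<in> CK" "0 \<le> c" "\<And>x. cmod (f x) \<le> c"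
  shows "mnorm (model n) f \<le> sqrt (real N ^ n) * c"
  using assms sqnorm_le[of f c n] by (subst mnorm_le_iff) (auto simp: power_mult_distrib)

lemma mnorm_minus_commute: "mnorm (model n) (\<lambda>x. f x - g x) = mnorm (model n) (\<lambda>x. g x - f x)"
  by (simp add: mnorm_def algebra_simps)

end

section \<open>Adjointable operators on the model\<close>

text \<open>The uniform boundedness principle for seminorms. Since \<open>2 p z \<le> p (a + z) + p (a - z)\<close>,
  an unbounded family takes arbitrarily large values in every ball; nested balls on which the
  values exceed \<open>0, 1, 2, \<dots>\<close> shrink to a point at which the family is unbounded.\<close>

lemma uniform_boundedness:
  fixes p :: "'i \<Rightarrow> 'b::{real_normed_vector,complete_space} \<Rightarrow> real"
  assumes sub: "\<And>i x y. p i (x + y) \<le> p i x + p i y"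
    and hom: "\<And>i c x. p i (c *\<^sub>R x) = \<bar>c\<bar> * p i x"
    and bnd: "\<And>i. \<exists>C. \<forall>x. p i x \<le> C * norm x"
    and pt: "\<And>x. \<exists>B. \<forall>i. p i x \<le> B"
  shows "\<exists>C. \<forall>i x. p i x \<le> C * norm x"
proof (rule ccontr)
  assume neg: "\<not> ?thesis"
  have p_minus: "p i (x - y) \<le> p i x + p i y" for i x y
    using sub[of i x "- y"] hom[of i "-1" y] by simp
  have large: "\<exists>z i. norm z \<le> r \<and> p i (a + z) > M" if r: "r > 0" for a r M
  proof -
    obtain i x where ix: "p i x > \<bar>M\<bar> / r * norm x"
      using neg by (meson not_le)
    have x0: "x \<noteq> 0"
      using ix hom[of i 0 0] by auto
    define z where "z = (r / norm x) *\<^sub>R x"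
    have nz: "norm z = r" using x0 r by (simp add: z_def)
    have "p i z > \<bar>M\<bar>"
      using ix x0 r by (simp add: z_def hom field_simps)
    moreover have "2 * p i z \<le> p i (a + z) + p i (a - z)"
      using p_minus[of i "a + z" "a - z"] hom[of i 2 z] by (simp add: scaleR_2)
    ultimately have "p i (a + z) > M \<or> p i (a + - z) > M" by auto
    then show ?thesis using nz by (metis norm_minus_cancel order_refl)
  qed
  have step: "\<exists>a' r'. r' > 0 \<and> r' \<le> inverse (real (Suc k)) \<and> cball a' r' \<subseteq> cball a r \<and>
      (\<exists>i. \<forall>y\<in>cball a' r'. p i y > M)" if r: "r > 0" for a r k M
  proof -
    obtain z i where z: "norm z \<le> r / 2" "p i (a + z) > M" using large[of "r / 2" M a] r by auto
    obtain C where C: "\<And>x. p i x \<le> C * norm x" using bnd by blast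
    define C' where "C' = max C 1"
    have C': "p i x \<le> C' * norm x" for x
      using C[of x] by (rule order_trans) (auto simp: C'_def intro!: mult_right_mono)
    have C'_pos: "C' > 0" by (simp add: C'_def)
    define e where "e = (p i (a + z) - M) / 2"
    have e: "e > 0" using z by (simp add: e_def)
    have ik: "inverse (real (Suc k)) > 0" by simp
    define r' where "r' = min (r / 2) (min (inverse (real (Suc k))) (e / C'))"
    have r': "r' > 0" "r' \<le> r / 2" "r' \<le> inverse (real (Suc k))" "r' \<le> e / C'"
      using r e C'_pos ik unfolding r'_def
      by (simp_all only: min_less_iff_conj min_le_iff_disj divide_pos_pos order_refl simp_thms half_gt_zero)
    have "cball (a + z) r' \<subseteq> cball a r"
    proof
      fix y assume "y \<in> cball (a + z) r'"
      then have "dist (a + z) y \<le> r / 2" using r' by auto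
      moreover have "dist a (a + z) \<le> r / 2" using z by (simp add: dist_norm)
      ultimately show "y \<in> cball a r" using dist_triangle[of a y "a + z"] by simp
    qed
    moreover have "p i y > M" if "y \<in> cball (a + z) r'" for y
    proof -
      have "p i (a + z) \<le> p i y + p i (a + z - y)" using sub[of i y "a + z - y"] by simp
      also have "p i (a + z - y) \<le> C' * norm (a + z - y)" by (rule C')
      also have "\<dots> \<le> C' * (e / C')"
        using that r' C'_pos by (intro mult_left_mono) (auto simp: dist_norm)
      also have "\<dots> = e" using C'_pos by simp
      finally show ?thesis using e z by (simp add: e_def field_simps)
    qed
    ultimately show ?thesis using r' by blast
  qed
  define Q where "Q k s s' \<longleftrightarrow> cball (fst s') (snd s') \<subseteq> cball (fst s) (snd s) \<and>
      (\<exists>i. \<forall>y\<in>cball (fst s') (snd s'). p i y > real k)" for k :: nat and s s' :: "'b \<times> real"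
  have "\<exists>f. \<forall>k. (snd (f k) > 0 \<and> snd (f k) \<le> inverse (real (Suc k))) \<and> Q k (f k) (f (Suc k))"
  proof (rule dependent_nat_choice)
    show "\<exists>x :: 'b \<times> real. 0 < snd x \<and> snd x \<le> inverse (real (Suc 0))"
      by (rule exI[of _ "(0, 1)"]) simp
    fix s :: "'b \<times> real" and k
    assume "0 < snd s \<and> snd s \<le> inverse (real (Suc k))"
    then obtain a' r' where "r' > 0 \<and> r' \<le> inverse (real (Suc (Suc k))) \<and>
        cball a' r' \<subseteq> cball (fst s) (snd s) \<and> (\<exists>i. \<forall>y\<in>cball a' r'. p i y > real k)"
      using step[of "snd s" "Suc k" "fst s" "real k"] by blast
    then show "\<exists>y. (0 < snd y \<and> snd y \<le> inverse (real (Suc (Suc k)))) \<and> Q k s y"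
      by (intro exI[of _ "(a', r')"]) (auto simp: Q_def)
  qed
  then obtain f where f: "\<And>k. snd (f k) > 0" "\<And>k. snd (f k) \<le> inverse (real (Suc k))"
    "\<And>k. Q k (f k) (f (Suc k))" by blast
  define B where "B k = cball (fst (f k)) (snd (f k))" for k
  have B_step: "B (Suc k) \<subseteq> B k" for k using f(3)[of k] by (simp add: Q_def B_def)
  then have B_dec: "m \<le> k \<Longrightarrow> B k \<subseteq> B m" for m k
    by (rule lift_Suc_antimono_le)
  have cen: "fst (f k) \<in> B m" if "m \<le> k" for m k
    using B_dec[OF that] f(1)[of k] by (auto simp: B_def simp del: mem_cball intro: subsetD)
  have "Cauchy (\<lambda>k. fst (f k))"
  proof (rule metric_CauchyI)
    fix e :: real assume "e > 0"
    then obtain M where M: "inverse (real (Suc M)) < e / 2" using reals_Archimedean[of "e / 2"] by auto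
    have "dist (fst (f M)) (fst (f k)) < e / 2" if "M \<le> k" for k
      using cen[OF that] f(2)[of M] M by (simp add: B_def)
    then show "\<exists>M. \<forall>m\<ge>M. \<forall>n\<ge>M. dist (fst (f m)) (fst (f n)) < e"
      by (metis dist_commute dist_triangle_half_r)
  qed
  then obtain x where x: "(\<lambda>k. fst (f k)) \<longlonglongrightarrow> x"
    using Cauchy_convergent convergent_def by blast
  have xB: "x \<in> B m" for m
    by (rule Lim_in_closed_set[OF _ _ _ x])
      (use cen in \<open>auto simp: B_def eventually_sequentially intro!: exI[of _ m]\<close>)
  obtain C where C: "\<And>i. p i x \<le> C" using pt by blast
  obtain k :: nat where "real k > C" using reals_Archimedean2 by blast
  moreover obtain i where "p i x > real k"
    using f(3)[of k] xB[of "Suc k"] unfolding Q_def B_def by blast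
  ultimately show False using C[of i] by simp
qed

context branch_system
begin

lemma inner_nondegenerate:
  assumes "f \<in> CK" "g \<in> CK"
    and "\<And>u. u \<in> CK \<Longrightarrow> minner (model n) u f = minner (model n) u g"
  shows "f = g"
proof
  fix x
  let ?u = "\<lambda>x. f x - g x"
  have u: "?u \<in> CK" using assms by (intro CK_diff)
  have "complex_of_real (sqnorm n ?u ((h ^^ n) x)) =
      transfer n (\<lambda>x. cnj (?u x) * f x) ((h ^^ n) x) - transfer n (\<lambda>x. cnj (?u x) * g x) ((h ^^ n) x)"
    unfolding minner_self[symmetric] by (simp add: transfer_def right_diff_distrib sum_subtractf)
  also have "\<dots> = 0" using fun_cong[OF assms(3)[OF u]] by simp
  finally show "f x = g x" using sqnorm_ge[of ?u x n] by simp
qed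

lemma inner_commute: "transfer n (\<lambda>x. cnj (f x) * g x) y = cnj (transfer n (\<lambda>x. cnj (g x) * f x) y)"
  by (simp add: transfer_def mult.commute)

text \<open>The algebra \<open>\<L>(X\<^sup>\<otimes>\<^sup>n)\<close>, realised on \<open>C(K)\<close>.\<close>

definition L :: "nat \<Rightarrow> (('k \<Rightarrow> complex) \<Rightarrow> 'k \<Rightarrow> complex) set" where
  "L n = {T. \<exists>S. is_adjoint (model n) T S}"

lemma is_adjoint_CK:
  assumes "is_adjoint (model n) T S" "f \<in> CK"
  shows "T f \<in> CK" "S f \<in> CK"
  using assms by (auto simp: is_adjoint_def)

lemma is_adjointD:
  assumes "is_adjoint (model n) T S" "f \<in> CK" "g \<in> CK"
  shows "transfer n (\<lambda>x. cnj (T f x) * g x) y = transfer n (\<lambda>x. cnj (f x) * S g x) y"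
  using assms by (auto simp: is_adjoint_def dest: fun_cong)

lemma is_adjoint_sym:
  assumes "is_adjoint (model n) T S"
  shows "is_adjoint (model n) S T"
proof -
  have "transfer n (\<lambda>x. cnj (S f x) * g x) y = transfer n (\<lambda>x. cnj (f x) * T g x) y"
    if "f \<in> CK" "g \<in> CK" for f g y
    using is_adjointD[OF assms that(2,1), of y] inner_commute[of n "S f" g y] inner_commute[of n f "T g" y]
    by simp
  then show ?thesis using assms by (auto simp: is_adjoint_def fun_eq_iff)
qed

lemma is_adjoint_unique:
  assumes "is_adjoint (model n) T S" "is_adjoint (model n) T S'"
  shows "S = S'"
proof (rule extensionalityI[of _ CK])
  show "S \<in> extensional CK" "S' \<in> extensional CK"
    using assms by (auto simp: is_adjoint_def PiE_def)
  show "S f = S' f" if "f \<in> CK" for f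
    by (rule inner_nondegenerate[of _ _ n])
      (use that in \<open>simp_all add: is_adjoint_CK[OF assms(1)] is_adjoint_CK[OF assms(2)]
        is_adjointD[OF assms(1), symmetric] is_adjointD[OF assms(2), symmetric] fun_eq_iff\<close>)
qed

definition adj :: "nat \<Rightarrow> (('k \<Rightarrow> complex) \<Rightarrow> 'k \<Rightarrow> complex) \<Rightarrow> ('k \<Rightarrow> complex) \<Rightarrow> 'k \<Rightarrow> complex" where
  "adj n T = (THE S. is_adjoint (model n) T S)"

lemma adj_eq: "is_adjoint (model n) T S \<Longrightarrow> adj n T = S"
  unfolding adj_def using is_adjoint_unique by blast

lemma L_adj: "T \<in> L n \<Longrightarrow> is_adjoint (model n) T (adj n T)"
  using adj_eq by (auto simp: L_def)

lemma L_I: "is_adjoint (model n) T S \<Longrightarrow> T \<in> L n"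
  by (auto simp: L_def)

lemma adj_in_L: "T \<in> L n \<Longrightarrow> adj n T \<in> L n"
  using L_adj is_adjoint_sym L_I by blast

lemma adj_adj: "T \<in> L n \<Longrightarrow> adj n (adj n T) = T"
  using L_adj is_adjoint_sym adj_eq by blast

lemma L_CK: "T \<in> L n \<Longrightarrow> f \<in> CK \<Longrightarrow> T f \<in> CK"
  using L_adj is_adjoint_CK by blast

lemma L_extensional: "T \<in> L n \<Longrightarrow> T \<in> extensional CK"
  using L_adj by (auto simp: is_adjoint_def PiE_def)

lemma L_eqI: "T \<in> L n \<Longrightarrow> S \<in> L m \<Longrightarrow> (\<And>f. f \<in> CK \<Longrightarrow> T f = S f) \<Longrightarrow> T = S"
  using L_extensional extensionalityI by blast

lemma L_adjD: "T \<in> L n \<Longrightarrow> f \<in> CK \<Longrightarrow> g \<in> CK \<Longrightarrow>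
    transfer n (\<lambda>x. cnj (T f x) * g x) y = transfer n (\<lambda>x. cnj (f x) * adj n T g x) y"
  using L_adj is_adjointD by blast

lemma L_adjD': "T \<in> L n \<Longrightarrow> f \<in> CK \<Longrightarrow> g \<in> CK \<Longrightarrow>
    transfer n (\<lambda>x. cnj (f x) * T g x) y = transfer n (\<lambda>x. cnj (adj n T f x) * g x) y"
  using L_adjD[OF adj_in_L] by (simp add: adj_adj)

lemma L_add:
  assumes T: "T \<in> L n" and fg: "f \<in> CK" "g \<in> CK"
  shows "T (\<lambda>x. f x + g x) = (\<lambda>x. T f x + T g x)"
proof (rule inner_nondegenerate[of _ _ n])
  show "T (\<lambda>x. f x + g x) \<in> CK" "(\<lambda>x. T f x + T g x) \<in> CK"
    using fg by (auto intro!: CK_add L_CK[OF T])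
  show "minner (model n) u (T (\<lambda>x. f x + g x)) = minner (model n) u (\<lambda>x. T f x + T g x)"
    if u: "u \<in> CK" for u
    using T fg u CK_add[OF fg] by (simp add: fun_eq_iff L_adjD' distrib_left transfer_add)
qed

text \<open>Moving \<open>T\<close> to the other side of the inner product leaves \<open>b \<circ> h\<^sup>n\<close> as a factor that can be pulled out.\<close>

lemma L_right:
  assumes T: "T \<in> L n" and f: "f \<in> CK" and b: "b \<in> CK"
  shows "T (\<lambda>x. f x * b ((h ^^ n) x)) = (\<lambda>x. T f x * b ((h ^^ n) x))"
proof (rule inner_nondegenerate[of _ _ n])
  have b': "(\<lambda>x. b ((h ^^ n) x)) \<in> CK" using b cont_hn by (rule CK_comp)
  have fb: "(\<lambda>x. f x * b ((h ^^ n) x)) \<in> CK" using f b' by (rule CK_mult)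
  show "T (\<lambda>x. f x * b ((h ^^ n) x)) \<in> CK" "(\<lambda>x. T f x * b ((h ^^ n) x)) \<in> CK"
    using f fb b' by (auto intro!: CK_mult L_CK[OF T])
  show "minner (model n) u (T (\<lambda>x. f x * b ((h ^^ n) x))) =
      minner (model n) u (\<lambda>x. T f x * b ((h ^^ n) x))"
    if u: "u \<in> CK" for u
  proof -
    have "transfer n (\<lambda>x. cnj (u x) * T (\<lambda>x. f x * b ((h ^^ n) x)) x) y =
        transfer n (\<lambda>x. (cnj (adj n T u x) * f x) * b ((h ^^ n) x)) y" for y
      using L_adjD'[OF T u fb] by (simp add: mult.assoc)
    moreover have "transfer n (\<lambda>x. (cnj (adj n T u x) * f x) * b ((h ^^ n) x)) y =
        transfer n (\<lambda>x. (cnj (u x) * T f x) * b ((h ^^ n) x)) y" for y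
      using transfer_pull[of n "\<lambda>x. cnj (adj n T u x) * f x" b y]
        transfer_pull[of n "\<lambda>x. cnj (u x) * T f x" b y] L_adjD'[OF T u f, of y] by simp
    ultimately show ?thesis by (simp add: fun_eq_iff mult.assoc)
  qed
qed

lemma L_scale:
  assumes "T \<in> L n" "f \<in> CK"
  shows "T (\<lambda>x. f x * c) = (\<lambda>x. T f x * c)"
  using L_right[OF assms, of "\<lambda>_. c"] by simp

lemma L_diff:
  assumes T: "T \<in> L n" and fg: "f \<in> CK" "g \<in> CK"
  shows "T (\<lambda>x. f x - g x) = (\<lambda>x. T f x - T g x)"
proof -
  have "T (\<lambda>x. f x + g x * (-1)) = (\<lambda>x. T f x + T g x * (-1))"
    using L_add[OF T fg(1) CK_mult[OF fg(2) CK_const[of "-1"]]] L_scale[OF T fg(2), of "-1"] by simp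
  then show ?thesis by simp
qed

text \<open>An adjointable operator acts fibrewise: \<open>(Tf|Tf)\<close> at \<open>y\<close> equals \<open>(f|T\<^sup>*Tf)\<close> at \<open>y\<close>,
  which sees \<open>f\<close> on the fibre over \<open>y\<close> only.\<close>

lemma L_fibre_zero:
  assumes T: "T \<in> L n" and f: "f \<in> CK" and z: "\<And>x. (h ^^ n) x = y \<Longrightarrow> f x = 0"
    and x: "(h ^^ n) x = y"
  shows "T f x = 0"
proof -
  have "complex_of_real (sqnorm n (T f) y) = transfer n (\<lambda>x. cnj (f x) * adj n T (T f) x) y"
    unfolding minner_self[symmetric] by (rule L_adjD[OF T f L_CK[OF T f]])
  also have "\<dots> = transfer n (\<lambda>x. 0) y" by (rule transfer_cong) (simp add: z)
  also have "\<dots> = 0" by (simp add: transfer_def)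
  finally show ?thesis using sqnorm_ge[of "T f" x n] x by simp
qed

lemma L_fibre_cong:
  assumes T: "T \<in> L n" and fg: "f \<in> CK" "g \<in> CK"
    and eq: "\<And>x'. (h ^^ n) x' = (h ^^ n) x \<Longrightarrow> f x' = g x'"
  shows "T f x = T g x"
proof -
  have "T (\<lambda>x. f x - g x) x = 0"
    by (rule L_fibre_zero[OF T CK_diff[OF fg] _ refl]) (simp add: eq)
  then show ?thesis using L_diff[OF T fg] by simp
qed

text \<open>Tensoring with the identity of \<open>X\<close> turns into an inclusion of operator algebras on \<open>C(K)\<close>:
  an adjoint for the \<open>n\<close>-th inner product is an adjoint for the next one, which is obtained
  by applying the transfer operator to it.\<close>

lemma is_adjoint_Suc: "is_adjoint (model n) T S \<Longrightarrow> is_adjoint (model (Suc n)) T S"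
  by (simp add: is_adjoint_def fun_eq_iff transfer_Suc)

lemma is_adjoint_mono: "n \<le> m \<Longrightarrow> is_adjoint (model n) T S \<Longrightarrow> is_adjoint (model m) T S"
  by (induction m rule: dec_induct) (auto intro: is_adjoint_Suc)

lemma L_mono: "n \<le> m \<Longrightarrow> T \<in> L n \<Longrightarrow> T \<in> L m"
  by (rule L_I, rule is_adjoint_mono, assumption, rule L_adj)

lemma adj_mono: "n \<le> m \<Longrightarrow> T \<in> L n \<Longrightarrow> adj m T = adj n T"
  using L_adj adj_eq is_adjoint_mono by blast

text \<open>The operations of \<open>\<L>(X\<^sup>\<otimes>\<^sup>n)\<close>, which except for the adjoint and the norm do not depend on \<open>n\<close>.\<close>

definition opadd where "opadd T S = (\<lambda>f\<in>CK. \<lambda>x::'k. T f x + S f x :: complex)"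
definition opscale where "opscale c T = (\<lambda>f\<in>CK. \<lambda>x::'k. T f x * c :: complex)"
definition opmult where "opmult T S = (\<lambda>f\<in>(CK::('k \<Rightarrow> complex) set). T (S f :: 'k \<Rightarrow> complex) :: 'k \<Rightarrow> complex)"
definition multop where "multop a = (\<lambda>f\<in>CK. \<lambda>x::'k. a x * f x :: complex)"

lemma op_apply:
  "f \<in> CK \<Longrightarrow> opadd T S f = (\<lambda>x. T f x + S f x)"
  "f \<in> CK \<Longrightarrow> opscale c T f = (\<lambda>x. T f x * c)"
  "f \<in> CK \<Longrightarrow> opmult T S f = T (S f)"
  "f \<in> CK \<Longrightarrow> multop a f = (\<lambda>x. a x * f x)"
  by (simp_all add: opadd_def opscale_def opmult_def multop_def)

lemma theta_apply: "f \<in> CK \<Longrightarrow>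
    theta (model n) u v f = (\<lambda>x. u x * transfer n (\<lambda>x. cnj (v x) * f x) ((h ^^ n) x))"
  by (simp add: theta_def)

definition nrm where "nrm n = snorm (adjointables (model n))"

lemma adjointables_model:
  "scarrier (adjointables (model n)) = L n"
  "sadd (adjointables (model n)) = opadd"
  "sscale (adjointables (model n)) = opscale"
  "smult (adjointables (model n)) = opmult"
  "sstar (adjointables (model n)) = adj n"
  "snorm (adjointables (model n)) = nrm n"
  by (simp_all add: adjointables_def L_def opadd_def opscale_def opmult_def adj_def nrm_def fun_eq_iff)

lemma is_adjointI:
  assumes "T \<in> extensional CK" "S \<in> extensional CK"
    "\<And>f. f \<in> CK \<Longrightarrow> T f \<in> CK" "\<And>f. f \<in> CK \<Longrightarrow> S f \<in> CK"
    "\<And>f g y. f \<in> CK \<Longrightarrow> g \<in> CK \<Longrightarrow>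
      transfer n (\<lambda>x. cnj (T f x) * g x) y = transfer n (\<lambda>x. cnj (f x) * S g x) y"
  shows "is_adjoint (model n) T S"
  using assms by (auto simp: is_adjoint_def PiE_def fun_eq_iff)

lemma is_adjoint_opadd:
  assumes "is_adjoint (model n) T T'" "is_adjoint (model n) S S'"
  shows "is_adjoint (model n) (opadd T S) (opadd T' S')"
  by (rule is_adjointI)
    (auto simp: opadd_def CK_add is_adjoint_CK[OF assms(1)] is_adjoint_CK[OF assms(2)]
      distrib_left distrib_right transfer_add is_adjointD[OF assms(1)] is_adjointD[OF assms(2)])

lemma is_adjoint_opscale:
  assumes "is_adjoint (model n) T T'"
  shows "is_adjoint (model n) (opscale c T) (opscale (cnj c) T')"
proof (rule is_adjointI)
  fix f g :: "'k \<Rightarrow> complex" and y assume fg: "f \<in> CK" "g \<in> CK"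
  have "transfer n (\<lambda>x. cnj (T f x * c) * g x) y = cnj c * transfer n (\<lambda>x. cnj (T f x) * g x) y"
    unfolding transfer_cmult[symmetric] by (simp add: mult_ac)
  also have "\<dots> = transfer n (\<lambda>x. cnj (f x) * (T' g x * cnj c)) y"
    unfolding is_adjointD[OF assms fg] transfer_cmult[symmetric] by (simp add: mult_ac)
  finally show "transfer n (\<lambda>x. cnj (opscale c T f x) * g x) y =
      transfer n (\<lambda>x. cnj (f x) * opscale (cnj c) T' g x) y"
    using fg by (simp add: opscale_def)
qed (auto simp: opscale_def CK_mult is_adjoint_CK[OF assms(1)])

lemma is_adjoint_opmult:
  assumes "is_adjoint (model n) T T'" "is_adjoint (model n) S S'"
  shows "is_adjoint (model n) (opmult T S) (opmult S' T')"
  by (rule is_adjointI)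
    (auto simp: opmult_def is_adjoint_CK[OF assms(1)] is_adjoint_CK[OF assms(2)]
      is_adjointD[OF assms(1)] is_adjointD[OF assms(2)])

lemma is_adjoint_multop:
  assumes "a \<in> CK"
  shows "is_adjoint (model n) (multop a) (multop (\<lambda>x. cnj (a x)))"
  by (rule is_adjointI) (auto simp: multop_def CK_mult CK_cnj assms mult_ac)

lemma inner_CK: "u \<in> CK \<Longrightarrow> v \<in> CK \<Longrightarrow> transfer n (\<lambda>x. cnj (u x) * v x) \<in> CK"
  by (intro transfer_CK CK_mult CK_cnj)

lemma is_adjoint_theta:
  assumes uv: "u \<in> CK" "v \<in> CK"
  shows "is_adjoint (model n) (theta (model n) u v) (theta (model n) v u)"
proof (rule is_adjointI)
  fix f g :: "'k \<Rightarrow> complex" and y assume fg: "f \<in> CK" "g \<in> CK"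
  let ?b = "transfer n (\<lambda>x. cnj (v x) * f x)"
  have "transfer n (\<lambda>x. cnj (u x * ?b ((h ^^ n) x)) * g x) y =
      transfer n (\<lambda>x. (cnj (u x) * g x) * cnj (?b ((h ^^ n) x))) y" by (simp add: mult_ac)
  also have "\<dots> = transfer n (\<lambda>x. cnj (u x) * g x) y * cnj (?b y)"
    by (rule transfer_pull[of n _ "\<lambda>x. cnj (?b x)"])
  also have "\<dots> = transfer n (\<lambda>x. cnj (f x) * v x) y * transfer n (\<lambda>x. cnj (u x) * g x) y"
    using inner_commute[of n f v y] by (simp add: mult_ac)
  also have "\<dots> = transfer n (\<lambda>x. cnj (f x) * v x * transfer n (\<lambda>x. cnj (u x) * g x) ((h ^^ n) x)) y"
    by (rule transfer_pull[symmetric])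
  finally show "transfer n (\<lambda>x. cnj (theta (model n) u v f x) * g x) y =
      transfer n (\<lambda>x. cnj (f x) * theta (model n) v u g x) y"
    using fg by (simp add: theta_apply mult_ac)
qed (use assms in \<open>auto simp: theta_def intro!: CK_mult CK_comp[OF _ cont_hn] inner_CK\<close>)

lemma L_closed:
  "T \<in> L n \<Longrightarrow> S \<in> L n \<Longrightarrow> opadd T S \<in> L n"
  "T \<in> L n \<Longrightarrow> S \<in> L n \<Longrightarrow> opmult T S \<in> L n"
  "T \<in> L n \<Longrightarrow> opscale c T \<in> L n"
  "a \<in> CK \<Longrightarrow> multop a \<in> L n"
  "u \<in> CK \<Longrightarrow> v \<in> CK \<Longrightarrow> theta (model n) u v \<in> L n"
  by (blast intro: L_I dest: L_adj is_adjoint_opadd is_adjoint_opmult is_adjoint_opscale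
    is_adjoint_multop is_adjoint_theta)+

lemma adj_simps:
  "T \<in> L n \<Longrightarrow> S \<in> L n \<Longrightarrow> adj n (opadd T S) = opadd (adj n T) (adj n S)"
  "T \<in> L n \<Longrightarrow> S \<in> L n \<Longrightarrow> adj n (opmult T S) = opmult (adj n S) (adj n T)"
  "T \<in> L n \<Longrightarrow> adj n (opscale c T) = opscale (cnj c) (adj n T)"
  "a \<in> CK \<Longrightarrow> adj n (multop a) = multop (\<lambda>x. cnj (a x))"
  "u \<in> CK \<Longrightarrow> v \<in> CK \<Longrightarrow> adj n (theta (model n) u v) = theta (model n) v u"
  by (auto intro!: adj_eq is_adjoint_opadd is_adjoint_opmult is_adjoint_opscale
    is_adjoint_multop is_adjoint_theta L_adj)

lemma theta_mult_left:
  assumes "T \<in> L n" "u \<in> CK" "v \<in> CK"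
  shows "opmult T (theta (model n) u v) = theta (model n) (T u) v"
  by (rule L_eqI[of _ n _ n])
    (use assms in \<open>auto simp: op_apply theta_apply L_right inner_CK L_CK intro!: L_closed\<close>)

lemma theta_mult_right:
  assumes "T \<in> L n" "u \<in> CK" "v \<in> CK"
  shows "opmult (theta (model n) u v) T = theta (model n) u (adj n T v)"
  by (rule L_eqI[of _ n _ n])
    (use assms L_CK[OF adj_in_L] in \<open>auto simp: op_apply theta_apply L_adjD' L_CK intro!: L_closed\<close>)

section \<open>The operator norm\<close>

text \<open>An operator with an adjoint is bounded, so the supremum in the operator norm is a true supremum.
  The functionals \<open>g \<mapsto> (Tf|g)(y)\<close>, for \<open>f\<close> in the unit ball and \<open>y \<in> K\<close>, are bounded at each \<open>g\<close>,
  being equal to \<open>(f|T\<^sup>*g)(y)\<close>; hence they are uniformly bounded.\<close>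

lemma adjointable_bounded:
  assumes T: "T \<in> L n"
  shows "\<exists>C\<ge>0. \<forall>f\<in>CK. mnorm (model n) f \<le> 1 \<longrightarrow> mnorm (model n) (T f) \<le> C"
proof -
  let ?S = "adj n T"
  define I where "I = {(f, y :: 'k). f \<in> CK \<and> mnorm (model n) f \<le> 1}"
  define p where "p i G = (if i \<in> I then
    cmod (transfer n (\<lambda>x. cnj (T (fst i) x) * apply_bcontfun G x) (snd i)) else 0)"
    for i :: "('k \<Rightarrow> complex) \<times> 'k" and G :: "'k \<Rightarrow>\<^sub>C complex"
  have G_CK: "apply_bcontfun G \<in> CK" for G :: "'k \<Rightarrow>\<^sub>C complex"
    by (auto simp: CK_def)
  have "\<exists>C. \<forall>i G. p i G \<le> C * norm G"
  proof (rule uniform_boundedness[of p])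
    fix i :: "('k \<Rightarrow> complex) \<times> 'k" and G G' :: "'k \<Rightarrow>\<^sub>C complex" and c :: real
    show "p i (G + G') \<le> p i G + p i G'"
      by (auto simp: p_def plus_bcontfun.rep_eq distrib_left transfer_add intro: norm_triangle_ineq)
    have "transfer n (\<lambda>x. cnj (T (fst i) x) * (c *\<^sub>R apply_bcontfun G x)) (snd i) =
        complex_of_real c * transfer n (\<lambda>x. cnj (T (fst i) x) * apply_bcontfun G x) (snd i)"
      unfolding transfer_cmult[symmetric] by (simp add: scaleR_conv_of_real mult_ac)
    then show "p i (c *\<^sub>R G) = \<bar>c\<bar> * p i G"
      by (simp add: p_def scaleR_bcontfun.rep_eq norm_mult)
  next
    fix i :: "('k \<Rightarrow> complex) \<times> 'k"
    have "p i G \<le> (mnorm (model n) (T (fst i)) * sqrt (real N ^ n)) * norm G"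
      if i: "i \<in> I" for G
    proof -
      have Tf: "T (fst i) \<in> CK" using i T by (auto simp: I_def L_CK)
      have "p i G \<le> sqrt (sqnorm n (T (fst i)) (snd i)) * sqrt (sqnorm n (apply_bcontfun G) (snd i))"
        using i by (simp add: p_def sqnorm_cauchy_schwarz)
      also have "\<dots> \<le> mnorm (model n) (T (fst i)) * mnorm (model n) (apply_bcontfun G)"
        using Tf G_CK by (intro mult_mono) (auto intro: sqrt_sqnorm_le_mnorm mnorm_nonneg)
      also have "\<dots> \<le> mnorm (model n) (T (fst i)) * (sqrt (real N ^ n) * norm G)"
        using Tf G_CK by (intro mult_left_mono mnorm_le_sup) (auto intro: norm_bounded mnorm_nonneg)
      finally show ?thesis by (simp add: mult_ac)
    qed
    then show "\<exists>C. \<forall>G. p i G \<le> C * norm G"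
      by (cases "i \<in> I") (auto simp: p_def intro: exI[of _ 0])
  next
    fix G :: "'k \<Rightarrow>\<^sub>C complex"
    have "p i G \<le> mnorm (model n) (?S (apply_bcontfun G))" for i
    proof (cases "i \<in> I")
      case True
      obtain f y where i: "i = (f, y)" by (cases i)
      then have f: "f \<in> CK" "mnorm (model n) f \<le> 1" using True by (auto simp: I_def)
      have SG: "?S (apply_bcontfun G) \<in> CK" using T G_CK adj_in_L L_CK by blast
      have "p i G = cmod (transfer n (\<lambda>x. cnj (f x) * ?S (apply_bcontfun G) x) y)"
        using True i L_adjD[OF T f(1) G_CK] by (simp add: p_def)
      also have "\<dots> \<le> sqrt (sqnorm n f y) * sqrt (sqnorm n (?S (apply_bcontfun G)) y)"
        by (rule sqnorm_cauchy_schwarz)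
      also have "\<dots> \<le> 1 * mnorm (model n) (?S (apply_bcontfun G))"
        using f SG by (intro mult_mono order_trans[OF sqrt_sqnorm_le_mnorm f(2)])
          (auto intro: sqrt_sqnorm_le_mnorm mnorm_nonneg)
      finally show ?thesis by simp
    next
      case False
      then show ?thesis using T G_CK adj_in_L L_CK mnorm_nonneg by (simp add: p_def) blast
    qed
    then show "\<exists>B. \<forall>i. p i G \<le> B" by blast
  qed
  then obtain C where C: "\<And>i G. p i G \<le> C * norm G" by blast
  \<comment> \<open>Testing the uniform bound on \<open>g = Tf\<close> gives \<open>m\<^sup>2 \<le> \<bar>C\<bar> m\<close> for the norm \<open>m\<close> of \<open>Tf\<close>.\<close>
  have "mnorm (model n) (T f) \<le> \<bar>C\<bar>" if f: "f \<in> CK" "mnorm (model n) f \<le> 1" for f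
  proof -
    define m where "m = mnorm (model n) (T f)"
    have Tf: "T f \<in> CK" using T f L_CK by blast
    have m: "m \<ge> 0" using Tf by (simp add: m_def mnorm_nonneg)
    have "T f \<in> bcontfun"
      unfolding bcontfun_def using Tf CK_bounded[OF cpt Tf] by (auto simp: CK_def bounded_iff)
    then have G: "apply_bcontfun (Bcontfun (T f)) = T f" by (rule Bcontfun_inverse)
    have "norm (Bcontfun (T f)) \<le> m"
      by (rule norm_bound) (simp add: G m_def cmod_le_mnorm Tf)
    then have "\<bar>C\<bar> * norm (Bcontfun (T f)) \<le> \<bar>C\<bar> * m" by (rule mult_left_mono) simp
    moreover have "C * norm (Bcontfun (T f)) \<le> \<bar>C\<bar> * norm (Bcontfun (T f))"
      by (rule mult_right_mono) auto
    ultimately have le: "p (f, y) (Bcontfun (T f)) \<le> \<bar>C\<bar> * m" for y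
      using C[of "(f, y)" "Bcontfun (T f)"] by simp
    have "sqnorm n (T f) y \<le> \<bar>C\<bar> * m" for y
      using le[of y] f by (simp add: p_def I_def G minner_self)
    then have "m \<le> sqrt (\<bar>C\<bar> * m)"
      unfolding m_def by (subst mnorm_le_iff) (use Tf m in \<open>auto simp: m_def\<close>)
    then have "m\<^sup>2 \<le> \<bar>C\<bar> * m"
      using m by (metis real_sqrt_le_iff real_sqrt_unique)
    then show ?thesis unfolding m_def[symmetric] using m
      by (cases "m = 0") (auto simp: power2_eq_square)
  qed
  then show ?thesis by (intro exI[of _ "\<bar>C\<bar>"]) auto
qed

lemma nrm_bdd:
  assumes "T \<in> L n"
  shows "bdd_above ((\<lambda>x. mnorm (model n) (T x)) ` {x \<in> CK. mnorm (model n) x \<le> 1})"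
  using adjointable_bounded[OF assms] by (auto simp: bdd_above_def)

lemma nrm_eq: "nrm n T = (SUP x\<in>{x\<in>CK. mnorm (model n) x \<le> 1}. mnorm (model n) (T x))"
  by (simp add: nrm_def adjointables_def)

lemma mnorm_zero: "mnorm (model n) (\<lambda>x. 0) = 0"
  by (simp add: mnorm_def transfer_def)

lemma nrm_nonneg: "T \<in> L n \<Longrightarrow> 0 \<le> nrm n T"
  unfolding nrm_eq
  by (rule cSUP_upper2[OF nrm_bdd, where x = "\<lambda>_. 0"]) (auto simp: mnorm_zero mnorm_nonneg L_CK)

text \<open>Rescaling \<open>f\<close> by \<open>(f|f)\<^bsup>-1/2\<^esup>\<close> through the right action localises the operator norm: it is the
  least \<open>c\<close> such that \<open>(Tf|Tf) \<le> c\<^sup>2 (f|f)\<close> pointwise.\<close>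

lemma nrm_le_iff:
  assumes T: "T \<in> L n" and c: "0 \<le> c"
  shows "nrm n T \<le> c \<longleftrightarrow> (\<forall>f\<in>CK. \<forall>y. sqnorm n (T f) y \<le> c\<^sup>2 * sqnorm n f y)"
proof
  assume le: "nrm n T \<le> c"
  show "\<forall>f\<in>CK. \<forall>y. sqnorm n (T f) y \<le> c\<^sup>2 * sqnorm n f y"
  proof (intro ballI allI)
    fix f :: "'k \<Rightarrow> complex" and y
    assume f: "f \<in> CK"
    have eps: "sqnorm n (T f) y \<le> c\<^sup>2 * (sqnorm n f y + e)" if e: "e > 0" for e
    proof -
      \<comment> \<open>The shift by \<open>e\<close> keeps \<open>b\<close> continuous where \<open>(f|f)\<close> vanishes.\<close>
      define b where "b z = complex_of_real (inverse (sqrt (sqnorm n f z + e)))" for z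
      have pos: "sqnorm n f z + e > 0" for z using e by (rule add_nonneg_pos[OF sqnorm_nonneg])
      have "(\<lambda>z. Re (complex_of_real (sqnorm n f z))) = sqnorm n f" by simp
      then have "continuous_on UNIV (sqnorm n f)"
        using sqnorm_cont[OF f, of n] by (metis CK_def continuous_on_Re mem_Collect_eq)
      then have b: "b \<in> CK"
        unfolding CK_def b_def using pos
        by (auto intro!: continuous_intros simp: less_imp_neq[symmetric])
      have b2: "(cmod (b z))\<^sup>2 = inverse (sqnorm n f z + e)" for z
        using pos[of z] by (simp add: b_def power_inverse norm_inverse)
      let ?g = "\<lambda>x. f x * b ((h ^^ n) x)"
      have g: "?g \<in> CK" using f b by (intro CK_mult CK_comp[OF _ cont_hn])
      have "mnorm (model n) ?g \<le> 1"
        using pos e by (subst mnorm_le_iff[OF g]) (auto simp: sqnorm_mult b2 field_simps)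
      then have "mnorm (model n) (T ?g) \<le> c"
        using le cSUP_upper[OF _ nrm_bdd[OF T], of ?g] g by (simp add: nrm_eq)
      then have "sqnorm n (T ?g) y \<le> c\<^sup>2"
        using mnorm_le_iff[OF L_CK[OF T g] c] by blast
      then show ?thesis
        using pos[of y] unfolding L_right[OF T f b] sqnorm_mult b2 by (simp add: field_simps)
    qed
    show "sqnorm n (T f) y \<le> c\<^sup>2 * sqnorm n f y"
    proof (rule field_le_epsilon)
      fix e :: real assume e: "e > 0"
      have "c\<^sup>2 * (e / (c\<^sup>2 + 1)) \<le> e"
        using e by (simp add: field_simps add_pos_nonneg)
      then show "sqnorm n (T f) y \<le> c\<^sup>2 * sqnorm n f y + e"
        using eps[of "e / (c\<^sup>2 + 1)"] e by (simp add: distrib_left add_nonneg_pos)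
    qed
  qed
next
  assume le: "\<forall>f\<in>CK. \<forall>y. sqnorm n (T f) y \<le> c\<^sup>2 * sqnorm n f y"
  show "nrm n T \<le> c"
    unfolding nrm_eq
  proof (rule cSUP_least)
    show "{x \<in> CK. mnorm (model n) x \<le> 1} \<noteq> {}" using mnorm_zero[of n] by (auto intro!: exI[of _ "\<lambda>_. 0"])
    fix f assume f: "f \<in> {x \<in> CK. mnorm (model n) x \<le> 1}"
    then have "sqnorm n f y \<le> 1" for y using mnorm_le_iff[of f 1 n] by auto
    then have "c\<^sup>2 * sqnorm n f y \<le> c\<^sup>2 * 1" for y by (intro mult_left_mono) auto
    then show "mnorm (model n) (T f) \<le> c"
      using f le c T by (subst mnorm_le_iff) (auto simp: L_CK intro: order_trans)
  qed
qed

lemma sqnorm_le_nrm: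
  assumes "T \<in> L n" "f \<in> CK"
  shows "sqnorm n (T f) y \<le> (nrm n T)\<^sup>2 * sqnorm n f y"
  using nrm_le_iff[OF assms(1) nrm_nonneg[OF assms(1)]] assms(2) by blast

lemma sqrt_sqnorm_le_nrm:
  assumes "T \<in> L n" "f \<in> CK"
  shows "sqrt (sqnorm n (T f) y) \<le> nrm n T * sqrt (sqnorm n f y)"
  using real_sqrt_le_mono[OF sqnorm_le_nrm[OF assms, of y]] nrm_nonneg[OF assms(1)]
  by (simp add: real_sqrt_mult)

lemma nrm_leI:
  assumes T: "T \<in> L n" and c: "0 \<le> c"
    and "\<And>f y. f \<in> CK \<Longrightarrow> sqrt (sqnorm n (T f) y) \<le> c * sqrt (sqnorm n f y)"
  shows "nrm n T \<le> c"
  unfolding nrm_le_iff[OF T c]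
proof (intro ballI allI)
  fix f :: "'k \<Rightarrow> complex" and y assume "f \<in> CK"
  from assms(3)[OF this, of y] have "(sqrt (sqnorm n (T f) y))\<^sup>2 \<le> (c * sqrt (sqnorm n f y))\<^sup>2"
    by (intro power_mono) auto
  then show "sqnorm n (T f) y \<le> c\<^sup>2 * sqnorm n f y" by (simp add: power_mult_distrib)
qed

lemma nrm_opadd:
  assumes "T \<in> L n" "S \<in> L n"
  shows "nrm n (opadd T S) \<le> nrm n T + nrm n S"
proof (rule nrm_leI)
  fix f :: "'k \<Rightarrow> complex" and y assume f: "f \<in> CK"
  show "sqrt (sqnorm n (opadd T S f) y) \<le> (nrm n T + nrm n S) * sqrt (sqnorm n f y)"
    unfolding op_apply[OF f] distrib_right
    by (rule order_trans[OF sqnorm_triangle add_mono]) (use assms f in \<open>auto intro: sqrt_sqnorm_le_nrm\<close>)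
qed (use assms in \<open>auto intro: L_closed add_nonneg_nonneg nrm_nonneg\<close>)

lemma nrm_opmult:
  assumes "T \<in> L n" "S \<in> L n"
  shows "nrm n (opmult T S) \<le> nrm n T * nrm n S"
proof (rule nrm_leI)
  fix f :: "'k \<Rightarrow> complex" and y assume f: "f \<in> CK"
  have "sqrt (sqnorm n (T (S f)) y) \<le> nrm n T * sqrt (sqnorm n (S f) y)"
    by (rule sqrt_sqnorm_le_nrm[OF assms(1) L_CK[OF assms(2) f]])
  also have "\<dots> \<le> nrm n T * (nrm n S * sqrt (sqnorm n f y))"
    using assms f by (intro mult_left_mono sqrt_sqnorm_le_nrm nrm_nonneg)
  finally show "sqrt (sqnorm n (opmult T S f) y) \<le> nrm n T * nrm n S * sqrt (sqnorm n f y)"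
    by (simp add: op_apply f mult.assoc)
qed (use assms in \<open>auto intro: L_closed mult_nonneg_nonneg nrm_nonneg\<close>)

lemma nrm_opscale:
  assumes "T \<in> L n"
  shows "nrm n (opscale c T) \<le> cmod c * nrm n T"
proof (rule nrm_leI)
  fix f :: "'k \<Rightarrow> complex" and y assume f: "f \<in> CK"
  show "sqrt (sqnorm n (opscale c T f) y) \<le> cmod c * nrm n T * sqrt (sqnorm n f y)"
    using sqrt_sqnorm_le_nrm[OF assms f, of y]
    by (simp add: op_apply f sqnorm_scale real_sqrt_mult mult.assoc mult_left_mono)
qed (use assms in \<open>auto intro: L_closed mult_nonneg_nonneg nrm_nonneg\<close>)

lemma nrm_adj_le:
  assumes T: "T \<in> L n"
  shows "nrm n (adj n T) \<le> nrm n T"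
proof (rule nrm_leI)
  fix f :: "'k \<Rightarrow> complex" and y assume f: "f \<in> CK"
  let ?S = "adj n T"
  have Sf: "?S f \<in> CK" "T (?S f) \<in> CK" using T f adj_in_L L_CK by blast+
  define a where "a = sqrt (sqnorm n (?S f) y)"
  have a: "a \<ge> 0" by (simp add: a_def)
  have "complex_of_real (a\<^sup>2) = transfer n (\<lambda>x. cnj (f x) * T (?S f) x) y"
    using L_adjD'[OF T f Sf(1), of y] by (simp add: a_def minner_self)
  then have "a\<^sup>2 = cmod (transfer n (\<lambda>x. cnj (f x) * T (?S f) x) y)"
    by (metis norm_of_real abs_of_nonneg zero_le_power2)
  also have "\<dots> \<le> sqrt (sqnorm n f y) * sqrt (sqnorm n (T (?S f)) y)"
    by (rule sqnorm_cauchy_schwarz)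
  also have "\<dots> \<le> sqrt (sqnorm n f y) * (nrm n T * a)"
    unfolding a_def using T Sf by (intro mult_left_mono sqrt_sqnorm_le_nrm) auto
  finally have "a * a \<le> (nrm n T * sqrt (sqnorm n f y)) * a" by (simp add: power2_eq_square mult_ac)
  then show "a \<le> nrm n T * sqrt (sqnorm n f y)"
    using a nrm_nonneg[OF T] by (cases "a = 0") auto
qed (use T in \<open>auto intro: adj_in_L nrm_nonneg\<close>)

lemma bump:
  fixes x0 :: 'k
  assumes "finite P"
  shows "\<exists>b::'k \<Rightarrow> complex. b \<in> CK \<and> b x0 = 1 \<and> (\<forall>p\<in>P. p \<noteq> x0 \<longrightarrow> b p = 0)"
proof -
  obtain d where d: "d > 0" "\<And>p. p \<in> P \<Longrightarrow> p \<noteq> x0 \<Longrightarrow> d \<le> dist x0 p"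
    using finite_set_avoid[OF assms, of x0] by blast
  define b where "b x = complex_of_real (max 0 (1 - dist x0 x / d))" for x
  have "b \<in> CK" unfolding CK_def b_def using d by (auto intro!: continuous_intros)
  moreover have "b p = 0" if "p \<in> P" "p \<noteq> x0" for p
    using d(2)[OF that] d(1) by (simp add: b_def max_def)
  ultimately show ?thesis by (intro exI[of _ b]) (auto simp: b_def)
qed

text \<open>\<open>T \<mapsto> T \<otimes> I\<close> is isometric. The pointwise description of the norm passes to the next
  level by summation over a fibre of \<open>h\<close>; for the converse a function concentrated near a
  single point of that fibre is used as a coefficient.\<close>

lemma nrm_Suc:
  assumes T: "T \<in> L n"
  shows "nrm (Suc n) T = nrm n T"
proof (rule antisym)
  have T': "T \<in> L (Suc n)" using T by (rule L_mono[rotated]) simp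
  show "nrm (Suc n) T \<le> nrm n T"
    unfolding nrm_le_iff[OF T' nrm_nonneg[OF T]] sqnorm_Suc sum_distrib_left
    using T by (auto intro!: sum_mono sqnorm_le_nrm)
  show "nrm n T \<le> nrm (Suc n) T"
    unfolding nrm_le_iff[OF T nrm_nonneg[OF T']]
  proof (intro ballI allI)
    fix f :: "'k \<Rightarrow> complex" and y assume f: "f \<in> CK"
    let ?c = "nrm (Suc n) T"
    obtain j0 where j0: "j0 \<in> {1..N}" "\<gamma> j0 (h y) = y" using cover by blast
    obtain b :: "'k \<Rightarrow> complex" where b: "b \<in> CK" "b y = 1"
      "\<And>p. p \<in> (\<lambda>j. \<gamma> j (h y)) ` {1..N} \<Longrightarrow> p \<noteq> y \<Longrightarrow> b p = 0"
      using bump[of "(\<lambda>j. \<gamma> j (h y)) ` {1..N}" y] by auto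
    let ?g = "\<lambda>x. f x * b ((h ^^ n) x)"
    let ?J = "{j\<in>{1..N}. \<gamma> j (h y) = y}"
    have g: "?g \<in> CK" using f b by (intro CK_mult CK_comp[OF _ cont_hn])
    \<comment> \<open>In the fibre of \<open>h\<close> over \<open>h y\<close> only \<open>y\<close> survives, counted with its multiplicity.\<close>
    have eq: "sqnorm (Suc n) (\<lambda>x. u x * b ((h ^^ n) x)) (h y) = card ?J * sqnorm n u y" for u
    proof -
      have "sqnorm (Suc n) (\<lambda>x. u x * b ((h ^^ n) x)) (h y) =
          (\<Sum>j=1..N. if \<gamma> j (h y) = y then sqnorm n u y else 0)"
        unfolding sqnorm_Suc sqnorm_mult by (rule sum.cong) (use b in auto)
      also have "\<dots> = card ?J * sqnorm n u y"
        by (subst sum.inter_filter[symmetric]) auto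
      finally show ?thesis .
    qed
    have "?J \<noteq> {}" using j0 by blast
    then have J: "card ?J > 0" by (simp add: card_gt_0_iff)
    have "sqnorm (Suc n) (T ?g) (h y) \<le> ?c\<^sup>2 * sqnorm (Suc n) ?g (h y)"
      by (rule sqnorm_le_nrm[OF T' g])
    then have "card ?J * sqnorm n (T f) y \<le> card ?J * (?c\<^sup>2 * sqnorm n f y)"
      unfolding L_right[OF T f b(1)] eq by (simp add: mult_ac)
    then show "sqnorm n (T f) y \<le> ?c\<^sup>2 * sqnorm n f y"
      using J by (simp add: mult_le_cancel_left_pos)
  qed
qed

lemma nrm_mono: "n \<le> m \<Longrightarrow> T \<in> L n \<Longrightarrow> nrm m T = nrm n T"
  by (induction m rule: dec_induct) (auto simp: nrm_Suc L_mono)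

end

section \<open>Compact operators and the levels of the core\<close>

context branch_system
begin

abbreviation opdist where
  "opdist n T S \<equiv> nrm n (opadd T (opscale (-1) S))"

lemma sdist_model: "sdist (adjointables (model n)) T S = opdist n T S"
  by (simp add: sdist_def adjointables_model)

lemma opdist_nonneg: "T \<in> L n \<Longrightarrow> S \<in> L n \<Longrightarrow> 0 \<le> opdist n T S"
  by (intro nrm_nonneg L_closed)

lemma opdist_commute:
  assumes "T \<in> L n" "S \<in> L n"
  shows "opdist n T S = opdist n S T"
proof -
  have "opdist n T S \<le> opdist n S T" if "T \<in> L n" "S \<in> L n" for T S
  proof -
    have "opadd T (opscale (-1) S) = opscale (-1) (opadd S (opscale (-1) T))"
      by (rule L_eqI[of _ n _ n]) (use that in \<open>auto simp: op_apply intro!: L_closed\<close>)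
    then show ?thesis
      using nrm_opscale[of "opadd S (opscale (-1) T)" n "-1"] that by (simp add: L_closed)
  qed
  then show ?thesis using assms by (intro antisym) auto
qed

lemma opdist_triangle:
  assumes "T \<in> L n" "S \<in> L n" "R \<in> L n"
  shows "opdist n T R \<le> opdist n T S + opdist n S R"
proof -
  have "opadd T (opscale (-1) R) = opadd (opadd T (opscale (-1) S)) (opadd S (opscale (-1) R))"
    by (rule L_eqI[of _ n _ n]) (use assms in \<open>auto simp: op_apply intro!: L_closed\<close>)
  then show ?thesis using assms by (simp add: nrm_opadd L_closed)
qed

lemma opdist_refl: "T \<in> L n \<Longrightarrow> opdist n T T = 0"
proof -
  assume T: "T \<in> L n"
  have "nrm n (opadd T (opscale (-1) T)) \<le> 0"
    by (rule nrm_leI) (use T in \<open>auto simp: op_apply sqnorm_def transfer_def intro!: L_closed\<close>)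
  then show ?thesis using opdist_nonneg[OF T T] by simp
qed

lemma opdist_opadd:
  assumes "T \<in> L n" "S \<in> L n" "T' \<in> L n" "S' \<in> L n"
  shows "opdist n (opadd T S) (opadd T' S') \<le> opdist n T T' + opdist n S S'"
proof -
  have "opadd (opadd T S) (opscale (-1) (opadd T' S')) =
      opadd (opadd T (opscale (-1) T')) (opadd S (opscale (-1) S'))"
    by (rule L_eqI[of _ n _ n]) (use assms in \<open>auto simp: op_apply algebra_simps intro!: L_closed\<close>)
  then show ?thesis using assms by (simp add: nrm_opadd L_closed)
qed

lemma opdist_opscale:
  assumes "T \<in> L n" "S \<in> L n"
  shows "opdist n (opscale c T) (opscale c S) \<le> cmod c * opdist n T S"
proof -
  have "opadd (opscale c T) (opscale (-1) (opscale c S)) = opscale c (opadd T (opscale (-1) S))"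
    by (rule L_eqI[of _ n _ n]) (use assms in \<open>auto simp: op_apply algebra_simps intro!: L_closed\<close>)
  then show ?thesis using assms by (simp add: nrm_opscale L_closed)
qed

lemma opdist_left:
  assumes "T \<in> L n" "S \<in> L n" "R \<in> L n"
  shows "opdist n (opmult R T) (opmult R S) \<le> nrm n R * opdist n T S"
proof -
  have "opadd (opmult R T) (opscale (-1) (opmult R S)) = opmult R (opadd T (opscale (-1) S))"
    by (rule L_eqI[of _ n _ n]) (use assms in
      \<open>auto simp: op_apply L_diff[symmetric] L_CK intro!: L_closed\<close>)
  then show ?thesis using assms by (simp add: nrm_opmult L_closed)
qed

lemma opdist_right:
  assumes "T \<in> L n" "S \<in> L n" "R \<in> L n"
  shows "opdist n (opmult T R) (opmult S R) \<le> opdist n T S * nrm n R"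
proof -
  have "opadd (opmult T R) (opscale (-1) (opmult S R)) = opmult (opadd T (opscale (-1) S)) R"
    by (rule L_eqI[of _ n _ n]) (use assms in \<open>auto simp: op_apply L_CK intro!: L_closed\<close>)
  then show ?thesis using assms by (simp add: nrm_opmult L_closed)
qed

lemma opdist_adj:
  assumes "T \<in> L n" "S \<in> L n"
  shows "opdist n (adj n T) (adj n S) \<le> opdist n T S"
  using nrm_adj_le[of "opadd T (opscale (-1) S)" n] assms by (simp add: adj_simps L_closed)

lemma nrm_le_opdist: "T \<in> L n \<Longrightarrow> S \<in> L n \<Longrightarrow> nrm n T \<le> nrm n S + opdist n T S"
proof -
  assume TS: "T \<in> L n" "S \<in> L n"
  have "T = opadd S (opadd T (opscale (-1) S))"
    by (rule L_eqI[of _ n _ n]) (use TS in \<open>auto simp: op_apply intro!: L_closed\<close>)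
  then show ?thesis using nrm_opadd[of S n "opadd T (opscale (-1) S)"] TS by (simp add: L_closed)
qed

lemma closed_subalgebra_model:
  "closed_star_subalgebra (adjointables (model n)) D \<longleftrightarrow>
     D \<noteq> {} \<and> D \<subseteq> L n \<and> (\<forall>x\<in>D. \<forall>y\<in>D. opadd x y \<in> D \<and> opmult x y \<in> D) \<and>
     (\<forall>c. \<forall>x\<in>D. opscale c x \<in> D) \<and> (\<forall>x\<in>D. adj n x \<in> D) \<and>
     (\<forall>f. \<forall>x\<in>L n. (\<forall>k. f k \<in> D) \<and> (\<lambda>k. opdist n (f k) x) \<longlonglongrightarrow> 0 \<longrightarrow> x \<in> D)"
  by (simp add: closed_star_subalgebra_def adjointables_model sdist_model)

abbreviation KK where "KK n \<equiv> compacts (model n)"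

lemma closed_subalgebra_L: "closed_star_subalgebra (adjointables (model n)) (L n)"
  unfolding closed_subalgebra_model by (auto intro: L_closed(1-4) adj_in_L CK_const)

lemma closed_subalgebra_KK: "closed_star_subalgebra (adjointables (model n)) (KK n)"
proof -
  define S where "S = {theta (model n) x y | x y. x \<in> mcarrier (model n) \<and> y \<in> mcarrier (model n)}"
  have S: "theta (model n) (\<lambda>_. 0) (\<lambda>_. 0) \<in> S"
    unfolding S_def by (intro CollectI exI[of _ "\<lambda>_. 0"]) simp
  have KK: "x \<in> KK n \<longleftrightarrow> (\<forall>D. closed_star_subalgebra (adjointables (model n)) D \<and> S \<subseteq> D \<longrightarrow> x \<in> D)" for x
    by (auto simp: compacts_def cstar_generated_def S_def)
  have SL: "S \<subseteq> L n" by (auto simp: S_def intro: L_closed)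
  have ne: "theta (model n) (\<lambda>_. 0) (\<lambda>_. 0) \<in> KK n" unfolding KK using S by blast
  show ?thesis
    unfolding closed_subalgebra_model
  proof (intro conjI allI ballI impI)
    show "KK n \<noteq> {}" using ne by blast
    show "KK n \<subseteq> L n" using KK closed_subalgebra_L SL by blast
  next
    fix f x assume x: "x \<in> L n" "(\<forall>k::nat. f k \<in> KK n) \<and> (\<lambda>k. opdist n (f k) x) \<longlonglongrightarrow> 0"
    show "x \<in> KK n"
      unfolding KK
    proof (intro allI impI)
      fix D assume D: "closed_star_subalgebra (adjointables (model n)) D \<and> S \<subseteq> D"
      then have "\<forall>k. f k \<in> D" using x KK by blast
      then show "x \<in> D" using D x unfolding closed_subalgebra_model by blast
    qed
  qed (auto simp: KK closed_subalgebra_model)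
qed

lemma KK_closed:
  shows KK_L: "T \<in> KK n \<Longrightarrow> T \<in> L n"
    and KK_add: "T \<in> KK n \<Longrightarrow> S \<in> KK n \<Longrightarrow> opadd T S \<in> KK n"
    and KK_scale: "T \<in> KK n \<Longrightarrow> opscale c T \<in> KK n"
    and KK_adj: "T \<in> KK n \<Longrightarrow> adj n T \<in> KK n"
    and KK_lim: "\<lbrakk>\<And>k. F k \<in> KK n; T \<in> L n; (\<lambda>k. opdist n (F k) T) \<longlonglongrightarrow> 0\<rbrakk> \<Longrightarrow> T \<in> KK n"
  using closed_subalgebra_KK[of n] unfolding closed_subalgebra_model by blast+

lemma KK_theta: "u \<in> CK \<Longrightarrow> v \<in> CK \<Longrightarrow> theta (model n) u v \<in> KK n"
  by (auto simp: compacts_def cstar_generated_def)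

lemma opmult_one: "T \<in> L n \<Longrightarrow> opmult T (multop (\<lambda>_. 1)) = T"
  "T \<in> L n \<Longrightarrow> opmult (multop (\<lambda>_. 1)) T = T"
  by (rule L_eqI[of _ n _ n]; auto simp: op_apply L_CK intro!: L_closed)+

lemma opmult_opadd:
  assumes "A \<in> L n" "B \<in> L n" "T \<in> L n"
  shows "opmult T (opadd A B) = opadd (opmult T A) (opmult T B)"
    "opmult (opadd A B) T = opadd (opmult A T) (opmult B T)"
  by (rule L_eqI[of _ n _ n]; use assms in \<open>auto simp: op_apply L_add L_CK intro!: L_closed\<close>)+

lemma opmult_opscale:
  assumes "A \<in> L n" "T \<in> L n"
  shows "opmult T (opscale c A) = opscale c (opmult T A)"
    "opmult (opscale c A) T = opscale c (opmult A T)"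
  by (rule L_eqI[of _ n _ n]; use assms in \<open>auto simp: op_apply L_scale L_CK intro!: L_closed\<close>)+

lemma opmult_assoc:
  assumes "A \<in> L n" "B \<in> L n" "T \<in> L n"
  shows "opmult A (opmult B T) = opmult (opmult A B) T"
  by (rule L_eqI[of _ n _ n]) (use assms in \<open>auto simp: op_apply L_CK intro!: L_closed\<close>)

text \<open>To prove a property of all compact operators it suffices to check rank-one operators and
  to show that it passes to linear combinations and limits; closure under products and
  adjoints comes for free. The operators \<open>S\<close> such that \<open>TSR\<close> and \<open>TS\<^sup>*R\<close> have the property for
  all \<open>T\<close> and \<open>R\<close> form a \<open>C\<^sup>*\<close>-subalgebra, since \<open>T \<theta>\<^bsub>u,v\<^esub> R\<close> has rank one again.\<close>

lemma KK_induct [consumes 1, case_names theta add scale lim]: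
  assumes S: "S \<in> KK n"
    and theta: "\<And>u v. u \<in> CK \<Longrightarrow> v \<in> CK \<Longrightarrow> P (theta (model n) u v)"
    and add: "\<And>A B. A \<in> L n \<Longrightarrow> B \<in> L n \<Longrightarrow> P A \<Longrightarrow> P B \<Longrightarrow> P (opadd A B)"
    and scale: "\<And>c A. A \<in> L n \<Longrightarrow> P A \<Longrightarrow> P (opscale c A)"
    and lim: "\<And>F A. (\<And>k::nat. F k \<in> L n) \<Longrightarrow> (\<And>k. P (F k)) \<Longrightarrow> A \<in> L n \<Longrightarrow>
      (\<lambda>k. opdist n (F k) A) \<longlonglongrightarrow> 0 \<Longrightarrow> P A"
  shows "P S"
proof -
  define D where "D = {S \<in> L n. \<forall>T\<in>L n. \<forall>R\<in>L n.
      P (opmult T (opmult S R)) \<and> P (opmult T (opmult (adj n S) R))}"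
  note Lc = L_closed adj_in_L
  have th: "theta (model n) u v \<in> D" if "u \<in> CK" "v \<in> CK" for u v
    unfolding D_def
    by (use that in \<open>auto simp: theta_mult_right theta_mult_left adj_simps L_CK[OF adj_in_L] L_CK
      intro!: theta L_closed\<close>)
  have "closed_star_subalgebra (adjointables (model n)) D"
    unfolding closed_subalgebra_model
  proof (intro conjI allI ballI impI)
    show "D \<noteq> {}" using th[OF CK_const CK_const] by blast
    show "D \<subseteq> L n" by (auto simp: D_def)
    fix A B assume A: "A \<in> D" and B: "B \<in> D"
    then have AB: "A \<in> L n" "B \<in> L n" by (auto simp: D_def)
    show "opadd A B \<in> D"
      using A B AB unfolding D_def
      by (auto simp: adj_simps opmult_opadd[where n = n] Lc intro!: add)
    have "P (opmult T (opmult (opmult A B) R)) \<and> P (opmult T (opmult (adj n (opmult A B)) R))"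
      if TR: "T \<in> L n" "R \<in> L n" for T R
    proof
      have "P (opmult T (opmult A (opmult B R)))"
        using A AB TR by (auto simp: D_def Lc)
      then show "P (opmult T (opmult (opmult A B) R))"
        using AB TR by (simp add: opmult_assoc[of A n B R])
      have "P (opmult T (opmult (adj n B) (opmult (adj n A) R)))"
        using B AB TR by (auto simp: D_def Lc)
      then show "P (opmult T (opmult (adj n (opmult A B)) R))"
        using AB TR by (simp add: adj_simps opmult_assoc[of "adj n B" n "adj n A" R] Lc)
    qed
    then show "opmult A B \<in> D" using AB by (auto simp: D_def Lc)
  next
    fix c A assume A: "A \<in> D"
    then have "A \<in> L n" by (auto simp: D_def)
    then show "opscale c A \<in> D"
      using A unfolding D_def
      by (auto simp: adj_simps opmult_opscale[where n = n] Lc intro!: scale)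
  next
    fix A assume A: "A \<in> D"
    then show "adj n A \<in> D" unfolding D_def by (auto simp: adj_adj Lc)
  next
    fix F A assume A: "A \<in> L n" and "(\<forall>k::nat. F k \<in> D) \<and> (\<lambda>k. opdist n (F k) A) \<longlonglongrightarrow> 0"
    then have F: "\<And>k. F k \<in> D" and l: "(\<lambda>k. opdist n (F k) A) \<longlonglongrightarrow> 0" by auto
    then have FL: "\<And>k. F k \<in> L n" by (auto simp: D_def)
    have l': "(\<lambda>k. opdist n (adj n (F k)) (adj n A)) \<longlonglongrightarrow> 0"
      by (rule real_tendsto_sandwich[OF _ _ tendsto_const l])
        (use FL A in \<open>auto intro!: always_eventually opdist_nonneg opdist_adj adj_in_L\<close>)
    have *: "P (opmult T (opmult A' R))"
      if TR: "T \<in> L n" "R \<in> L n" and A': "A' \<in> L n" "\<And>k. F' k \<in> L n"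
        "(\<lambda>k. opdist n (F' k) A') \<longlonglongrightarrow> 0" "\<And>k. P (opmult T (opmult (F' k) R))" for T R A' F'
    proof (rule lim)
      show "opmult T (opmult (F' k) R) \<in> L n" for k using TR A' by (auto intro!: Lc)
      show "P (opmult T (opmult (F' k) R))" for k by fact
      show "opmult T (opmult A' R) \<in> L n" using TR A' by (auto intro!: Lc)
      have l2: "(\<lambda>k. nrm n T * (opdist n (F' k) A' * nrm n R)) \<longlonglongrightarrow> 0"
        by (rule tendsto_mult_right_zero, rule tendsto_mult_left_zero, rule A'(3))
      have le: "opdist n (opmult T (opmult (F' k) R)) (opmult T (opmult A' R)) \<le>
          nrm n T * (opdist n (F' k) A' * nrm n R)" for k
        by (rule order_trans[OF opdist_left mult_left_mono[OF opdist_right]])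
          (use TR A' in \<open>auto intro!: Lc nrm_nonneg\<close>)
      show "(\<lambda>k. opdist n (opmult T (opmult (F' k) R)) (opmult T (opmult A' R))) \<longlonglongrightarrow> 0"
        by (rule real_tendsto_sandwich[OF _ _ tendsto_const l2])
          (use le TR A' in \<open>auto intro!: always_eventually opdist_nonneg Lc\<close>)
    qed
    have "P (opmult T (opmult A R)) \<and> P (opmult T (opmult (adj n A) R))"
      if TR: "T \<in> L n" "R \<in> L n" for T R
      using *[OF TR A FL l] *[OF TR adj_in_L[OF A] adj_in_L[OF FL] l'] F TR
      by (auto simp: D_def)
    then show "A \<in> D" using A by (auto simp: D_def)
  qed
  then have "S \<in> D" using S th by (auto simp: compacts_def cstar_generated_def)
  then have "P (opmult (multop (\<lambda>_. 1)) (opmult S (multop (\<lambda>_. 1))))"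
    by (auto simp: D_def L_closed)
  then show ?thesis using KK_L[OF S] by (simp add: opmult_one)
qed

lemma KK_ideal:
  assumes "S \<in> KK n" "T \<in> L n"
  shows "opmult T S \<in> KK n \<and> opmult S T \<in> KK n"
  using assms(1)
proof (induction rule: KK_induct)
  case (theta u v)
  then show ?case using assms(2)
    by (simp add: theta_mult_left theta_mult_right KK_theta L_CK L_CK[OF adj_in_L])
next
  case (add A B)
  then show ?case using assms(2) by (simp add: opmult_opadd[where n = n] KK_add)
next
  case (scale c A)
  then show ?case using assms(2) by (simp add: opmult_opscale[where n = n] KK_scale)
next
  case (lim F A)
  have l1: "(\<lambda>k. nrm n T * opdist n (F k) A) \<longlonglongrightarrow> 0"
    by (rule tendsto_mult_right_zero) fact
  have l2: "(\<lambda>k. opdist n (F k) A * nrm n T) \<longlonglongrightarrow> 0"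
    by (rule tendsto_mult_left_zero) fact
  have "(\<lambda>k. opdist n (opmult T (F k)) (opmult T A)) \<longlonglongrightarrow> 0"
    by (rule real_tendsto_sandwich[OF _ _ tendsto_const l1])
      (use lim assms(2) in \<open>auto intro!: always_eventually opdist_nonneg opdist_left L_closed\<close>)
  moreover have "(\<lambda>k. opdist n (opmult (F k) T) (opmult A T)) \<longlonglongrightarrow> 0"
    by (rule real_tendsto_sandwich[OF _ _ tendsto_const l2])
      (use lim assms(2) in \<open>auto intro!: always_eventually opdist_nonneg opdist_right L_closed\<close>)
  ultimately show ?case using lim assms(2)
    by (auto intro: KK_lim[of "\<lambda>k. opmult T (F k)"] KK_lim[of "\<lambda>k. opmult (F k) T"] L_closed)
qed

text \<open>The level \<open>\<F>\<^sup>(\<^sup>n\<^sup>)\<close> inside the operators on \<open>C(K)\<close>: as amplification is an inclusion there, its elements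
  are plain sums of a multiplication operator and compact operators of the levels \<open>1, \<dots>, n\<close>.\<close>

definition levelop :: "('k \<Rightarrow> complex) \<Rightarrow> (nat \<Rightarrow> ('k \<Rightarrow> complex) \<Rightarrow> 'k \<Rightarrow> complex) \<Rightarrow> nat \<Rightarrow>
    ('k \<Rightarrow> complex) \<Rightarrow> 'k \<Rightarrow> complex" where
  "levelop a T n = (\<lambda>f\<in>CK. \<lambda>x. a x * f x + (\<Sum>i=1..n. T i f x))"

definition FF :: "nat \<Rightarrow> (('k \<Rightarrow> complex) \<Rightarrow> 'k \<Rightarrow> complex) set" where
  "FF n = {levelop a T n | a T. a \<in> CK \<and> (\<forall>i\<in>{1..n}. T i \<in> KK i)}"

lemma FF_I: "a \<in> CK \<Longrightarrow> \<forall>i\<in>{1..n}. T i \<in> KK i \<Longrightarrow> levelop a T n \<in> FF n"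
  by (auto simp: FF_def)

lemma levelop_0: "levelop a T 0 = multop a"
  by (simp add: levelop_def multop_def)

lemma levelop_Suc: "levelop a T (Suc n) = opadd (levelop a T n) (T (Suc n))"
  by (auto simp: levelop_def opadd_def fun_eq_iff)

lemma levelop_induct:
  assumes "a \<in> CK" "\<forall>i\<in>{1..n}. T i \<in> KK i"
    and mult: "P (multop a)"
    and compact: "\<And>i S. 1 \<le> i \<Longrightarrow> i \<le> n \<Longrightarrow> S \<in> KK i \<Longrightarrow> P S"
    and add: "\<And>A B. A \<in> L n \<Longrightarrow> B \<in> L n \<Longrightarrow> P A \<Longrightarrow> P B \<Longrightarrow> P (opadd A B)"
  shows "levelop a T n \<in> L n \<and> P (levelop a T n)"
proof -
  have "m \<le> n \<Longrightarrow> levelop a T m \<in> L n \<and> P (levelop a T m)" for m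
  proof (induction m)
    case 0
    then show ?case using assms by (simp add: levelop_0 L_closed)
  next
    case (Suc m)
    then have T: "T (Suc m) \<in> KK (Suc m)" using assms(2) by simp
    then have "T (Suc m) \<in> L n" using KK_L L_mono Suc.prems by blast
    then show ?case using Suc T compact by (auto simp: levelop_Suc intro!: L_closed add)
  qed
  then show ?thesis by blast
qed

lemma FF_L: "T \<in> FF n \<Longrightarrow> T \<in> L n"
  using levelop_induct[where P = "\<lambda>_. True"] by (auto simp: FF_def)

lemma zero_KK: "multop (\<lambda>_. 0) \<in> KK n"
proof -
  have "multop (\<lambda>_. 0) = theta (model n) (\<lambda>_. 0) (\<lambda>_. 0)"
    by (simp add: multop_def theta_def)
  then show ?thesis using KK_theta[of "\<lambda>_. 0" "\<lambda>_. 0" n] by simp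
qed

lemma FF_multop: "a \<in> CK \<Longrightarrow> multop a \<in> FF n"
  unfolding FF_def
  by (auto intro!: exI[of _ a] exI[of _ "\<lambda>_. multop (\<lambda>_. 0)"] zero_KK simp: levelop_def multop_def fun_eq_iff)

lemma KK_FF: 
  assumes "1 \<le> i" "i \<le> n" "S \<in> KK i"
  shows "S \<in> FF n"
proof -
  let ?T = "\<lambda>j. if j = i then S else multop (\<lambda>_. 0)"
  have SL: "S \<in> L i" using assms KK_L by blast
  have "levelop (\<lambda>_. 0) ?T n = S"
  proof (rule extensionalityI)
    show "levelop (\<lambda>_. 0) ?T n \<in> extensional CK" by (simp add: levelop_def)
    show "S \<in> extensional CK" using SL L_extensional by blast
    fix f :: "'k \<Rightarrow> complex" assume f: "f \<in> CK"
    have "(\<Sum>j=1..n. ?T j f x) = (\<Sum>j=1..n. if j = i then S f x else 0)" for x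
      by (rule sum.cong) (auto simp: op_apply f)
    then show "levelop (\<lambda>_. 0) ?T n f = S f"
      using f assms by (simp add: levelop_def fun_eq_iff)
  qed
  moreover have "\<forall>j\<in>{1..n}. ?T j \<in> KK j" using assms zero_KK by simp
  ultimately show ?thesis using FF_I[of "\<lambda>_. 0" n ?T] by simp
qed

lemma FF_opadd:
  assumes "T \<in> FF n" "S \<in> FF n"
  shows "opadd T S \<in> FF n"
proof -
  obtain a A where A: "T = levelop a A n" "a \<in> CK" "\<forall>i\<in>{1..n}. A i \<in> KK i"
    using assms by (auto simp: FF_def)
  obtain b B where B: "S = levelop b B n" "b \<in> CK" "\<forall>i\<in>{1..n}. B i \<in> KK i"
    using assms by (auto simp: FF_def)
  have "opadd T S = levelop (\<lambda>x. a x + b x) (\<lambda>i. opadd (A i) (B i)) n"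
    unfolding A B
    by (auto simp: opadd_def levelop_def fun_eq_iff sum.distrib algebra_simps)
  then show ?thesis unfolding FF_def using A B CK_add KK_add by blast
qed

lemma FF_induct [consumes 1, case_names mult compact add]:
  assumes T: "T \<in> FF n"
    and mult: "\<And>a. a \<in> CK \<Longrightarrow> P (multop a)"
    and compact: "\<And>i S. 1 \<le> i \<Longrightarrow> i \<le> n \<Longrightarrow> S \<in> KK i \<Longrightarrow> P S"
    and add: "\<And>A B. A \<in> FF n \<Longrightarrow> B \<in> FF n \<Longrightarrow> P A \<Longrightarrow> P B \<Longrightarrow> P (opadd A B)"
  shows "P T"
proof -
  obtain a A where A: "T = levelop a A n" "a \<in> CK" "\<forall>i\<in>{1..n}. A i \<in> KK i"
    using T by (auto simp: FF_def)
  have "levelop a A n \<in> FF n \<and> P (levelop a A n)"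
    by (rule levelop_induct[where P = "\<lambda>T. T \<in> FF n \<and> P T", THEN conjunct2])
      (use A in \<open>auto intro: mult compact add FF_multop KK_FF FF_opadd\<close>)
  then show ?thesis using A by simp
qed

lemma FF_mono: "n \<le> m \<Longrightarrow> T \<in> FF n \<Longrightarrow> T \<in> FF m"
proof -
  assume "n \<le> m" "T \<in> FF n"
  from this(2) show ?thesis
    by (induction rule: FF_induct) (use \<open>n \<le> m\<close> in \<open>auto intro: FF_multop KK_FF FF_opadd\<close>)
qed

lemma FF_opscale: "T \<in> FF n \<Longrightarrow> opscale c T \<in> FF n"
proof (induction rule: FF_induct)
  case (mult a)
  have "opscale c (multop a) = multop (\<lambda>x. a x * c)"
    by (auto simp: opscale_def multop_def fun_eq_iff)
  then show ?case using mult by (simp add: FF_multop CK_mult)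
next
  case (add A B)
  have "opscale c (opadd A B) = opadd (opscale c A) (opscale c B)"
    by (auto simp: opscale_def opadd_def fun_eq_iff distrib_right)
  then show ?case using add by (simp add: FF_opadd)
qed (auto intro: KK_FF KK_scale)

lemma FF_adj: "T \<in> FF n \<Longrightarrow> adj n T \<in> FF n"
proof (induction rule: FF_induct)
  case (mult a)
  then show ?case by (simp add: adj_simps FF_multop CK_cnj)
next
  case (add A B)
  then show ?case by (simp add: adj_simps FF_L FF_opadd)
next
  case (compact i S)
  then show ?case using adj_mono[of i n S] KK_L[of S i] by (auto intro: KK_FF KK_adj)
qed

text \<open>A product of compact operators of two levels lies in the higher of them, because the compact
  operators form an ideal there.\<close>

lemma KK_opmult_FF:
  assumes T: "T \<in> FF n" and S: "1 \<le> i" "i \<le> n" "S \<in> KK i"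
  shows "opmult T S \<in> FF n \<and> opmult S T \<in> FF n"
  using T
proof (induction rule: FF_induct)
  case (mult a)
  then show ?case using KK_ideal[OF S(3), of "multop a"] S KK_FF by (auto simp: L_closed)
next
  case (compact j R)
  show ?case
  proof (cases "i \<le> j")
    case True
    then have "S \<in> L j" using S KK_L L_mono by blast
    then show ?thesis using KK_ideal[OF compact(3)] compact KK_FF by blast
  next
    case False
    then have "R \<in> L i" using compact KK_L[of R j] L_mono[of j i R] by simp
    then show ?thesis using KK_ideal[OF S(3)] S KK_FF by blast
  qed
next
  case (add A B)
  then have "A \<in> L n" "B \<in> L n" "S \<in> L n" using FF_L S KK_L[of S i] L_mono[of i n S] by auto
  then show ?case using add by (simp add: opmult_opadd[where n = n] FF_opadd)
qed

lemma FF_opmult: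
  assumes T: "T \<in> FF n" and S: "S \<in> FF n"
  shows "opmult T S \<in> FF n"
  using S
proof (induction rule: FF_induct)
  case (mult b)
  show ?case using T
  proof (induction rule: FF_induct)
    case (mult a)
    have "opmult (multop a) (multop b) = multop (\<lambda>x. a x * b x)"
      using \<open>b \<in> CK\<close> by (auto simp: opmult_def multop_def CK_mult fun_eq_iff mult.assoc)
    then show ?case using mult \<open>b \<in> CK\<close> by (simp add: FF_multop CK_mult)
  next
    case (compact i S)
    then show ?case using KK_opmult_FF[OF FF_multop[OF mult]] by blast
  next
    case (add A B)
    then show ?case using mult FF_L by (simp add: opmult_opadd[where n = n] FF_opadd L_closed)
  qed
next
  case (compact i S)
  then show ?case using KK_opmult_FF[OF T] by blast
next
  case (add A B)
  then show ?case using T FF_L by (simp add: opmult_opadd[where n = n] FF_opadd)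
qed

end

section \<open>The Hutchinson measure has no atoms\<close>

text \<open>Condition (3) of Assumption A enters through its case \<open>k = 1\<close>: since \<open>x = \<gamma>\<^sub>j (h x)\<close> for some \<open>j\<close>,
  it forbids that \<open>x\<close> and \<open>h x\<close> are both branch points.\<close>

locale branch_measure = branch_system N \<gamma> h
  for N and \<gamma> :: "nat \<Rightarrow> 'k::metric_space \<Rightarrow> 'k" and h +
  fixes \<mu> :: "'k measure"
  assumes N2: "N \<ge> 2"
    and prob: "prob_space \<mu>"
    and sets_\<mu>: "sets \<mu> = sets borel"
    and invariant: "a \<in> CK \<Longrightarrow> (LINT x|\<mu>. a x) = (1 / of_nat N) * (\<Sum>j=1..N. LINT x|\<mu>. a (\<gamma> j x))"
    and finite_branch: "finite (branch_set N \<gamma>)"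
    and branch_h: "x \<in> branch_set N \<gamma> \<Longrightarrow> h x \<notin> branch_set N \<gamma>"
begin

sublocale prob_space \<mu> by (rule prob)

lemma branch_set_iff:
  "x \<in> branch_set N \<gamma> \<longleftrightarrow> (\<exists>i\<in>{1..N}. \<exists>j\<in>{1..N}. i \<noteq> j \<and> \<gamma> i (h x) = x \<and> \<gamma> j (h x) = x)"
proof
  assume "x \<in> branch_set N \<gamma>"
  then obtain a i j where *: "i \<in> {1..N}" "j \<in> {1..N}" "i \<noteq> j" "x = \<gamma> i a" "x = \<gamma> j a"
    unfolding branch_set_def by blast
  then have "h x = a" using h_\<gamma> by auto
  then show "\<exists>i\<in>{1..N}. \<exists>j\<in>{1..N}. i \<noteq> j \<and> \<gamma> i (h x) = x \<and> \<gamma> j (h x) = x" using * by metis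
next
  assume "\<exists>i\<in>{1..N}. \<exists>j\<in>{1..N}. i \<noteq> j \<and> \<gamma> i (h x) = x \<and> \<gamma> j (h x) = x"
  then show "x \<in> branch_set N \<gamma>" unfolding branch_set_def by (metis (mono_tags, lifting) mem_Collect_eq)
qed

lemma space_\<mu> [simp]: "space \<mu> = UNIV"
  using sets_eq_imp_space_eq[OF sets_\<mu>] by simp

lemma measurable_\<mu>: "borel_measurable \<mu> = borel_measurable borel"
  by (rule measurable_cong_sets) (simp_all add: sets_\<mu>)

lemma CK_measurable: "f \<in> CK \<Longrightarrow> f \<in> borel_measurable \<mu>"
  unfolding measurable_\<mu> CK_def by (auto intro: borel_measurable_continuous_onI)

lemma CK_integrable: "f \<in> CK \<Longrightarrow> integrable \<mu> f"
  using CK_bounded[OF cpt] by (blast intro: integrable_const_bound CK_measurable AE_I2)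

definition branch_mult :: "'k \<Rightarrow> nat" where
  "branch_mult x = card {j\<in>{1..N}. \<gamma> j (h x) = x}"

lemma branch_mult_le: "branch_mult x \<le> N"
  unfolding branch_mult_def by (rule order_trans[OF card_mono[of "{1..N}"]]) auto

lemma branch_mult_full: "branch_mult x = N \<Longrightarrow> x \<in> branch_set N \<gamma>"
proof -
  assume "branch_mult x = N"
  then have "{j\<in>{1..N}. \<gamma> j (h x) = x} = {1..N}"
    unfolding branch_mult_def by (intro card_subset_eq) auto
  then have "\<forall>j\<in>{1..N}. \<gamma> j (h x) = x" by blast
  then have "\<gamma> 1 (h x) = x" "\<gamma> 2 (h x) = x" using N2 by simp_all
  then show ?thesis unfolding branch_set_iff using N2
    by (intro bexI[of _ 1] bexI[of _ 2]) auto
qed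

lemma integral_indicator_complex:
  assumes "A \<in> sets borel"
  shows "(LINT y|\<mu>. indicator A y) = complex_of_real (measure \<mu> A)"
proof -
  have "(LINT y|\<mu>. complex_of_real (indicator A y)) = complex_of_real (LINT y|\<mu>. indicator A y)"
    by (rule integral_complex_of_real)
  then show ?thesis using assms by (simp add: of_real_indicator sets_\<mu>)
qed

text \<open>The invariance equation, tested on tent functions that decrease to the indicator of \<open>{x}\<close>.\<close>

lemma measure_point: "measure \<mu> {x} = real (branch_mult x) / real N * measure \<mu> {h x}"
proof -
  define f :: "nat \<Rightarrow> 'k \<Rightarrow> complex" where "f k y = complex_of_real (max 0 (1 - real k * dist x y))" for k y
  have f_CK: "f k \<in> CK" for k by (auto simp: CK_def f_def intro!: continuous_intros)
  have f_le: "cmod (f k y) \<le> 1" for k y by (auto simp: f_def)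
  have f_lim: "(\<lambda>k. f k y) \<longlonglongrightarrow> indicator {x} y" for y
  proof (cases "y = x")
    case False
    then have "dist x y > 0" by simp
    then obtain k0 :: nat where k0: "1 < real k0 * dist x y" using ex_less_of_nat_mult by blast
    have "f k y = 0" if "k \<ge> k0" for k
    proof -
      have "real k0 * dist x y \<le> real k * dist x y" using that by (intro mult_right_mono) auto
      then show ?thesis using k0 by (simp add: f_def max_def)
    qed
    then show ?thesis using False
      by (auto intro!: tendsto_eventually exI[of _ k0] simp: eventually_sequentially)
  qed (simp add: f_def)
  have ind_meas: "(\<lambda>y. indicator {x} (g y) :: complex) \<in> borel_measurable \<mu>"
    if "continuous_on UNIV g" for g :: "'k \<Rightarrow> 'k"
    unfolding measurable_\<mu>
    by (rule measurable_compose[OF borel_measurable_continuous_onI[OF that] borel_measurable_indicator]) simp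
  have lim: "(\<lambda>k. LINT y|\<mu>. f k (g y)) \<longlonglongrightarrow> (LINT y|\<mu>. indicator {x} (g y))"
    if g: "continuous_on UNIV g" for g :: "'k \<Rightarrow> 'k"
    by (rule integral_dominated_convergence[where w = "\<lambda>_. 1"])
      (use f_le f_lim in \<open>auto intro!: ind_meas[OF g] CK_measurable CK_comp[OF f_CK g]\<close>)
  have val: "(LINT y|\<mu>. indicator {x} (\<gamma> j y)) =
      complex_of_real (if \<gamma> j (h x) = x then measure \<mu> {h x} else 0)" if j: "j \<in> {1..N}" for j
  proof -
    have "(\<lambda>y. indicator {x} (\<gamma> j y) :: complex) =
        indicator (if \<gamma> j (h x) = x then {h x} else {})"
      using h_\<gamma>[OF j] by (auto simp: fun_eq_iff indicator_def)
    then show ?thesis by (simp add: integral_indicator_complex)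
  qed
  have "(\<lambda>k. (1 / of_nat N) * (\<Sum>j=1..N. LINT y|\<mu>. f k (\<gamma> j y))) \<longlonglongrightarrow>
      (1 / of_nat N) * (\<Sum>j=1..N. LINT y|\<mu>. indicator {x} (\<gamma> j y))"
    by (intro tendsto_mult tendsto_const tendsto_sum lim cont_\<gamma>)
  then have "(\<lambda>k. LINT y|\<mu>. f k y) \<longlonglongrightarrow>
      (1 / of_nat N) * (\<Sum>j=1..N. LINT y|\<mu>. indicator {x} (\<gamma> j y))"
    unfolding invariant[OF f_CK] .
  moreover have "(\<lambda>k. LINT y|\<mu>. f k y) \<longlonglongrightarrow> (LINT y|\<mu>. indicator {x} y)"
    using lim[of "\<lambda>y. y"] by simp
  ultimately have "(LINT y|\<mu>. indicator {x} y) =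
      (1 / of_nat N) * (\<Sum>j=1..N. LINT y|\<mu>. (indicator {x} (\<gamma> j y) :: complex))"
    using LIMSEQ_unique by blast
  also have "(\<Sum>j=1..N. LINT y|\<mu>. (indicator {x} (\<gamma> j y) :: complex)) =
      complex_of_real (\<Sum>j=1..N. if \<gamma> j (h x) = x then measure \<mu> {h x} else 0)"
    by (simp add: val del: of_real_sum) (simp add: val)
  also have "(\<Sum>j=1..N. if \<gamma> j (h x) = x then measure \<mu> {h x} else 0) =
      real (branch_mult x) * measure \<mu> {h x}"
    unfolding branch_mult_def by (subst sum.inter_filter[symmetric]) auto
  also have "(LINT y|\<mu>. indicator {x} y) = complex_of_real (measure \<mu> {x})"
    by (simp add: integral_indicator_complex)
  finally have "complex_of_real (measure \<mu> {x}) =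
      complex_of_real (1 / real N * (real (branch_mult x) * measure \<mu> {h x}))" by simp
  then show ?thesis unfolding of_real_eq_iff by simp
qed

text \<open>A point whose mass comes close to the supremum \<open>M\<close> of all point masses has full
  multiplicity, as otherwise its image under \<open>h\<close> would have mass greater than \<open>M\<close>; and its image
  under \<open>h\<close> has the same mass. Both would be branch points.\<close>

lemma no_atoms: "measure \<mu> {x} = 0"
proof (rule ccontr)
  assume x: "measure \<mu> {x} \<noteq> 0"
  define M where "M = (SUP y. measure \<mu> {y})"
  have bdd: "bdd_above (range (\<lambda>y. measure \<mu> {y}))" by (auto intro: bdd_aboveI[of _ 1])
  have le_M: "measure \<mu> {y} \<le> M" for y unfolding M_def by (rule cSUP_upper[OF _ bdd]) simp
  have M: "M > 0" using x le_M[of x] zero_less_measure_iff[of \<mu> "{x}"] by linarith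
  have full: "branch_mult y = N \<and> measure \<mu> {h y} = measure \<mu> {y}"
    if y: "measure \<mu> {y} > (real N - 1) / real N * M" for y
  proof -
    have "measure \<mu> {y} \<le> real (branch_mult y) / real N * M"
      unfolding measure_point[of y] using le_M by (intro mult_left_mono) auto
    then have "(real N - 1) / real N * M < real (branch_mult y) / real N * M" using y by simp
    then have "real N - 1 < real (branch_mult y)"
      using M N2 by (simp add: mult_less_cancel_right divide_less_cancel)
    then have "branch_mult y = N" using branch_mult_le[of y] by linarith
    then show ?thesis using measure_point[of y] N2 by simp
  qed
  have "(real N - 1) / real N * M < M" using M N2 by (simp add: field_simps)
  then obtain y where y: "measure \<mu> {y} > (real N - 1) / real N * M"
    unfolding M_def using less_cSUP_iff[OF _ bdd] by blast
  then have "branch_mult y = N" "branch_mult (h y) = N" using full[of y] full[of "h y"] by auto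
  then show False using branch_mult_full branch_h by blast
qed

text \<open>The points with a generic forward orbit; the others form a countable set.\<close>

definition G :: "'k set" where
  "G = {x. \<forall>i. (h ^^ i) x \<notin> branch_set N \<gamma>}"

lemma countable_not_G: "countable (- G)"
proof -
  have eq: "- G = (\<Union>i. \<Union>b\<in>branch_set N \<gamma>. {x. (h ^^ i) x = b})"
    by (auto simp: G_def)
  have "finite {x. (h ^^ i) x = b}" for i b
  proof (rule finite_subset)
    show "{x. (h ^^ i) x = b} \<subseteq> (\<lambda>w. foldr \<gamma> w b) ` words i"
    proof
      fix x assume x: "x \<in> {x. (h ^^ i) x = b}"
      obtain w where "w \<in> words i" "foldr \<gamma> w ((h ^^ i) x) = x" using word_cover by blast
      then show "x \<in> (\<lambda>w. foldr \<gamma> w b) ` words i" using x by force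
    qed
  qed simp
  then have "countable (\<Union>b\<in>branch_set N \<gamma>. {x. (h ^^ i) x = b})" for i
    using finite_branch by (intro countable_finite) auto
  then show ?thesis unfolding eq by (rule countable_UN[OF countableI_type])
qed

lemma G_borel: "G \<in> sets borel"
  using borel_comp[of "- G"] countable_not_G by (simp add: borel_singleton sets.countable)

lemma AE_G: "AE x in \<mu>. x \<in> G"
proof (rule AE_I')
  have "{x} \<in> null_sets \<mu>" for x
    using no_atoms[of x] by (simp add: null_sets_def sets_\<mu> emeasure_eq_measure)
  then have "(\<Union>x\<in>- G. {x}) \<in> null_sets \<mu>" using countable_not_G by (intro null_sets_UN') auto
  then show "- G \<in> null_sets \<mu>" by simp
qed auto

lemma fibre_mono: "n \<le> m \<Longrightarrow> (h ^^ n) p = (h ^^ n) x \<Longrightarrow> (h ^^ m) p = (h ^^ m) x"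
  by (induction m rule: dec_induct) auto

text \<open>Outside the exceptional set every point occurs with multiplicity one in its fibres.\<close>

lemma transfer_single:
  assumes x: "x \<in> G"
    and z: "\<And>p. (h ^^ n) p = (h ^^ n) x \<Longrightarrow> p \<noteq> x \<Longrightarrow> F p = 0"
  shows "transfer n F ((h ^^ n) x) = F x"
  using z
proof (induction n)
  case (Suc n)
  let ?y = "(h ^^ n) x"
  obtain j where j: "j \<in> {1..N}" "\<gamma> j (h ?y) = ?y" using cover by blast
  have other: "transfer n F (\<gamma> i (h ?y)) = 0" if i: "i \<in> {1..N} - {j}" for i
  proof -
    have ne: "\<gamma> i (h ?y) \<noteq> ?y"
    proof
      assume "\<gamma> i (h ?y) = ?y"
      then have "?y \<in> branch_set N \<gamma>" unfolding branch_set_iff using i j by (metis DiffE singletonI)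
      then show False using x by (auto simp: G_def)
    qed
    have "transfer n F (\<gamma> i (h ?y)) = transfer n (\<lambda>_. 0) (\<gamma> i (h ?y))"
    proof (rule transfer_cong)
      fix p assume p: "(h ^^ n) p = \<gamma> i (h ?y)"
      have "h (\<gamma> i (h ?y)) = h ?y" using i by (intro h_\<gamma>) auto
      then show "F p = 0" using p ne by (intro Suc.prems) auto
    qed
    then show ?thesis by (simp add: transfer_def)
  qed
  have "transfer (Suc n) F ((h ^^ Suc n) x) = (\<Sum>i=1..N. transfer n F (\<gamma> i (h ?y)))"
    by (simp add: transfer_Suc)
  also have "\<dots> = transfer n F (\<gamma> j (h ?y))"
    using j other by (subst sum.remove[of _ j]) auto
  also have "\<dots> = F x" using j Suc by simp
  finally show ?case .
qed simp

section \<open>The diagonal of an adjointable operator\<close>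

definition peak :: "nat \<Rightarrow> 'k \<Rightarrow> 'k \<Rightarrow> complex" where
  "peak n x = (SOME b. b \<in> CK \<and> b x = 1 \<and> (\<forall>p. (h ^^ n) p = (h ^^ n) x \<longrightarrow> p \<noteq> x \<longrightarrow> b p = 0))"

lemma peak:
  shows peak_CK: "peak n x \<in> CK" and peak_1: "peak n x x = 1"
    and peak_0: "(h ^^ n) p = (h ^^ n) x \<Longrightarrow> p \<noteq> x \<Longrightarrow> peak n x p = 0"
proof -
  have fin: "finite {p. (h ^^ n) p = (h ^^ n) x}"
  proof (rule finite_subset)
    show "{p. (h ^^ n) p = (h ^^ n) x} \<subseteq> (\<lambda>w. foldr \<gamma> w ((h ^^ n) x)) ` words n"
    proof
      fix p assume p: "p \<in> {p. (h ^^ n) p = (h ^^ n) x}"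
      obtain w where "w \<in> words n" "foldr \<gamma> w ((h ^^ n) p) = p" using word_cover by blast
      then show "p \<in> (\<lambda>w. foldr \<gamma> w ((h ^^ n) x)) ` words n" using p by force
    qed
  qed simp
  have "\<exists>b. b \<in> CK \<and> b x = 1 \<and> (\<forall>p. (h ^^ n) p = (h ^^ n) x \<longrightarrow> p \<noteq> x \<longrightarrow> b p = 0)"
    using bump[OF fin, of x] by auto
  from someI_ex[OF this] show "peak n x \<in> CK" "peak n x x = 1"
    "(h ^^ n) p = (h ^^ n) x \<Longrightarrow> p \<noteq> x \<Longrightarrow> peak n x p = 0"
    unfolding peak_def by blast+
qed

text \<open>The entry of \<open>T\<close> at \<open>x\<close> on the diagonal of the fibre matrix of \<open>T\<close> over \<open>h\<^sup>n x\<close>.\<close>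

definition diag :: "nat \<Rightarrow> (('k \<Rightarrow> complex) \<Rightarrow> 'k \<Rightarrow> complex) \<Rightarrow> 'k \<Rightarrow> complex" where
  "diag n T x = T (peak n x) x"

text \<open>A function that peaks at \<open>x\<close> on the larger fibre also does so on the smaller one.\<close>

lemma diag_mono:
  assumes "n \<le> m" "T \<in> L n"
  shows "diag m T x = diag n T x"
  unfolding diag_def
proof (rule L_fibre_cong[OF assms(2) peak_CK peak_CK])
  fix p assume p: "(h ^^ n) p = (h ^^ n) x"
  then have "(h ^^ m) p = (h ^^ m) x" using fibre_mono assms(1) by blast
  then show "peak m x p = peak n x p" using p peak_1 peak_0 by (cases "p = x") auto
qed

lemma diag_simps:
  "diag n (opadd T S) x = diag n T x + diag n S x"
  "diag n (opscale c T) x = diag n T x * c"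
  "diag n (multop a) x = a x"
  "diag n (opmult (multop a) T) x = a x * diag n T x" if "T \<in> L n"
  using that by (simp_all add: diag_def op_apply peak_CK peak_1 L_CK)

text \<open>On the fibre of \<open>x\<close> the functions \<open>a \<cdot> peak\<close> and \<open>a x \<cdot> peak\<close> agree.\<close>

lemma diag_multop_right:
  assumes T: "T \<in> L n" and a: "a \<in> CK"
  shows "diag n (opmult T (multop a)) x = a x * diag n T x"
proof -
  have "T (\<lambda>p. a p * peak n x p) x = T (\<lambda>p. peak n x p * a x) x"
  proof (rule L_fibre_cong[OF T])
    fix p assume "(h ^^ n) p = (h ^^ n) x"
    then show "a p * peak n x p = peak n x p * a x" using peak_0[of n p x] by (cases "p = x") auto
  qed (auto intro!: CK_mult a peak_CK CK_const)
  then show ?thesis by (simp add: diag_def op_apply peak_CK L_scale[OF T])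
qed

lemma diag_theta:
  assumes "x \<in> G" "u \<in> CK" "v \<in> CK"
  shows "diag n (theta (model n) u v) x = u x * cnj (v x)"
proof -
  have "transfer n (\<lambda>p. cnj (v p) * peak n x p) ((h ^^ n) x) = cnj (v x)"
    by (subst transfer_single[OF assms(1)]) (auto simp: peak_0 peak_1)
  then show ?thesis by (simp add: diag_def theta_apply peak_CK)
qed

lemma diag_bound:
  assumes x: "x \<in> G" and T: "T \<in> L n"
  shows "cmod (diag n T x) \<le> nrm n T"
proof -
  have "sqnorm n (peak n x) ((h ^^ n) x) = (cmod (peak n x x))\<^sup>2"
    unfolding sqnorm_def by (rule transfer_single[OF x]) (simp add: peak_0)
  then have "sqnorm n (T (peak n x)) ((h ^^ n) x) \<le> (nrm n T)\<^sup>2"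
    using sqnorm_le_nrm[OF T peak_CK, of n x "(h ^^ n) x"] by (simp add: peak_1)
  then have "(cmod (diag n T x))\<^sup>2 \<le> (nrm n T)\<^sup>2"
    using sqnorm_ge[of "T (peak n x)" x n] by (simp add: diag_def)
  then show ?thesis using nrm_nonneg[OF T] by (simp add: power2_le_iff_abs_le)
qed

lemma diag_pos:
  assumes x: "x \<in> G" and T: "T \<in> L n"
  shows "diag n (opmult (adj n T) T) x = complex_of_real (sqnorm n (T (peak n x)) ((h ^^ n) x))"
proof -
  let ?f = "peak n x" and ?S = "adj n T"
  have "transfer n (\<lambda>p. cnj (?f p) * ?S (T ?f) p) ((h ^^ n) x) = cnj (?f x) * ?S (T ?f) x"
    by (rule transfer_single[OF x]) (simp add: peak_0)
  also have "transfer n (\<lambda>p. cnj (?f p) * ?S (T ?f) p) ((h ^^ n) x) =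
      complex_of_real (sqnorm n (T ?f) ((h ^^ n) x))"
    unfolding minner_self[symmetric] by (rule L_adjD[OF T peak_CK L_CK[OF T peak_CK], symmetric])
  finally show ?thesis by (simp add: diag_def op_apply peak_CK peak_1)
qed

text \<open>Where the forward orbit meets the branch set, the diagonal of \<open>\<theta>\<^bsub>u,v\<^esub>\<close> carries a multiplicity as a
  factor. With this null set cut off it is \<open>u v\<^sup>*\<close>, a continuous function, which also makes
  the diagonals of all operators in the core measurable.\<close>

definition gdiag :: "nat \<Rightarrow> (('k \<Rightarrow> complex) \<Rightarrow> 'k \<Rightarrow> complex) \<Rightarrow> 'k \<Rightarrow> complex" where
  "gdiag n T x = indicator G x * diag n T x"

lemma gdiag_add: "T \<in> L n \<Longrightarrow> S \<in> L n \<Longrightarrow> gdiag n (opadd T S) = (\<lambda>x. gdiag n T x + gdiag n S x)"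
  by (simp add: gdiag_def diag_simps distrib_left fun_eq_iff)

lemma gdiag_scale: "T \<in> L n \<Longrightarrow> gdiag n (opscale c T) = (\<lambda>x. c * gdiag n T x)"
  by (simp add: gdiag_def diag_simps fun_eq_iff)

lemma gdiag_bound: "T \<in> L n \<Longrightarrow> cmod (gdiag n T x) \<le> nrm n T"
  using diag_bound[of x T n] nrm_nonneg[of T n]
  by (cases "x \<in> G") (auto simp: gdiag_def)

lemma gdiag_dist:
  assumes "T \<in> L n" "S \<in> L n"
  shows "dist (gdiag n T x) (gdiag n S x) \<le> opdist n T S"
  using gdiag_bound[of "opadd T (opscale (-1) S)" n x] assms
  by (simp add: gdiag_add gdiag_scale L_closed dist_norm)

lemma indicator_G_measurable: "(indicator G :: 'k \<Rightarrow> complex) \<in> borel_measurable borel"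
  using G_borel by simp

lemma gdiag_measurable_KK: "T \<in> KK n \<Longrightarrow> gdiag n T \<in> borel_measurable borel"
proof (induction rule: KK_induct)
  case (theta u v)
  have "gdiag n (theta (model n) u v) = (\<lambda>x. indicator G x * (u x * cnj (v x)))"
    using theta by (auto simp: gdiag_def diag_theta indicator_def fun_eq_iff)
  moreover have "(\<lambda>x. u x * cnj (v x)) \<in> borel_measurable borel"
    using CK_measurable[OF CK_mult[OF theta(1) CK_cnj[OF theta(2)]]] by (simp add: measurable_\<mu>)
  ultimately show ?case using indicator_G_measurable by simp
next
  case (lim F A)
  show ?case
  proof (rule borel_measurable_LIMSEQ_metric)
    show "gdiag n (F k) \<in> borel_measurable borel" for k by fact
    fix x
    have "(\<lambda>k. dist (gdiag n (F k) x) (gdiag n A x)) \<longlonglongrightarrow> 0"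
      by (rule real_tendsto_sandwich[OF _ _ tendsto_const \<open>(\<lambda>k. opdist n (F k) A) \<longlonglongrightarrow> 0\<close>])
        (use lim in \<open>auto intro!: always_eventually gdiag_dist\<close>)
    then show "(\<lambda>k. gdiag n (F k) x) \<longlonglongrightarrow> gdiag n A x" by (rule tendsto_dist_iff[THEN iffD2])
  qed
qed (simp_all add: gdiag_add gdiag_scale)

lemma gdiag_mono: "n \<le> m \<Longrightarrow> T \<in> L n \<Longrightarrow> gdiag m T = gdiag n T"
  by (simp add: gdiag_def diag_mono fun_eq_iff)

lemma gdiag_measurable: "T \<in> FF n \<Longrightarrow> gdiag n T \<in> borel_measurable borel"
proof (induction rule: FF_induct)
  case (mult a)
  have "gdiag n (multop a) = (\<lambda>x. indicator G x * a x)"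
    by (simp add: gdiag_def diag_def op_apply peak_CK peak_1 fun_eq_iff)
  then show ?case using indicator_G_measurable CK_measurable[OF mult] by (simp add: measurable_\<mu>)
next
  case (compact i S)
  then show ?case using gdiag_measurable_KK gdiag_mono[of i n S] KK_L by metis
qed (simp add: gdiag_add FF_L)

lemma gdiag_integrable: "T \<in> FF n \<Longrightarrow> integrable \<mu> (gdiag n T)"
  by (rule integrable_const_bound[where B = "nrm n T"])
    (auto simp: measurable_\<mu> gdiag_measurable intro!: AE_I2 gdiag_bound FF_L)

section \<open>The trace\<close>

text \<open>Over a generic point \<open>z\<close> the fibre of \<open>X\<^sup>\<otimes>\<^sup>n\<close> is a Hilbert space of dimension \<open>N\<^sup>n\<close>, and
  by invariance of \<open>\<mu>\<close> the integral of the diagonal of \<open>T\<close> is the mean over \<open>z\<close> of the normalised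
  traces of the fibre operators.\<close>

definition tr :: "nat \<Rightarrow> (('k \<Rightarrow> complex) \<Rightarrow> 'k \<Rightarrow> complex) \<Rightarrow> complex" where
  "tr n T = (LINT x|\<mu>. gdiag n T x)"

lemma tr_add: "T \<in> FF n \<Longrightarrow> S \<in> FF n \<Longrightarrow> tr n (opadd T S) = tr n T + tr n S"
  by (simp add: tr_def gdiag_add FF_L gdiag_integrable)

lemma tr_scale: "T \<in> FF n \<Longrightarrow> tr n (opscale c T) = c * tr n T"
  by (simp add: tr_def gdiag_scale FF_L)

lemma tr_mono: "n \<le> m \<Longrightarrow> T \<in> L n \<Longrightarrow> tr m T = tr n T"
  by (simp add: tr_def gdiag_mono)

lemma tr_bound:
  assumes "T \<in> FF n"
  shows "cmod (tr n T) \<le> nrm n T"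
proof -
  have "cmod (tr n T) \<le> (LINT x|\<mu>. cmod (gdiag n T x))" unfolding tr_def by (rule integral_norm_bound)
  also have "\<dots> \<le> (LINT x|\<mu>. nrm n T)"
    using assms by (intro integral_mono integrable_norm gdiag_integrable gdiag_bound FF_L) auto
  finally show ?thesis using prob_space by simp
qed

lemma tr_dist:
  assumes "T \<in> FF n" "S \<in> FF n"
  shows "dist (tr n T) (tr n S) \<le> opdist n T S"
  using tr_bound[of "opadd T (opscale (-1) S)" n] assms
  by (simp add: tr_add tr_scale FF_opadd FF_opscale dist_norm)

lemma tr_pos:
  assumes "T \<in> FF n"
  shows "tr n (opmult (adj n T) T) \<in> \<real>\<^sub>\<ge>\<^sub>0"
proof -
  have "gdiag n (opmult (adj n T) T) =
      (\<lambda>x. complex_of_real (indicator G x * sqnorm n (T (peak n x)) ((h ^^ n) x)))"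
    using diag_pos[OF _ FF_L[OF assms]] by (auto simp: gdiag_def indicator_def fun_eq_iff)
  then have "tr n (opmult (adj n T) T) =
      complex_of_real (LINT x|\<mu>. indicator G x * sqnorm n (T (peak n x)) ((h ^^ n) x))"
    by (simp add: tr_def del: of_real_mult)
  moreover have "0 \<le> (LINT x|\<mu>. indicator G x * sqnorm n (T (peak n x)) ((h ^^ n) x))"
    by (intro integral_nonneg_AE AE_I2) auto
  ultimately show ?thesis by (simp add: nonneg_Reals_of_real_iff)
qed

lemma integral_AE_G:
  assumes "\<And>x. x \<in> G \<Longrightarrow> f x = g x" "f \<in> borel_measurable \<mu>" "g \<in> borel_measurable \<mu>"
  shows "(LINT x|\<mu>. f x) = (LINT x|\<mu>. (g x :: complex))"
  using assms AE_G by (intro integral_cong_AE) auto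

lemma tr_multop: "a \<in> CK \<Longrightarrow> tr n (multop a) = (LINT x|\<mu>. a x)"
  unfolding tr_def
proof (rule integral_AE_G)
  assume a: "a \<in> CK"
  show "gdiag n (multop a) x = a x" if "x \<in> G" for x
    using that by (simp add: gdiag_def diag_def op_apply peak_CK peak_1)
  show "gdiag n (multop a) \<in> borel_measurable \<mu>"
    unfolding measurable_\<mu> by (rule gdiag_measurable[OF FF_multop[OF a]])
  show "a \<in> borel_measurable \<mu>" by (rule CK_measurable[OF a])
qed

lemma integral_transfer:
  "f \<in> CK \<Longrightarrow> (LINT x|\<mu>. transfer n f x) = of_nat N ^ n * (LINT x|\<mu>. f x)"
proof (induction n arbitrary: f)
  case (Suc n)
  have fj: "(\<lambda>x. f (\<gamma> j x)) \<in> CK" if "j \<in> {1..N}" for j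
    using Suc.prems cont_\<gamma>[OF that] by (rule CK_comp)
  have "(LINT x|\<mu>. transfer (Suc n) f x) = of_nat N ^ n * (LINT x|\<mu>. (\<Sum>j=1..N. f (\<gamma> j x)))"
    unfolding transfer_Suc' by (intro Suc.IH CK_sum fj)
  also have "(LINT x|\<mu>. (\<Sum>j=1..N. f (\<gamma> j x))) = of_nat N * (LINT x|\<mu>. f x)"
    using N_pos by (subst Bochner_Integration.integral_sum)
      (simp_all add: CK_integrable fj invariant[OF Suc.prems])
  finally show ?case by simp
qed simp

lemma tr_theta_eq:
  assumes "u \<in> CK" "v \<in> CK" "1 \<le> n"
  shows "tr n (theta (model n) u v) = (LINT x|\<mu>. cnj (v x) * u x)"
  unfolding tr_def
proof (rule integral_AE_G)
  show "gdiag n (theta (model n) u v) x = cnj (v x) * u x" if "x \<in> G" for x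
    using that assms by (simp add: gdiag_def diag_theta)
  show "gdiag n (theta (model n) u v) \<in> borel_measurable \<mu>"
    unfolding measurable_\<mu> using assms by (intro gdiag_measurable KK_FF[of n] KK_theta) auto
  show "(\<lambda>x. cnj (v x) * u x) \<in> borel_measurable \<mu>"
    using assms by (intro CK_measurable CK_mult CK_cnj)
qed

lemma tr_theta:
  assumes "u \<in> CK" "v \<in> CK" "1 \<le> n"
  shows "tr n (theta (model n) u v) = 1 / of_nat N ^ n * (LINT x|\<mu>. minner (model n) v u x)"
  using assms N_pos by (simp add: tr_theta_eq integral_transfer CK_mult CK_cnj)

text \<open>For \<open>S = \<theta>\<^bsub>u,v\<^esub>\<close> both sides are the integral of \<open>(v|Tu) = (T\<^sup>*v|u)\<close>.\<close>

lemma tr_comm_KK: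
  assumes S: "S \<in> KK n" and n: "1 \<le> n" and T: "T \<in> L n"
  shows "tr n (opmult S T) = tr n (opmult T S)"
proof -
  have fin: "A \<in> FF n" if "A \<in> KK n" for A using KK_FF[OF n order_refl that] .
  have "S \<in> KK n \<and> tr n (opmult S T) = tr n (opmult T S)"
    using S
  proof (induction rule: KK_induct)
    case (theta u v)
    have "tr n (theta (model n) u (adj n T v)) = 1 / of_nat N ^ n *
        (LINT x|\<mu>. minner (model n) (adj n T v) u x)"
      using theta n T by (intro tr_theta L_CK[OF adj_in_L])
    also have "minner (model n) (adj n T v) u = minner (model n) v (T u)"
      using L_adjD'[OF T theta(2,1)] by (simp add: fun_eq_iff)
    also have "1 / of_nat N ^ n * (LINT x|\<mu>. minner (model n) v (T u) x) =
        tr n (theta (model n) (T u) v)"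
      by (rule tr_theta[symmetric, OF L_CK[OF T theta(1)] theta(2) n])
    finally show ?case using theta T by (simp add: theta_mult_left theta_mult_right KK_theta)
  next
    case (add A B)
    then show ?case using T KK_ideal[OF _ T]
      by (simp add: opmult_opadd[where n = n] tr_add fin KK_add)
  next
    case (scale c A)
    then have "opmult T A \<in> FF n" "opmult A T \<in> FF n" using KK_ideal[OF _ T] fin by auto
    then show ?case using scale KK_scale[of A n c]
      by (simp only: opmult_opscale[OF scale(1) T] tr_scale simp_thms)
  next
    case (lim F A)
    have A: "A \<in> KK n"
      by (rule KK_lim[of F]) (use lim in \<open>simp_all only: simp_thms\<close>)
    have ideal: "opmult T B \<in> FF n" "opmult B T \<in> FF n" if "B \<in> KK n" for B
      using KK_ideal[OF that T] fin by auto
    have l1: "(\<lambda>k. nrm n T * opdist n (F k) A) \<longlonglongrightarrow> 0"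
      by (rule tendsto_mult_right_zero) fact
    have l2: "(\<lambda>k. opdist n (F k) A * nrm n T) \<longlonglongrightarrow> 0"
      by (rule tendsto_mult_left_zero) fact
    have d1: "dist (tr n (opmult T (F k))) (tr n (opmult T A)) \<le> nrm n T * opdist n (F k) A" for k
      by (rule order_trans[OF tr_dist opdist_left]) (use lim A T ideal in simp_all)
    have d2: "dist (tr n (opmult (F k) T)) (tr n (opmult A T)) \<le> opdist n (F k) A * nrm n T" for k
      by (rule order_trans[OF tr_dist opdist_right]) (use lim A T ideal in simp_all)
    have "(\<lambda>k. tr n (opmult T (F k))) \<longlonglongrightarrow> tr n (opmult T A)"
      by (rule tendsto_dist_iff[THEN iffD2], rule real_tendsto_sandwich[OF _ _ tendsto_const l1]) (use d1 in auto)
    moreover have "(\<lambda>k. tr n (opmult T (F k))) \<longlonglongrightarrow> tr n (opmult A T)"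
      by (rule tendsto_dist_iff[THEN iffD2], rule real_tendsto_sandwich[OF _ _ tendsto_const l2]) (use d2 lim in auto)
    ultimately show ?case using A LIMSEQ_unique by blast
  qed
  then show ?thesis by blast
qed

lemma tr_comm_multop:
  assumes "T \<in> L n" "a \<in> CK"
  shows "tr n (opmult (multop a) T) = tr n (opmult T (multop a))"
  using assms by (simp add: tr_def gdiag_def diag_simps diag_multop_right)

lemma tr_comm_compact:
  assumes T: "T \<in> FF n" and S: "1 \<le> i" "i \<le> n" "S \<in> KK i"
  shows "tr n (opmult S T) = tr n (opmult T S)"
proof -
  have S': "S \<in> FF n" "S \<in> L n" using KK_FF[OF S] FF_L by auto
  show ?thesis using T
  proof (induction rule: FF_induct)
    case (mult a)
    then show ?case using tr_comm_multop[OF S'(2)] by simp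
  next
    case (compact j R)
    show ?case
    proof (cases "i \<le> j")
      case True
      then have Sj: "S \<in> L j" using S KK_L L_mono by blast
      have R: "R \<in> L j" using compact KK_L by blast
      show ?thesis
        using tr_comm_KK[OF compact(3,1) Sj] tr_mono[OF compact(2)] Sj R
        by (simp add: L_closed)
    next
      case False
      then have R: "R \<in> L i" using compact KK_L[of R j] L_mono[of j i R] by simp
      have Si: "S \<in> L i" using S KK_L by blast
      show ?thesis
        using tr_comm_KK[OF S(3,1) R] tr_mono[OF S(2)] Si R by (simp add: L_closed)
    qed
  next
    case (add A B)
    then show ?case using S' FF_opmult[of _ n S] FF_opmult[OF S'(1)]
      by (simp add: opmult_opadd[where n = n] FF_L tr_add)
  qed
qed

lemma tr_comm:
  assumes T: "T \<in> FF n" and S: "S \<in> FF n"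
  shows "tr n (opmult S T) = tr n (opmult T S)"
  using S
proof (induction rule: FF_induct)
  case (mult a)
  then show ?case using tr_comm_multop[OF FF_L[OF T]] by simp
next
  case (compact i S)
  then show ?case using tr_comm_compact[OF T] by blast
next
  case (add A B)
  then show ?case using T FF_opmult[of _ n T] FF_opmult[OF T]
    by (simp add: opmult_opadd[where n = n] FF_L tr_add)
qed

end

section \<open>Completions\<close>

lemma tendsto_zero_le:
  fixes f g :: "nat \<Rightarrow> real"
  shows "g \<longlonglongrightarrow> 0 \<Longrightarrow> (\<And>k. f k \<le> g k) \<Longrightarrow> (\<And>k. 0 \<le> f k) \<Longrightarrow> f \<longlonglongrightarrow> 0"
  by (rule real_tendsto_sandwich[OF _ _ tendsto_const]) auto

locale pseudo_metric_on =
  fixes S :: "'s set" and d :: "'s \<Rightarrow> 's \<Rightarrow> real"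
  assumes d_refl: "p \<in> S \<Longrightarrow> d p p = 0"
    and d_sym: "p \<in> S \<Longrightarrow> q \<in> S \<Longrightarrow> d p q = d q p"
    and d_tri: "p \<in> S \<Longrightarrow> q \<in> S \<Longrightarrow> r \<in> S \<Longrightarrow> d p r \<le> d p q + d q r"
begin

lemma d_nonneg: "p \<in> S \<Longrightarrow> q \<in> S \<Longrightarrow> 0 \<le> d p q"
  using d_tri[of p q p] d_refl[of p] d_sym[of p q] by simp

lemma cauchy_seqsD: "s \<in> cauchy_seqs S d \<Longrightarrow> s k \<in> S"
  by (auto simp: cauchy_seqs_def)

lemma d_lim_sym:
  assumes "range s \<subseteq> S" "range t \<subseteq> S" "(\<lambda>k. d (s k) (t k)) \<longlonglongrightarrow> 0"
  shows "(\<lambda>k. d (t k) (s k)) \<longlonglongrightarrow> 0"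
proof -
  have "d (t k) (s k) = d (s k) (t k)" for k using assms by (intro d_sym) auto
  then show ?thesis using assms by simp
qed

lemma d_lim_trans:
  assumes "range s \<subseteq> S" "range t \<subseteq> S" "range u \<subseteq> S"
    and "(\<lambda>k. d (s k) (t k)) \<longlonglongrightarrow> 0" "(\<lambda>k. d (t k) (u k)) \<longlonglongrightarrow> 0"
  shows "(\<lambda>k. d (s k) (u k)) \<longlonglongrightarrow> 0"
proof (rule real_tendsto_sandwich[OF _ _ tendsto_const])
  show "(\<lambda>k. d (s k) (t k) + d (t k) (u k)) \<longlonglongrightarrow> 0" using tendsto_add[OF assms(4,5)] by simp
  have "s k \<in> S" "t k \<in> S" "u k \<in> S" for k using assms by auto
  then show "\<forall>\<^sub>F k in sequentially. 0 \<le> d (s k) (u k)"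
    "\<forall>\<^sub>F k in sequentially. d (s k) (u k) \<le> d (s k) (t k) + d (t k) (u k)"
    using d_nonneg d_tri by auto
qed

lemma equiv_completion: "equiv (cauchy_seqs S d) (completion_rel S d)"
proof (rule equivI)
  show "completion_rel S d \<subseteq> cauchy_seqs S d \<times> cauchy_seqs S d"
    by (auto simp: completion_rel_def)
  show "refl_on (cauchy_seqs S d) (completion_rel S d)"
    by (rule refl_onI) (auto simp: completion_rel_def d_refl cauchy_seqsD)
  show "sym (completion_rel S d)"
    by (rule symI) (auto simp: completion_rel_def cauchy_seqs_def intro: d_lim_sym)
  show "trans (completion_rel S d)"
    by (rule transI) (auto simp: completion_rel_def cauchy_seqs_def intro: d_lim_trans)
qed

text \<open>The Cauchy property of \<open>t\<close> is inherited from \<open>s\<close>.\<close>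

lemma completion_relI:
  assumes s: "s \<in> cauchy_seqs S d" and t: "range t \<subseteq> S" and l: "(\<lambda>k. d (s k) (t k)) \<longlonglongrightarrow> 0"
  shows "(s, t) \<in> completion_rel S d"
proof -
  have sS: "s k \<in> S" and tS: "t k \<in> S" for k using cauchy_seqsD[OF s] t by blast+
  have "\<exists>M. \<forall>k\<ge>M. \<forall>l\<ge>M. d (t k) (t l) < e" if e: "e > 0" for e
  proof -
    have "\<forall>e>0. \<exists>M. \<forall>k\<ge>M. \<forall>l\<ge>M. d (s k) (s l) < e" using s by (simp add: cauchy_seqs_def)
    moreover have "e / 3 > 0" using e by simp
    ultimately obtain M1 where M1: "\<And>k l. k \<ge> M1 \<Longrightarrow> l \<ge> M1 \<Longrightarrow> d (s k) (s l) < e / 3" by meson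
    have "\<forall>\<^sub>F k in sequentially. d (s k) (t k) < e / 3" by (rule order_tendstoD(2)[OF l]) (use e in simp)
    then obtain M2 where M2: "\<And>k. k \<ge> M2 \<Longrightarrow> d (s k) (t k) < e / 3"
      by (auto simp: eventually_sequentially)
    have "d (t k) (t l) < e" if "k \<ge> max M1 M2" "l \<ge> max M1 M2" for k l
      using d_tri[of "t k" "s k" "t l"] d_tri[of "s k" "s l" "t l"] d_sym[of "t k" "s k"] sS tS
        M1[of k l] M2[of k] M2[of l] that by simp
    then show ?thesis by blast
  qed
  then have "t \<in> cauchy_seqs S d" using t by (auto simp: cauchy_seqs_def)
  then show ?thesis using s l by (auto simp: completion_rel_def)
qed

lemma mem_cclass: "t \<in> cclass S d s \<longleftrightarrow> (s, t) \<in> completion_rel S d"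
  by (simp add: cclass_def)

lemma cclass_self: "s \<in> cauchy_seqs S d \<Longrightarrow> s \<in> cclass S d s"
  using equiv_class_self[OF equiv_completion] by (simp add: cclass_def)

lemma cclass_eq: "(s, t) \<in> completion_rel S d \<Longrightarrow> cclass S d s = cclass S d t"
  unfolding cclass_def by (rule equiv_class_eq[OF equiv_completion])

lemma cclass_in: "s \<in> cauchy_seqs S d \<Longrightarrow> cclass S d s \<in> completion S d"
  unfolding completion_def cclass_def by (rule quotientI)

lemma completion_cases:
  assumes "P \<in> completion S d"
  obtains s where "s \<in> cauchy_seqs S d" "P = cclass S d s"
  using assms unfolding completion_def cclass_def by (rule quotientE)

lemma const_cauchy: "p \<in> S \<Longrightarrow> (\<lambda>_. p) \<in> cauchy_seqs S d"
  by (auto simp: cauchy_seqs_def d_refl)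

lemma clift1_cclass:
  assumes T: "pseudo_metric_on T d'" and s: "s \<in> cauchy_seqs S d"
    and rel: "\<And>t. (s, t) \<in> completion_rel S d \<Longrightarrow> (\<lambda>k. f (s k), \<lambda>k. f (t k)) \<in> completion_rel T d'"
  shows "clift1 T d' f (cclass S d s) = cclass T d' (\<lambda>k. f (s k))"
proof -
  interpret T: pseudo_metric_on T d' by fact
  have "cclass T d' (\<lambda>k. f (t k)) = cclass T d' (\<lambda>k. f (s k))" if "t \<in> cclass S d s" for t
    using T.cclass_eq[OF rel] that by (simp add: mem_cclass)
  then show ?thesis unfolding clift1_def using cclass_self[OF s] by blast
qed

lemma clift2_cclass:
  assumes s: "s \<in> cauchy_seqs S d" and t: "t \<in> cauchy_seqs S d"
    and rel: "\<And>s' t'. (s, s') \<in> completion_rel S d \<Longrightarrow> (t, t') \<in> completion_rel S d \<Longrightarrow>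
      (\<lambda>k. f (s k) (t k), \<lambda>k. f (s' k) (t' k)) \<in> completion_rel S d"
  shows "clift2 S d f (cclass S d s) (cclass S d t) = cclass S d (\<lambda>k. f (s k) (t k))"
proof -
  have "cclass S d (\<lambda>k. f (s' k) (t' k)) = cclass S d (\<lambda>k. f (s k) (t k))"
    if "s' \<in> cclass S d s" "t' \<in> cclass S d t" for s' t'
    using cclass_eq[OF rel] that by (simp add: mem_cclass)
  then show ?thesis unfolding clift2_def using cclass_self[OF s] cclass_self[OF t] by blast
qed

end

section \<open>The tensor powers of the correspondence\<close>

context branch_system
begin

abbreviation X where "X \<equiv> self_similar_corr N \<gamma>"

lemma cograph_iff: "p \<in> cograph N \<gamma> \<longleftrightarrow> snd p = h (fst p)"
proof
  assume "p \<in> cograph N \<gamma>"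
  then obtain j y where "j \<in> {1..N}" "p = (\<gamma> j y, y)" unfolding cograph_def by blast
  then show "snd p = h (fst p)" using h_\<gamma>[of j y] by simp
next
  assume p: "snd p = h (fst p)"
  obtain j where "j \<in> {1..N}" "\<gamma> j (h (fst p)) = fst p" using cover by blast
  then have "p = (\<gamma> j (snd p), snd p)" using p by (simp add: prod_eq_iff)
  then show "p \<in> cograph N \<gamma>" unfolding cograph_def using \<open>j \<in> _\<close> by blast
qed

lemma X_simps:
  "mcarrier X = {f \<in> extensional (cograph N \<gamma>). continuous_on (cograph N \<gamma>) f}"
  "mact X f b = (\<lambda>p\<in>cograph N \<gamma>. f p * b (snd p))"
  "mleft X a f = (\<lambda>p\<in>cograph N \<gamma>. a (fst p) * f p)"
  "minner X f g = (\<lambda>y. \<Sum>j=1..N. cnj (f (\<gamma> j y, y)) * g (\<gamma> j y, y))"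
  by (simp_all add: self_similar_corr_def)

lemma X_graph: "v \<in> mcarrier X \<Longrightarrow> (\<lambda>x. v (x, h x)) \<in> CK"
  unfolding CK_def mem_Collect_eq
  by (rule continuous_on_compose2[of "cograph N \<gamma>" v])
    (auto simp: X_simps cograph_iff intro!: continuous_intros cont_h)

lemma X_mact: "v \<in> mcarrier X \<Longrightarrow> b \<in> CK \<Longrightarrow> mact X v b \<in> mcarrier X"
  and X_mleft: "v \<in> mcarrier X \<Longrightarrow> b \<in> CK \<Longrightarrow> mleft X b v \<in> mcarrier X"
  by (auto simp: X_simps CK_def cong: continuous_on_cong intro!: continuous_intros
    intro: continuous_on_compose2[of UNIV b])

text \<open>The inverse of the identification of \<open>X\<close> with \<open>C(K)\<close>.\<close>

definition lift_fun :: "('k \<Rightarrow> complex) \<Rightarrow> 'k \<times> 'k \<Rightarrow> complex" where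
  "lift_fun f = (\<lambda>p\<in>cograph N \<gamma>. f (fst p))"

lemma lift_fun_X: "f \<in> CK \<Longrightarrow> lift_fun f \<in> mcarrier X"
  by (auto simp: X_simps CK_def lift_fun_def cong: continuous_on_cong intro!: continuous_intros
    intro: continuous_on_compose2[of UNIV f])

lemma lift_fun_graph: "lift_fun f (x, h x) = f x"
  by (simp add: lift_fun_def cograph_iff)

text \<open>The function on \<open>K\<close> that represents an elementary tensor, and its linear extension.\<close>

fun evalw :: "('k \<times> 'k \<Rightarrow> complex) list \<Rightarrow> 'k \<Rightarrow> complex" where
  "evalw [] x = 1"
| "evalw (v # vs) x = v (x, h x) * evalw vs (h x)"

definition eval :: "('k \<times> 'k \<Rightarrow> complex) ptensor \<Rightarrow> 'k \<Rightarrow> complex" where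
  "eval s x = (\<Sum>w\<in>Poly_Mapping.keys s. Poly_Mapping.lookup s w * evalw w x)"

lemma evalw_snoc: "evalw (vs @ [v]) x = evalw vs x * v ((h ^^ length vs) x, h ((h ^^ length vs) x))"
  by (induction vs arbitrary: x) (auto simp: funpow_Suc_right simp del: funpow.simps(2))

lemma evalw_CK: "set w \<subseteq> mcarrier X \<Longrightarrow> evalw w \<in> CK"
proof (induction w)
  case Nil
  have "evalw [] = (\<lambda>_. 1)" by (simp add: fun_eq_iff)
  then show ?case by simp
next
  case (Cons v w)
  then have "(\<lambda>x. v (x, h x) * evalw w (h x)) \<in> CK"
    by (intro CK_mult X_graph CK_comp[OF _ cont_h]) auto
  moreover have "evalw (v # w) = (\<lambda>x. v (x, h x) * evalw w (h x))" by (simp add: fun_eq_iff)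
  ultimately show ?case by simp
qed

lemma eval_CK: "s \<in> pt_carrier X n \<Longrightarrow> eval s \<in> CK"
  unfolding eval_def[abs_def] pt_carrier_def
  by (intro CK_sum CK_mult CK_const evalw_CK) auto

lemma eval_superset:
  assumes "finite A" "Poly_Mapping.keys s \<subseteq> A"
  shows "eval s x = (\<Sum>w\<in>A. Poly_Mapping.lookup s w * evalw w x)"
  unfolding eval_def by (rule sum.mono_neutral_left) (use assms in \<open>auto simp: in_keys_iff\<close>)

lemma eval_add: "eval (s + t) x = eval s x + eval t x"
proof -
  let ?A = "Poly_Mapping.keys s \<union> Poly_Mapping.keys t"
  have "eval (s + t) x = (\<Sum>w\<in>?A. Poly_Mapping.lookup (s + t) w * evalw w x)"
    by (rule eval_superset) (auto dest: subsetD[OF keys_add])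
  also have "\<dots> = eval s x + eval t x"
    by (simp add: eval_superset[of ?A] lookup_add distrib_right sum.distrib)
  finally show ?thesis .
qed

lemma eval_diff: "eval (s - t) x = eval s x - eval t x"
  using eval_add[of "s - t" t x] by simp

lemma eval_single: "eval (Poly_Mapping.single w c) x = c * evalw w x"
  by (simp add: eval_def)

lemma eval_sum: "finite I \<Longrightarrow> eval (\<Sum>i\<in>I. f i) x = (\<Sum>i\<in>I. eval (f i) x)"
proof (induction I rule: finite_induct)
  case empty
  show ?case by (simp add: eval_def)
qed (simp add: eval_add)

lemma eval_pt_map:
  assumes "\<And>w. w \<in> Poly_Mapping.keys s \<Longrightarrow> evalw (f w) x = c x * evalw w x"
  shows "eval (pt_map f s) x = c x * eval s x"
proof -
  have "eval (pt_map f s) x = (\<Sum>w\<in>Poly_Mapping.keys s. Poly_Mapping.lookup s w * evalw (f w) x)"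
    by (simp add: pt_map_def eval_sum eval_single)
  also have "\<dots> = (\<Sum>w\<in>Poly_Mapping.keys s. c x * (Poly_Mapping.lookup s w * evalw w x))"
    by (rule sum.cong) (auto simp: assms)
  finally show ?thesis by (simp add: eval_def sum_distrib_left)
qed

lemma pt_map_carrier:
  assumes "s \<in> pt_carrier E n"
    and "\<And>w. length w = n \<Longrightarrow> set w \<subseteq> mcarrier E \<Longrightarrow> length (f w) = m \<and> set (f w) \<subseteq> mcarrier E"
  shows "pt_map f s \<in> pt_carrier E m"
proof -
  have "Poly_Mapping.keys (pt_map f s) \<subseteq> (\<Union>w\<in>Poly_Mapping.keys s.
      Poly_Mapping.keys (Poly_Mapping.single (f w) (Poly_Mapping.lookup s w)))"
    unfolding pt_map_def by (rule keys_sum)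
  also have "\<dots> \<subseteq> f ` Poly_Mapping.keys s" by (auto split: if_splits)
  finally show ?thesis using assms unfolding pt_carrier_def by blast
qed

lemma pt_add: "s \<in> pt_carrier E n \<Longrightarrow> t \<in> pt_carrier E n \<Longrightarrow> s + t \<in> pt_carrier E n"
  using keys_add[of s t] by (auto simp: pt_carrier_def)

lemma pt_diff: "s \<in> pt_carrier E n \<Longrightarrow> t \<in> pt_carrier E n \<Longrightarrow> s - t \<in> pt_carrier E n"
  using keys_diff[of s t] by (auto simp: pt_carrier_def)

text \<open>The recursion of \<open>word_inner\<close> peels off one application of the transfer operator for each letter.\<close>

lemma word_inner_eq:
  "length v = n \<Longrightarrow> length w = n \<Longrightarrow>
    word_inner X a v w = transfer n (\<lambda>x. a x * cnj (evalw v x) * evalw w x)"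
proof (induction n arbitrary: a v w)
  case (Suc n)
  then obtain v0 vs w0 ws where vw: "v = v0 # vs" "w = w0 # ws" "length vs = n" "length ws = n"
    by (auto simp: length_Suc_conv)
  have "minner X v0 (mleft X a w0) y = (\<Sum>j=1..N. cnj (v0 (\<gamma> j y, y)) * (a (\<gamma> j y) * w0 (\<gamma> j y, y)))" for y
    unfolding X_simps by (rule sum.cong) (auto simp: cograph_iff h_\<gamma>)
  then have "word_inner X a v w = transfer n (\<lambda>x.
      (\<Sum>j=1..N. cnj (v0 (\<gamma> j x, x)) * (a (\<gamma> j x) * w0 (\<gamma> j x, x))) * cnj (evalw vs x) * evalw ws x)"
    by (simp add: vw Suc.IH)
  also have "\<dots> = transfer (Suc n) (\<lambda>x. a x * cnj (evalw v x) * evalw w x)"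
    unfolding transfer_Suc' vw
    by (rule arg_cong[where f = "transfer n"])
      (auto simp: fun_eq_iff sum_distrib_right sum_distrib_left h_\<gamma> mult_ac intro!: sum.cong)
  finally show ?case .
qed simp

lemma pt_inner_eq:
  assumes "s \<in> pt_carrier X n" "t \<in> pt_carrier X n"
  shows "pt_inner X s t = transfer n (\<lambda>x. cnj (eval s x) * eval t x)"
proof
  fix y
  let ?K = "Poly_Mapping.keys" and ?l = "Poly_Mapping.lookup"
  have "pt_inner X s t y = (\<Sum>v\<in>?K s. \<Sum>w\<in>?K t. cnj (?l s v) * ?l t w *
      transfer n (\<lambda>x. cnj (evalw v x) * evalw w x) y)"
    unfolding pt_inner_def
    by (intro sum.cong refl) (use assms in \<open>auto simp: pt_carrier_def word_inner_eq\<close>)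
  also have "\<dots> = transfer n (\<lambda>x. \<Sum>v\<in>?K s. \<Sum>w\<in>?K t. cnj (?l s v) * ?l t w *
      (cnj (evalw v x) * evalw w x)) y"
    by (simp add: transfer_sum transfer_cmult)
  also have "(\<lambda>x. \<Sum>v\<in>?K s. \<Sum>w\<in>?K t. cnj (?l s v) * ?l t w * (cnj (evalw v x) * evalw w x)) =
      (\<lambda>x. cnj (eval s x) * eval t x)"
    unfolding eval_def cnj_sum sum_product by (intro ext sum.cong refl) simp
  finally show "pt_inner X s t y = transfer n (\<lambda>x. cnj (eval s x) * eval t x) y" .
qed

abbreviation fdist :: "nat \<Rightarrow> ('k \<Rightarrow> complex) \<Rightarrow> ('k \<Rightarrow> complex) \<Rightarrow> real" where
  "fdist n f g \<equiv> mnorm (model n) (\<lambda>x. f x - g x)"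

lemma pt_dist_eq:
  assumes "s \<in> pt_carrier X n" "t \<in> pt_carrier X n"
  shows "pt_dist X s t = fdist n (eval s) (eval t)"
  by (simp add: pt_dist_def mnorm_def pt_inner_eq[OF pt_diff[OF assms] pt_diff[OF assms]] eval_diff)

lemma fdist_triangle:
  assumes "f \<in> CK" "g \<in> CK" "u \<in> CK"
  shows "fdist n f u \<le> fdist n f g + fdist n g u"
  using mnorm_triangle[OF CK_diff[OF assms(1,2)] CK_diff[OF assms(2,3)], of n] by simp

lemma pt_pseudo_metric: "pseudo_metric_on (pt_carrier X n) (pt_dist X)"
proof
  fix p q r assume *: "p \<in> pt_carrier X n" "q \<in> pt_carrier X n" "r \<in> pt_carrier X n"
  show "pt_dist X p p = 0" using * by (simp add: pt_dist_eq mnorm_zero)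
  show "pt_dist X p q = pt_dist X q p" using * mnorm_minus_commute[of n "eval p" "eval q"] by (simp add: pt_dist_eq)
  show "pt_dist X p r \<le> pt_dist X p q + pt_dist X q r"
    using * by (simp add: pt_dist_eq fdist_triangle eval_CK)
qed

text \<open>The element of the \<open>n\<close>-th tensor power that corresponds to \<open>f\<close>, as a set of Cauchy sequences: those
  whose values converge to \<open>f\<close>.\<close>

definition cls :: "nat \<Rightarrow> ('k \<Rightarrow> complex) \<Rightarrow> ('k \<times> 'k \<Rightarrow> complex) tensor" where
  "cls n f = {s. range s \<subseteq> pt_carrier X n \<and> (\<lambda>k. fdist n (eval (s k)) f) \<longlonglongrightarrow> 0}"

lemma eval_surj:
  assumes f: "f \<in> CK" and n: "1 \<le> n"
  shows "\<exists>s\<in>pt_carrier X n. eval s = f"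
proof -
  have one: "evalw (replicate k (lift_fun (\<lambda>_. 1))) x = 1" for k x
    by (induction k arbitrary: x) (auto simp: lift_fun_graph)
  let ?w = "lift_fun f # replicate (n - 1) (lift_fun (\<lambda>_. 1))"
  have "Poly_Mapping.single ?w 1 \<in> pt_carrier X n"
    using f n lift_fun_X by (auto simp: pt_carrier_def)
  moreover have "eval (Poly_Mapping.single ?w 1) = f"
    by (simp add: eval_single one lift_fun_graph fun_eq_iff)
  ultimately show ?thesis by blast
qed

lemma cls_nonempty: "f \<in> CK \<Longrightarrow> 1 \<le> n \<Longrightarrow> \<exists>s. s \<in> cls n f"
proof -
  assume "f \<in> CK" "1 \<le> n"
  then obtain s where "s \<in> pt_carrier X n" "eval s = f" using eval_surj by blast
  then have "(\<lambda>_. s) \<in> cls n f" by (auto simp: cls_def mnorm_zero)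
  then show ?thesis by blast
qed

lemma cls_eval: "s \<in> cls n f \<Longrightarrow> eval (s k) \<in> CK"
  by (rule eval_CK[of _ n]) (auto simp: cls_def)

lemma cls_inj:
  assumes "f \<in> CK" "g \<in> CK" "1 \<le> n" "cls n f = cls n g"
  shows "f = g"
proof
  fix x
  obtain s where "s \<in> pt_carrier X n" "eval s = f" using eval_surj assms by blast
  then have "(\<lambda>_. s) \<in> cls n f" by (auto simp: cls_def mnorm_zero)
  then have "(\<lambda>_. s) \<in> cls n g" using assms(4) by simp
  then have "(\<lambda>k::nat. fdist n f g) \<longlonglongrightarrow> 0"
    using \<open>eval s = f\<close> by (simp add: cls_def)
  then have "fdist n f g = 0" by (simp add: LIMSEQ_const_iff)
  then show "f x = g x" using cmod_le_mnorm[OF CK_diff[OF assms(1,2)], of x n] by simp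
qed

lemma cls_cauchy:
  assumes f: "f \<in> CK" and s: "s \<in> cls n f"
  shows "s \<in> cauchy_seqs (pt_carrier X n) (pt_dist X)"
proof -
  have sk: "s k \<in> pt_carrier X n" for k using s by (auto simp: cls_def)
  have "\<exists>M. \<forall>k\<ge>M. \<forall>l\<ge>M. pt_dist X (s k) (s l) < e" if "e > 0" for e
  proof -
    have "\<forall>\<^sub>F k in sequentially. fdist n (eval (s k)) f < e / 2"
      by (rule order_tendstoD(2)) (use s \<open>e > 0\<close> in \<open>auto simp: cls_def\<close>)
    then obtain M where M: "\<And>k. k \<ge> M \<Longrightarrow> fdist n (eval (s k)) f < e / 2"
      by (auto simp: eventually_sequentially)
    have "pt_dist X (s k) (s l) < e" if "k \<ge> M" "l \<ge> M" for k l
      using fdist_triangle[of "eval (s k)" f "eval (s l)" n] f eval_CK[OF sk] M[OF that(1)] M[OF that(2)]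
        mnorm_minus_commute[of n f "eval (s l)"]
      by (simp add: pt_dist_eq[OF sk sk])
    then show ?thesis by blast
  qed
  then show ?thesis using sk by (auto simp: cauchy_seqs_def)
qed

text \<open>The supremum norm is dominated by the module norm, so completeness of \<open>C(K)\<close> provides the limit.\<close>

lemma cauchy_cls:
  assumes s: "s \<in> cauchy_seqs (pt_carrier X n) (pt_dist X)"
  shows "\<exists>f\<in>CK. s \<in> cls n f"
proof -
  have sk: "s k \<in> pt_carrier X n" for k using s by (auto simp: cauchy_seqs_def)
  note ev = eval_CK[OF sk]
  have close: "cmod (eval (s k) x - eval (s l) x) \<le> pt_dist X (s k) (s l)" for k l x
    unfolding pt_dist_eq[OF sk sk] by (rule cmod_le_mnorm[OF CK_diff[OF ev ev]])
  have "uniformly_Cauchy_on UNIV (\<lambda>k. eval (s k))"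
    unfolding uniformly_Cauchy_on_def dist_norm
  proof (intro allI impI)
    fix e :: real assume "e > 0"
    then obtain M where "\<forall>k\<ge>M. \<forall>l\<ge>M. pt_dist X (s k) (s l) < e"
      using s by (auto simp: cauchy_seqs_def)
    then show "\<exists>M. \<forall>x\<in>UNIV. \<forall>m\<ge>M. \<forall>n\<ge>M. cmod (eval (s m) x - eval (s n) x) < e"
      using close order_le_less_trans by blast
  qed
  then obtain f where f: "uniform_limit UNIV (\<lambda>k. eval (s k)) f sequentially"
    using Cauchy_uniformly_convergent uniformly_convergent_on_def by blast
  have fCK: "f \<in> CK" by (rule CK_uniform_limit[OF ev f])
  have "(\<lambda>k. fdist n (eval (s k)) f) \<longlonglongrightarrow> 0"
  proof (rule LIMSEQ_I)
    fix e :: real assume e: "e > 0"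
    have half: "A * (e / (2 * A)) = e / 2" if "A > 0" for A :: real using that by simp
    define e' where "e' = e / (2 * (sqrt (real N ^ n) + 1))"
    have pos: "sqrt (real N ^ n) + 1 > 0" by (rule add_nonneg_pos) auto
    have e': "e' > 0" using e pos by (simp add: e'_def)
    obtain M where M: "\<And>k x. k \<ge> M \<Longrightarrow> cmod (eval (s k) x - f x) < e'"
      using uniform_limitD[OF f e'] by (auto simp: eventually_sequentially dist_norm)
    have "fdist n (eval (s k)) f < e" if "k \<ge> M" for k
    proof -
      have "fdist n (eval (s k)) f \<le> sqrt (real N ^ n) * e'"
        by (rule mnorm_le_sup[OF CK_diff[OF ev fCK]]) (use e' less_imp_le[OF M[OF that]] in auto)
      also have "\<dots> \<le> (sqrt (real N ^ n) + 1) * e'" using e' by (intro mult_right_mono) auto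
      also have "\<dots> = e / 2"
        unfolding e'_def by (rule half[OF pos])
      finally show ?thesis using e by simp
    qed
    then show "\<exists>M. \<forall>k\<ge>M. norm (fdist n (eval (s k)) f - 0) < e"
      using mnorm_nonneg[OF CK_diff[OF ev fCK]] by auto
  qed
  then show ?thesis using fCK sk by (auto simp: cls_def)
qed

lemma cls_cclass:
  assumes f: "f \<in> CK" and s: "s \<in> cls n f"
  shows "cclass (pt_carrier X n) (pt_dist X) s = cls n f"
proof -
  interpret pseudo_metric_on "pt_carrier X n" "pt_dist X" by (rule pt_pseudo_metric)
  have sk: "s k \<in> pt_carrier X n" for k using s by (auto simp: cls_def)
  have sf: "(\<lambda>k. fdist n (eval (s k)) f) \<longlonglongrightarrow> 0" using s by (simp add: cls_def)
  have "t \<in> cls n f \<longleftrightarrow> (s, t) \<in> completion_rel (pt_carrier X n) (pt_dist X)" for t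
  proof
    assume t: "t \<in> cls n f"
    then have tk: "t k \<in> pt_carrier X n" for k by (auto simp: cls_def)
    have "(\<lambda>k. fdist n (eval (s k)) f + fdist n (eval (t k)) f) \<longlonglongrightarrow> 0"
      using tendsto_add[OF sf, of _ 0] t by (simp add: cls_def)
    moreover have "pt_dist X (s k) (t k) \<le> fdist n (eval (s k)) f + fdist n (eval (t k)) f" for k
      using fdist_triangle[of "eval (s k)" f "eval (t k)" n] f eval_CK[OF sk] eval_CK[OF tk] mnorm_minus_commute[of n f "eval (t k)"]
      by (simp add: pt_dist_eq[OF sk tk])
    ultimately have "(\<lambda>k. pt_dist X (s k) (t k)) \<longlonglongrightarrow> 0"
      by (rule tendsto_zero_le) (rule d_nonneg[OF sk tk])
    then show "(s, t) \<in> completion_rel (pt_carrier X n) (pt_dist X)"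
      using cls_cauchy[OF f s] tk by (intro completion_relI) auto
  next
    assume t: "(s, t) \<in> completion_rel (pt_carrier X n) (pt_dist X)"
    then have tk: "t k \<in> pt_carrier X n" for k by (auto simp: completion_rel_def cauchy_seqs_def)
    have "(\<lambda>k. pt_dist X (s k) (t k) + fdist n (eval (s k)) f) \<longlonglongrightarrow> 0"
      using tendsto_add[OF _ sf, of _ 0] t by (simp add: completion_rel_def)
    moreover have "fdist n (eval (t k)) f \<le> pt_dist X (s k) (t k) + fdist n (eval (s k)) f" for k
      using fdist_triangle[of "eval (t k)" "eval (s k)" f n] f eval_CK[OF sk] eval_CK[OF tk]
        d_sym[of "s k" "t k"] sk tk
      by (simp add: pt_dist_eq[OF tk sk])
    ultimately have "(\<lambda>k. fdist n (eval (t k)) f) \<longlonglongrightarrow> 0"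
      by (rule tendsto_zero_le) (rule mnorm_nonneg[OF CK_diff[OF eval_CK[OF tk] f]])
    then show "t \<in> cls n f" using tk by (auto simp: cls_def)
  qed
  then show ?thesis by (intro set_eqI) (simp only: mem_cclass)
qed

lemma tensor_carrier: "1 \<le> n \<Longrightarrow> mcarrier (tensor_power X n) = cls n ` CK"
proof -
  assume n: "1 \<le> n"
  interpret pseudo_metric_on "pt_carrier X n" "pt_dist X" by (rule pt_pseudo_metric)
  have "completion (pt_carrier X n) (pt_dist X) = cls n ` CK"
  proof (intro equalityI subsetI)
    fix P assume "P \<in> completion (pt_carrier X n) (pt_dist X)"
    then obtain s where s: "s \<in> cauchy_seqs (pt_carrier X n) (pt_dist X)"
      "P = cclass (pt_carrier X n) (pt_dist X) s" by (rule completion_cases)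
    then show "P \<in> cls n ` CK" using cauchy_cls[OF s(1)] cls_cclass by blast
  next
    fix P assume "P \<in> cls n ` CK"
    then obtain f where f: "f \<in> CK" "P = cls n f" by blast
    then obtain s where "s \<in> cls n f" using cls_nonempty n by blast
    then show "P \<in> completion (pt_carrier X n) (pt_dist X)"
      using f cls_cauchy cls_cclass cclass_in by metis
  qed
  then show ?thesis by (simp add: tensor_power_def Let_def)
qed

text \<open>The left and right actions and \<open>f \<mapsto> f \<otimes> x\<close> all become multiplication by a function on \<open>C(K)\<close>.\<close>

lemma clift1_cls:
  assumes f: "f \<in> CK" and c: "c \<in> CK" and n: "1 \<le> n"
    and F: "\<And>s. s \<in> pt_carrier X n \<Longrightarrow> F s \<in> pt_carrier X m"
    and ev: "\<And>s x. s \<in> pt_carrier X n \<Longrightarrow> eval (F s) x = c x * eval s x"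
  shows "clift1 (pt_carrier X m) (pt_dist X) F (cls n f) = cls m (\<lambda>x. c x * f x)"
proof -
  have cf: "(\<lambda>x. c x * f x) \<in> CK" using c f by (rule CK_mult)
  have "(\<lambda>k. F (s k)) \<in> cls m (\<lambda>x. c x * f x)" if s: "s \<in> cls n f" for s
  proof -
    have sk: "s k \<in> pt_carrier X n" for k using s by (auto simp: cls_def)
    obtain C where C: "C \<ge> 0" "\<And>x. cmod (c x) \<le> C" using CK_bounded[OF cpt c] by blast
    have le: "fdist m (eval (F (s k))) (\<lambda>x. c x * f x) \<le> sqrt (real N ^ m) * (C * fdist n (eval (s k)) f)" for k
    proof (rule mnorm_le_sup)
      show "(\<lambda>x. eval (F (s k)) x - c x * f x) \<in> CK"
        using cf eval_CK[OF F[OF sk]] by (intro CK_diff)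
      show "0 \<le> C * fdist n (eval (s k)) f"
        using C mnorm_nonneg[OF CK_diff[OF eval_CK[OF sk] f]] by simp
      show "cmod (eval (F (s k)) x - c x * f x) \<le> C * fdist n (eval (s k)) f" for x
        unfolding ev[OF sk] right_diff_distrib[symmetric] norm_mult
        using C cmod_le_mnorm[OF CK_diff[OF eval_CK[OF sk] f]] by (intro mult_mono) auto
    qed
    have lim: "(\<lambda>k. sqrt (real N ^ m) * (C * fdist n (eval (s k)) f)) \<longlonglongrightarrow> 0"
      by (rule tendsto_mult_right_zero, rule tendsto_mult_right_zero) (use s in \<open>simp add: cls_def\<close>)
    have nn: "0 \<le> fdist m (eval (F (s k))) (\<lambda>x. c x * f x)" for k
      using cf eval_CK[OF F[OF sk]] by (intro mnorm_nonneg CK_diff)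
    have "(\<lambda>k. fdist m (eval (F (s k))) (\<lambda>x. c x * f x)) \<longlonglongrightarrow> 0"
      by (rule tendsto_zero_le[OF lim le nn])
    then show ?thesis using F[OF sk] by (auto simp: cls_def)
  qed
  then have "cclass (pt_carrier X m) (pt_dist X) (\<lambda>k. F (s k)) = cls m (\<lambda>x. c x * f x)" if "s \<in> cls n f" for s
    using cls_cclass[OF cf] that by blast
  then have "clift1 (pt_carrier X m) (pt_dist X) F (cls n f) = (\<Union>s\<in>cls n f. cls m (\<lambda>x. c x * f x))"
    unfolding clift1_def by (intro SUP_cong refl)
  moreover obtain s where "s \<in> cls n f" using cls_nonempty[OF f n] by blast
  ultimately show ?thesis by blast
qed

lemma clift2_cls:
  assumes f: "f \<in> CK" and g: "g \<in> CK" and n: "1 \<le> n"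
  shows "clift2 (pt_carrier X n) (pt_dist X) (+) (cls n f) (cls n g) = cls n (\<lambda>x. f x + g x)"
proof -
  have fg: "(\<lambda>x. f x + g x) \<in> CK" using f g by (rule CK_add)
  have "(\<lambda>k. s k + t k) \<in> cls n (\<lambda>x. f x + g x)" if s: "s \<in> cls n f" and t: "t \<in> cls n g" for s t
  proof -
    have sk: "s k \<in> pt_carrier X n" and tk: "t k \<in> pt_carrier X n" for k using s t by (auto simp: cls_def)
    have le: "fdist n (eval (s k + t k)) (\<lambda>x. f x + g x) \<le> fdist n (eval (s k)) f + fdist n (eval (t k)) g" for k
      using mnorm_triangle[of "\<lambda>x. eval (s k) x - f x" "\<lambda>x. eval (t k) x - g x" n]
        CK_diff[OF eval_CK[OF sk] f] CK_diff[OF eval_CK[OF tk] g]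
      by (simp add: eval_add algebra_simps)
    have lim: "(\<lambda>k. fdist n (eval (s k)) f + fdist n (eval (t k)) g) \<longlonglongrightarrow> 0"
      by (rule tendsto_add_zero) (use s t in \<open>simp_all add: cls_def\<close>)
    have nn: "0 \<le> fdist n (eval (s k + t k)) (\<lambda>x. f x + g x)" for k
      using fg eval_CK[OF pt_add[OF sk tk]] by (intro mnorm_nonneg CK_diff)
    have "(\<lambda>k. fdist n (eval (s k + t k)) (\<lambda>x. f x + g x)) \<longlonglongrightarrow> 0"
      by (rule tendsto_zero_le[OF lim le nn])
    then show ?thesis using pt_add[OF sk tk] by (auto simp: cls_def)
  qed
  then have "cclass (pt_carrier X n) (pt_dist X) (\<lambda>k. s k + t k) = cls n (\<lambda>x. f x + g x)"
    if "s \<in> cls n f" "t \<in> cls n g" for s t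
    using cls_cclass[OF fg] that by blast
  then have "clift2 (pt_carrier X n) (pt_dist X) (+) (cls n f) (cls n g) =
      (\<Union>s\<in>cls n f. \<Union>t\<in>cls n g. cls n (\<lambda>x. f x + g x))"
    unfolding clift2_def by (intro SUP_cong refl)
  moreover obtain s where "s \<in> cls n f" using cls_nonempty[OF f n] by blast
  moreover obtain t where "t \<in> cls n g" using cls_nonempty[OF g n] by blast
  ultimately show ?thesis by blast
qed

lemma tensor_madd:
  "f \<in> CK \<Longrightarrow> g \<in> CK \<Longrightarrow> 1 \<le> n \<Longrightarrow>
    madd (tensor_power X n) (cls n f) (cls n g) = cls n (\<lambda>x. f x + g x)"
  by (simp add: tensor_power_def Let_def clift2_cls)

lemma word_cases:
  assumes "length w = n" "1 \<le> n"
  obtains u v where "w = u @ [v]" "length u = n - 1"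
  using assms by (cases w rule: rev_cases) auto

lemma tensor_mact:
  assumes f: "f \<in> CK" and b: "b \<in> CK" and n: "1 \<le> n"
  shows "mact (tensor_power X n) (cls n f) b = cls n (\<lambda>x. f x * b ((h ^^ n) x))"
proof -
  let ?F = "\<lambda>w. butlast w @ [mact X (last w) b]"
  have "clift1 (pt_carrier X n) (pt_dist X) (pt_map ?F) (cls n f) = cls n (\<lambda>x. b ((h ^^ n) x) * f x)"
  proof (rule clift1_cls[OF f CK_comp[OF b cont_hn] n])
    fix s assume s: "s \<in> pt_carrier X n"
    show "pt_map ?F s \<in> pt_carrier X n"
    proof (rule pt_map_carrier[OF s])
      fix w assume w: "length w = n" "set w \<subseteq> mcarrier X"
      then show "length (?F w) = n \<and> set (?F w) \<subseteq> mcarrier X"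
        using n X_mact[OF _ b] by (elim word_cases[OF _ n]) auto
    qed
    fix x
    show "eval (pt_map ?F s) x = b ((h ^^ n) x) * eval s x"
    proof (rule eval_pt_map)
      fix w assume "w \<in> Poly_Mapping.keys s"
      then have "length w = n" using s by (auto simp: pt_carrier_def)
      then obtain u v where uv: "w = u @ [v]" "length u = n - 1" using n by (rule word_cases)
      have "(h ^^ n) x = h ((h ^^ (n - 1)) x)" using n by (cases n) auto
      then show "evalw (?F w) x = b ((h ^^ n) x) * evalw w x"
        using uv by (simp add: evalw_snoc X_simps cograph_iff)
    qed
  qed
  then show ?thesis by (simp add: tensor_power_def Let_def mult.commute)
qed

lemma tensor_mleft:
  assumes f: "f \<in> CK" and a: "a \<in> CK" and n: "1 \<le> n"
  shows "mleft (tensor_power X n) a (cls n f) = cls n (\<lambda>x. a x * f x)"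
proof -
  let ?F = "\<lambda>w. mleft X a (hd w) # tl w"
  have "clift1 (pt_carrier X n) (pt_dist X) (pt_map ?F) (cls n f) = cls n (\<lambda>x. a x * f x)"
  proof (rule clift1_cls[OF f a n])
    fix s assume s: "s \<in> pt_carrier X n"
    show "pt_map ?F s \<in> pt_carrier X n"
    proof (rule pt_map_carrier[OF s])
      fix w assume w: "length w = n" "set w \<subseteq> mcarrier X"
      then show "length (?F w) = n \<and> set (?F w) \<subseteq> mcarrier X"
        using n X_mleft[OF _ a] by (cases w) auto
    qed
    fix x
    show "eval (pt_map ?F s) x = a x * eval s x"
    proof (rule eval_pt_map)
      fix w assume "w \<in> Poly_Mapping.keys s"
      then have "length w = n" using s by (auto simp: pt_carrier_def)
      then show "evalw (?F w) x = a x * evalw w x"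
        using n by (cases w) (auto simp: X_simps cograph_iff)
    qed
  qed
  then show ?thesis by (simp add: tensor_power_def Let_def)
qed

lemma tensor_snoc_cls:
  assumes f: "f \<in> CK" and v: "v \<in> mcarrier X" and n: "1 \<le> n"
  shows "tensor_snoc X n (cls n f) v = cls (Suc n) (\<lambda>x. f x * v ((h ^^ n) x, h ((h ^^ n) x)))"
proof -
  let ?F = "\<lambda>w. w @ [v]"
  let ?c = "\<lambda>x. v ((h ^^ n) x, h ((h ^^ n) x))"
  have "clift1 (pt_carrier X (Suc n)) (pt_dist X) (pt_map ?F) (cls n f) = cls (Suc n) (\<lambda>x. ?c x * f x)"
  proof (rule clift1_cls[OF f CK_comp[OF X_graph[OF v] cont_hn] n])
    fix s assume s: "s \<in> pt_carrier X n"
    show "pt_map ?F s \<in> pt_carrier X (Suc n)"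
      by (rule pt_map_carrier[OF s]) (use v in auto)
    fix x
    show "eval (pt_map ?F s) x = ?c x * eval s x"
    proof (rule eval_pt_map)
      fix w assume "w \<in> Poly_Mapping.keys s"
      then have "length w = n" using s by (auto simp: pt_carrier_def)
      then show "evalw (?F w) x = ?c x * evalw w x" by (simp add: evalw_snoc)
    qed
  qed
  then show ?thesis by (simp add: tensor_snoc_def mult.commute)
qed

lemma tensor_minner:
  assumes f: "f \<in> CK" and g: "g \<in> CK" and n: "1 \<le> n"
  shows "minner (tensor_power X n) (cls n f) (cls n g) = transfer n (\<lambda>x. cnj (f x) * g x)"
proof
  fix y
  have pointwise: "(\<lambda>k. eval (s k) x) \<longlonglongrightarrow> f x" if s: "s \<in> cls n f" and f: "f \<in> CK" for s f x
  proof -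
    have lim: "(\<lambda>k. fdist n (eval (s k)) f) \<longlonglongrightarrow> 0" using s by (simp add: cls_def)
    have le: "dist (eval (s k) x) (f x) \<le> fdist n (eval (s k)) f" for k
      unfolding dist_norm by (rule cmod_le_mnorm[OF CK_diff[OF cls_eval[OF s] f]])
    have "(\<lambda>k. dist (eval (s k) x) (f x)) \<longlonglongrightarrow> 0"
      by (rule tendsto_zero_le[OF lim le]) simp
    then show ?thesis by (rule tendsto_dist_iff[THEN iffD2])
  qed
  have lim: "(\<lambda>k. pt_inner X (s k) (t k) y) \<longlonglongrightarrow> transfer n (\<lambda>x. cnj (f x) * g x) y"
    if s: "s \<in> cls n f" and t: "t \<in> cls n g" for s t
  proof -
    have "pt_inner X (s k) (t k) y = transfer n (\<lambda>x. cnj (eval (s k) x) * eval (t k) x) y" for k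
      using s t by (subst pt_inner_eq[of _ n]) (auto simp: cls_def)
    then show ?thesis
      unfolding transfer_def using pointwise[OF s f] pointwise[OF t g]
      by (auto intro!: tendsto_sum tendsto_mult tendsto_cnj)
  qed
  have "(THE z. \<forall>s\<in>cls n f. \<forall>t\<in>cls n g. (\<lambda>k. pt_inner X (s k) (t k) y) \<longlonglongrightarrow> z) =
      transfer n (\<lambda>x. cnj (f x) * g x) y"
  proof (rule the_equality)
    fix z assume z: "\<forall>s\<in>cls n f. \<forall>t\<in>cls n g. (\<lambda>k. pt_inner X (s k) (t k) y) \<longlonglongrightarrow> z"
    obtain s t where "s \<in> cls n f" "t \<in> cls n g" using cls_nonempty f g n by metis
    then show "z = transfer n (\<lambda>x. cnj (f x) * g x) y" using z lim LIMSEQ_unique by blast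
  qed (use lim in blast)
  then show "minner (tensor_power X n) (cls n f) (cls n g) y = transfer n (\<lambda>x. cnj (f x) * g x) y"
    by (simp add: tensor_power_def Let_def)
qed

end

section \<open>Transport of operators to the tensor powers\<close>

context branch_system
begin

abbreviation TP where "TP n \<equiv> tensor_power X n"

definition uncls :: "nat \<Rightarrow> ('k \<times> 'k \<Rightarrow> complex) tensor \<Rightarrow> 'k \<Rightarrow> complex" where
  "uncls n = inv_into CK (cls n)"

text \<open>Conjugation with \<open>cls n\<close> carries operators on \<open>C(K)\<close> to operators on the tensor power, and back.\<close>

definition up :: "nat \<Rightarrow> (('k \<Rightarrow> complex) \<Rightarrow> 'k \<Rightarrow> complex) \<Rightarrow>
    ('k \<times> 'k \<Rightarrow> complex) tensor \<Rightarrow> ('k \<times> 'k \<Rightarrow> complex) tensor" where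
  "up n T = (\<lambda>P\<in>mcarrier (TP n). cls n (T (uncls n P)))"

definition down :: "nat \<Rightarrow> (('k \<times> 'k \<Rightarrow> complex) tensor \<Rightarrow> ('k \<times> 'k \<Rightarrow> complex) tensor) \<Rightarrow>
    ('k \<Rightarrow> complex) \<Rightarrow> 'k \<Rightarrow> complex" where
  "down n T = (\<lambda>f\<in>CK. uncls n (T (cls n f)))"

context
  fixes n :: nat
  assumes n: "1 \<le> n"
begin

lemma uncls_cls: "f \<in> CK \<Longrightarrow> uncls n (cls n f) = f"
  unfolding uncls_def by (rule inv_into_f_f) (auto intro: inj_onI cls_inj n)

lemma cls_in: "f \<in> CK \<Longrightarrow> cls n f \<in> mcarrier (TP n)"
  by (simp add: tensor_carrier n[simplified])

lemma uncls:
  assumes "P \<in> mcarrier (TP n)"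
  shows uncls_CK: "uncls n P \<in> CK" and cls_uncls: "cls n (uncls n P) = P"
  using assms by (auto simp: tensor_carrier n[simplified] uncls_cls)

lemma up_cls: "f \<in> CK \<Longrightarrow> up n T (cls n f) = cls n (T f)"
  by (simp add: up_def cls_in uncls_cls)

lemma down_CK: "f \<in> CK \<Longrightarrow> down n T f = uncls n (T (cls n f))"
  by (simp add: down_def)

lemma TP_eqI:
  assumes "T \<in> extensional (mcarrier (TP n))" "S \<in> extensional (mcarrier (TP n))"
    and "\<And>f. f \<in> CK \<Longrightarrow> T (cls n f) = S (cls n f)"
  shows "T = S"
  by (rule extensionalityI[OF assms(1,2)]) (auto simp: tensor_carrier n[simplified] assms(3))

lemma up_extensional: "up n T \<in> extensional (mcarrier (TP n))"
  by (simp add: up_def)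

lemma up_inj:
  assumes T: "T \<in> L n" and S: "S \<in> L n" and eq: "up n T = up n S"
  shows "T = S"
proof (rule L_eqI[OF T S])
  fix f :: "'k \<Rightarrow> complex" assume f: "f \<in> CK"
  have "cls n (T f) = cls n (S f)" using fun_cong[OF eq, of "cls n f"] f by (simp add: up_cls)
  then show "T f = S f" using cls_inj[OF L_CK[OF T f] L_CK[OF S f] n] by simp
qed

lemma is_adjoint_up:
  assumes "is_adjoint (model n) T S"
  shows "is_adjoint (TP n) (up n T) (up n S)"
  unfolding is_adjoint_def
proof (intro conjI ballI)
  note CK = is_adjoint_CK[OF assms]
  show "up n T \<in> mcarrier (TP n) \<rightarrow>\<^sub>E mcarrier (TP n)" "up n S \<in> mcarrier (TP n) \<rightarrow>\<^sub>E mcarrier (TP n)"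
    by (auto simp: PiE_def up_extensional[unfolded tensor_carrier[OF n]] tensor_carrier n[simplified] up_cls CK)
  fix x y assume "x \<in> mcarrier (TP n)" "y \<in> mcarrier (TP n)"
  then obtain f g where "f \<in> CK" "x = cls n f" "g \<in> CK" "y = cls n g"
    by (auto simp: tensor_carrier n[simplified])
  then show "minner (TP n) (up n T x) y = minner (TP n) x (up n S y)"
    by (simp add: up_cls tensor_minner CK n[simplified] fun_eq_iff is_adjointD[OF assms])
qed

lemma is_adjoint_down:
  assumes "is_adjoint (TP n) T S"
  shows "is_adjoint (model n) (down n T) (down n S)"
proof (rule is_adjointI)
  have T: "T (cls n f) \<in> mcarrier (TP n)" and S: "S (cls n f) \<in> mcarrier (TP n)" if "f \<in> CK" for f
    using assms cls_in[OF that] by (auto simp: is_adjoint_def PiE_def)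
  show "down n T f \<in> CK" "down n S f \<in> CK" if "f \<in> CK" for f
    using uncls_CK[OF T[OF that]] uncls_CK[OF S[OF that]] that by (simp_all add: down_CK)
  fix f g :: "'k \<Rightarrow> complex" and y assume f: "f \<in> CK" and g: "g \<in> CK"
  have "minner (TP n) (T (cls n f)) (cls n g) = minner (TP n) (cls n f) (S (cls n g))"
    using assms cls_in[OF f] cls_in[OF g] by (auto simp: is_adjoint_def)
  then have "minner (TP n) (cls n (down n T f)) (cls n g) = minner (TP n) (cls n f) (cls n (down n S g))"
    using f g T[OF f] S[OF g] by (simp add: down_CK cls_uncls)
  then show "transfer n (\<lambda>x. cnj (down n T f x) * g x) y = transfer n (\<lambda>x. cnj (f x) * down n S g x) y"
    using f g T[OF f] S[OF g] by (simp add: tensor_minner n[simplified] down_CK uncls_CK fun_eq_iff)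
qed (auto simp: down_def)

lemma up_down:
  assumes "T \<in> mcarrier (TP n) \<rightarrow>\<^sub>E mcarrier (TP n)"
  shows "up n (down n T) = T"
proof (rule TP_eqI[OF up_extensional])
  show "T \<in> extensional (mcarrier (TP n))" using assms by (auto simp: PiE_def)
  show "up n (down n T) (cls n f) = T (cls n f)" if f: "f \<in> CK" for f
  proof -
    have "T (cls n f) \<in> mcarrier (TP n)" using assms cls_in[OF f] by blast
    then show ?thesis using f by (simp add: up_cls down_CK cls_uncls)
  qed
qed

lemma scarrier_TP: "scarrier (adjointables (TP n)) = up n ` L n"
proof (intro equalityI subsetI)
  fix T assume "T \<in> scarrier (adjointables (TP n))"
  then obtain S where S: "is_adjoint (TP n) T S" by (auto simp: adjointables_def)
  then have "up n (down n T) = T" by (intro up_down) (auto simp: is_adjoint_def)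
  then show "T \<in> up n ` L n" using L_I[OF is_adjoint_down[OF S]] by force
next
  fix T assume "T \<in> up n ` L n"
  then show "T \<in> scarrier (adjointables (TP n))"
    using is_adjoint_up by (auto simp: L_def adjointables_def)
qed

lemma sadd_TP:
  assumes "T \<in> L n" "S \<in> L n"
  shows "sadd (adjointables (TP n)) (up n T) (up n S) = up n (opadd T S)"
  by (rule TP_eqI)
    (use assms in \<open>auto simp: adjointables_def up_extensional up_cls cls_in op_apply tensor_madd L_CK n[simplified]\<close>)

lemma sscale_TP:
  assumes "T \<in> L n"
  shows "sscale (adjointables (TP n)) c (up n T) = up n (opscale c T)"
  by (rule TP_eqI)
    (use assms in \<open>auto simp: adjointables_def up_extensional up_cls cls_in op_apply tensor_mact L_CK n[simplified]\<close>)

lemma smult_TP: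
  assumes "T \<in> L n" "S \<in> L n"
  shows "smult (adjointables (TP n)) (up n T) (up n S) = up n (opmult T S)"
  by (rule TP_eqI)
    (use assms in \<open>auto simp: adjointables_def up_extensional up_cls cls_in op_apply L_CK n[simplified]\<close>)

lemma sstar_TP:
  assumes "T \<in> L n"
  shows "sstar (adjointables (TP n)) (up n T) = up n (adj n T)"
proof -
  have ad: "is_adjoint (model n) T (adj n T)" by (rule L_adj[OF assms])
  have "(THE S. is_adjoint (TP n) (up n T) S) = up n (adj n T)"
  proof (rule the_equality)
    show "is_adjoint (TP n) (up n T) (up n (adj n T))" by (rule is_adjoint_up[OF ad])
    fix S assume S: "is_adjoint (TP n) (up n T) S"
    have "down n (up n T) = T"
      by (rule extensionalityI[of _ CK])
        (use assms in \<open>auto simp: down_def up_cls L_extensional uncls_cls L_CK\<close>)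
    then have "down n S = adj n T"
      using is_adjoint_unique[OF ad] is_adjoint_down[OF S] by simp
    moreover have "up n (down n S) = S" using S by (intro up_down) (auto simp: is_adjoint_def)
    ultimately show "S = up n (adj n T)" by simp
  qed
  then show ?thesis by (simp add: adjointables_def)
qed

lemma mnorm_TP: "f \<in> CK \<Longrightarrow> mnorm (TP n) (cls n f) = mnorm (model n) f"
  by (simp add: mnorm_def tensor_minner n[simplified])

lemma snorm_TP:
  assumes "T \<in> L n"
  shows "snorm (adjointables (TP n)) (up n T) = nrm n T"
proof -
  have "{x \<in> mcarrier (TP n). mnorm (TP n) x \<le> 1} = cls n ` {f \<in> CK. mnorm (model n) f \<le> 1}"
    by (auto simp: tensor_carrier n[simplified] mnorm_TP)
  then have "(\<lambda>x. mnorm (TP n) (up n T x)) ` {x \<in> mcarrier (TP n). mnorm (TP n) x \<le> 1} =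
      (\<lambda>f. mnorm (model n) (T f)) ` {f \<in> CK. mnorm (model n) f \<le> 1}"
    unfolding image_image by (simp add: image_image) (rule image_cong, auto simp: up_cls mnorm_TP L_CK[OF assms])
  then show ?thesis by (simp add: adjointables_def nrm_eq)
qed

lemma sdist_TP:
  assumes "T \<in> L n" "S \<in> L n"
  shows "sdist (adjointables (TP n)) (up n T) (up n S) = opdist n T S"
  using assms by (simp add: sdist_def sscale_TP sadd_TP snorm_TP L_closed)

lemma theta_TP:
  assumes "u \<in> CK" "v \<in> CK"
  shows "theta (TP n) (cls n u) (cls n v) = up n (theta (model n) u v)"
  by (rule TP_eqI)
    (use assms in \<open>auto simp: theta_def up_extensional up_cls cls_in tensor_minner tensor_mact inner_CK n[simplified]\<close>)

lemma left_op_TP: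
  assumes "a \<in> CK"
  shows "left_op (TP n) a = up n (multop a)"
  by (rule TP_eqI)
    (use assms in \<open>auto simp: left_op_def up_extensional up_cls cls_in tensor_mleft op_apply n[simplified]\<close>)

text \<open>Conjugation is an isometric isomorphism of \<open>*\<close>-algebras, so it matches closed subalgebras and with
  them the compact operators.\<close>

lemma closed_subalgebra_TP:
  assumes D: "D \<subseteq> L n"
  shows "closed_star_subalgebra (adjointables (TP n)) (up n ` D) \<longleftrightarrow>
    closed_star_subalgebra (adjointables (model n)) D"
proof -
  have mem: "up n T \<in> up n ` D \<longleftrightarrow> T \<in> D" if "T \<in> L n" for T
    using up_inj that D by blast
  have lim: "(\<forall>F. \<forall>x\<in>up n ` L n. (\<forall>k::nat. F k \<in> up n ` D) \<and>
        (\<lambda>k. sdist (adjointables (TP n)) (F k) x) \<longlonglongrightarrow> 0 \<longrightarrow> x \<in> up n ` D) \<longleftrightarrow>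
      (\<forall>F. \<forall>x\<in>L n. (\<forall>k::nat. F k \<in> D) \<and> (\<lambda>k. opdist n (F k) x) \<longlonglongrightarrow> 0 \<longrightarrow> x \<in> D)" (is "?A \<longleftrightarrow> ?B")
  proof
    assume A: ?A
    show ?B
    proof (intro allI ballI impI, elim conjE)
      fix F x assume x: "x \<in> L n" and F: "\<forall>k::nat. F k \<in> D" and l: "(\<lambda>k. opdist n (F k) x) \<longlonglongrightarrow> 0"
      have FL: "F k \<in> L n" for k using F D by blast
      have "(\<lambda>k. sdist (adjointables (TP n)) (up n (F k)) (up n x)) \<longlonglongrightarrow> 0"
        using l by (simp add: sdist_TP FL x)
      then have "up n x \<in> up n ` D" using A[rule_format, of "up n x" "\<lambda>k. up n (F k)"] F x by blast
      then show "x \<in> D" using mem x by blast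
    qed
  next
    assume B: ?B
    show ?A
    proof (intro allI ballI impI, elim conjE)
      fix F x assume x: "x \<in> up n ` L n" and F: "\<forall>k::nat. F k \<in> up n ` D"
        and l: "(\<lambda>k. sdist (adjointables (TP n)) (F k) x) \<longlonglongrightarrow> 0"
      obtain x' where x': "x = up n x'" "x' \<in> L n" using x by blast
      have "\<forall>k. \<exists>T. T \<in> D \<and> F k = up n T" using F by blast
      then obtain F' where F': "\<And>k. F' k \<in> D" "\<And>k. F k = up n (F' k)" by metis
      have FL: "F' k \<in> L n" for k using F' D by blast
      have "(\<lambda>k. opdist n (F' k) x') \<longlonglongrightarrow> 0" using l by (simp add: F'(2) x'(1) sdist_TP FL x'(2))
      then have "x' \<in> D" using B F' x' by blast
      then show "x \<in> up n ` D" using x' by blast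
    qed
  qed
  have sub: "up n ` D \<subseteq> up n ` L n" using D by blast
  have add: "(\<forall>x\<in>up n ` D. \<forall>y\<in>up n ` D. sadd (adjointables (TP n)) x y \<in> up n ` D \<and>
        smult (adjointables (TP n)) x y \<in> up n ` D) \<longleftrightarrow>
      (\<forall>x\<in>D. \<forall>y\<in>D. opadd x y \<in> D \<and> opmult x y \<in> D)"
    using D by (simp add: sadd_TP smult_TP mem L_closed subset_iff)
  have scale: "(\<forall>c. \<forall>x\<in>up n ` D. sscale (adjointables (TP n)) c x \<in> up n ` D) \<longleftrightarrow>
      (\<forall>c. \<forall>x\<in>D. opscale c x \<in> D)"
    using D by (simp add: sscale_TP mem L_closed subset_iff)
  have star: "(\<forall>x\<in>up n ` D. sstar (adjointables (TP n)) x \<in> up n ` D) \<longleftrightarrow> (\<forall>x\<in>D. adj n x \<in> D)"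
    using D by (simp add: sstar_TP mem adj_in_L subset_iff)
  show ?thesis
    unfolding closed_subalgebra_model
    unfolding closed_star_subalgebra_def scarrier_TP lim add scale star
    using D sub by simp
qed

lemma compacts_TP: "compacts (TP n) = up n ` KK n"
proof -
  define S where "S = {theta (model n) x y | x y. x \<in> CK \<and> y \<in> CK}"
  have SL: "S \<subseteq> L n" by (auto simp: S_def intro: L_closed)
  have thetas: "{theta (TP n) x y | x y. x \<in> mcarrier (TP n) \<and> y \<in> mcarrier (TP n)} = up n ` S"
  proof (intro equalityI subsetI)
    fix T assume "T \<in> {theta (TP n) x y | x y. x \<in> mcarrier (TP n) \<and> y \<in> mcarrier (TP n)}"
    then obtain u v where "u \<in> CK" "v \<in> CK" "T = theta (TP n) (cls n u) (cls n v)"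
      by (auto simp: tensor_carrier n[simplified])
    then show "T \<in> up n ` S" by (auto simp: theta_TP S_def)
  next
    fix T assume "T \<in> up n ` S"
    then obtain u v where "u \<in> CK" "v \<in> CK" "T = theta (TP n) (cls n u) (cls n v)"
      by (auto simp: theta_TP S_def)
    then show "T \<in> {theta (TP n) x y | x y. x \<in> mcarrier (TP n) \<and> y \<in> mcarrier (TP n)}"
      using cls_in by blast
  qed
  have KK: "KK n = \<Inter>{D. closed_star_subalgebra (adjointables (model n)) D \<and> S \<subseteq> D}"
    by (simp add: compacts_def cstar_generated_def S_def)
  have TP: "compacts (TP n) = \<Inter>{D. closed_star_subalgebra (adjointables (TP n)) D \<and> up n ` S \<subseteq> D}"
    by (simp add: compacts_def cstar_generated_def thetas)
  have KL: "KK n \<subseteq> L n" using KK_L by blast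
  show ?thesis
  proof
    have "closed_star_subalgebra (adjointables (TP n)) (up n ` KK n)"
      using closed_subalgebra_TP[OF KL] closed_subalgebra_KK by simp
    moreover have "S \<subseteq> KK n" unfolding KK by blast
    ultimately show "compacts (TP n) \<subseteq> up n ` KK n" unfolding TP by blast
    show "up n ` KK n \<subseteq> compacts (TP n)"
      unfolding TP
    proof (intro Inter_greatest)
      fix D assume "D \<in> {D. closed_star_subalgebra (adjointables (TP n)) D \<and> up n ` S \<subseteq> D}"
      then have D: "closed_star_subalgebra (adjointables (TP n)) D" "up n ` S \<subseteq> D" by auto
      define D' where "D' = {T \<in> L n. up n T \<in> D}"
      have "D \<subseteq> up n ` L n" using D(1) unfolding closed_star_subalgebra_def scarrier_TP by blast
      then have D': "D = up n ` D'" "D' \<subseteq> L n" unfolding D'_def by blast+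
      have "closed_star_subalgebra (adjointables (model n)) D'"
        using closed_subalgebra_TP[OF D'(2)] D(1) D'(1) by simp
      moreover have "S \<subseteq> D'" using D(2) SL by (auto simp: D'_def)
      ultimately have "KK n \<subseteq> D'" unfolding KK by blast
      then show "up n ` KK n \<subseteq> D" using D' by blast
    qed
  qed
qed

end

text \<open>Amplification is the inclusion of operators on \<open>C(K)\<close>; it is determined by its values on
  \<open>f \<otimes> 1\<close>, which is \<open>f\<close> again.\<close>

lemma amplify_up:
  assumes n: "1 \<le> n" and T: "T \<in> L n"
  shows "amplify X n (up n T) = up (Suc n) T"
  unfolding amplify_def
proof (rule the_equality)
  have n': "1 \<le> Suc n" by simp
  have T': "T \<in> L (Suc n)" using T by (rule L_mono[rotated]) simp
  show "up (Suc n) T \<in> scarrier (adjointables (TP (Suc n))) \<and>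
      (\<forall>P\<in>mcarrier (TP n). \<forall>x\<in>mcarrier X. up (Suc n) T (tensor_snoc X n P x) = tensor_snoc X n (up n T P) x)"
  proof (intro conjI ballI)
    show "up (Suc n) T \<in> scarrier (adjointables (TP (Suc n)))" using T' by (simp add: scarrier_TP)
    fix P x assume P: "P \<in> mcarrier (TP n)" and x: "x \<in> mcarrier X"
    obtain f where f: "f \<in> CK" "P = cls n f" using P by (auto simp: tensor_carrier n[simplified])
    note gx = X_graph[OF x]
    have "(\<lambda>z. f z * x ((h ^^ n) z, h ((h ^^ n) z))) \<in> CK"
      using f CK_comp[OF gx cont_hn] by (intro CK_mult)
    then show "up (Suc n) T (tensor_snoc X n P x) = tensor_snoc X n (up n T P) x"
      using L_right[OF T f(1) gx]
      by (simp add: f(2) up_cls[OF n] up_cls[OF n'] f(1) tensor_snoc_cls[OF _ x n] L_CK[OF T])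
  qed
  fix S assume S: "S \<in> scarrier (adjointables (TP (Suc n))) \<and>
      (\<forall>P\<in>mcarrier (TP n). \<forall>x\<in>mcarrier X. S (tensor_snoc X n P x) = tensor_snoc X n (up n T P) x)"
  then obtain S' where S': "S = up (Suc n) S'" "S' \<in> L (Suc n)" by (auto simp: scarrier_TP)
  have "S' = T"
  proof (rule L_eqI[OF S'(2) T'])
    fix f :: "'k \<Rightarrow> complex" assume f: "f \<in> CK"
    have one: "lift_fun (\<lambda>_. 1) \<in> mcarrier X" by (rule lift_fun_X) simp
    have "S (tensor_snoc X n (cls n f) (lift_fun (\<lambda>_. 1))) =
        tensor_snoc X n (up n T (cls n f)) (lift_fun (\<lambda>_. 1))"
      using S one cls_in[OF n f] by blast
    then have "cls (Suc n) (S' f) = cls (Suc n) (T f)"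
      using f one by (simp add: tensor_snoc_cls[OF _ _ n] up_cls[OF n] up_cls[OF n'] L_CK[OF T] S'(1) lift_fun_graph)
    then show "S' f = T f" using cls_inj[OF L_CK[OF S'(2) f] L_CK[OF T f] n'] by blast
  qed
  then show "S = up (Suc n) T" using S' by simp
qed

lemma amplify_by_up: "1 \<le> n \<Longrightarrow> T \<in> L n \<Longrightarrow> amplify_by X n k (up n T) = up (n + k) T"
proof (induction k)
  case (Suc k)
  then have "T \<in> L (n + k)" using L_mono[of n "n + k"] by simp
  then show ?case using Suc by (simp add: amplify_up)
qed simp

lemma foldr_opadd:
  assumes "Z \<in> extensional CK"
  shows "foldr opadd (map T js) Z = (\<lambda>f\<in>CK. \<lambda>x. Z f x + (\<Sum>i\<leftarrow>js. T i f x))"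
proof (induction js)
  case Nil
  show ?case using assms by (auto simp: fun_eq_iff extensional_def)
next
  case (Cons i js)
  have eq: "foldr opadd (map T (i # js)) Z = opadd (T i) (foldr opadd (map T js) Z)" by simp
  show ?case unfolding eq Cons.IH by (auto simp: opadd_def fun_eq_iff)
qed

lemma foldr_opadd_levelop: "foldr opadd (map T [1..<Suc n]) (multop a) = levelop a T n"
proof -
  have "multop a \<in> extensional CK" by (simp add: multop_def)
  then have "foldr opadd (map T [1..<Suc n]) (multop a) =
      (\<lambda>f\<in>CK. \<lambda>x. multop a f x + (\<Sum>i\<leftarrow>[1..<Suc n]. T i f x))"
    by (rule foldr_opadd)
  also have "\<dots> = levelop a T n"
    unfolding levelop_def interv_sum_list_conv_sum_set_nat
    by (auto simp: op_apply fun_eq_iff atLeastLessThanSuc_atLeastAtMost simp del: upt_Suc)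
  finally show ?thesis .
qed

lemma foldr_up:
  assumes n: "1 \<le> n" and T: "\<And>i. i \<in> set js \<Longrightarrow> T i \<in> L n" and Z: "Z \<in> L n"
  shows "foldr (sadd (adjointables (TP n))) (map (\<lambda>i. up n (T i)) js) (up n Z) =
    up n (foldr opadd (map T js) Z) \<and> foldr opadd (map T js) Z \<in> L n"
  using T by (induction js) (auto simp: Z sadd_TP n[simplified] L_closed)

lemma core_level_eq:
  assumes n: "1 \<le> n"
  shows "core_level X n = up n ` FF n"
proof -
  have *: "foldr (sadd (adjointables (TP n)))
        (map (\<lambda>i. amplify_by X i (n - i) (U i)) [1..<Suc n])
        (amplify_by X 1 (n - 1) (left_op (TP 1) a)) = up n (levelop a T n)"
    if a: "a \<in> CK" and T: "\<forall>i\<in>{1..n}. T i \<in> KK i" and U: "\<forall>i\<in>{1..n}. U i = up i (T i)" for a T U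
  proof -
    have amp: "amplify_by X i (n - i) (U i) = up n (T i)" if "i \<in> set [1..<Suc n]" for i
    proof -
      have i: "i \<in> {1..n}" using that by auto
      then have "T i \<in> L i" using T KK_L by blast
      then show ?thesis using i U by (simp add: amplify_by_up)
    qed
    have TL: "T i \<in> L n" if "i \<in> set [1..<Suc n]" for i
      using that T KK_L[of "T i" i] L_mono[of i n "T i"] by auto
    have base: "amplify_by X 1 (n - 1) (left_op (TP 1) a) = up n (multop a)"
      using n a by (simp add: left_op_TP amplify_by_up L_closed)
    have "map (\<lambda>i. amplify_by X i (n - i) (U i)) [1..<Suc n] = map (\<lambda>i. up n (T i)) [1..<Suc n]"
      by (rule map_cong[OF refl amp])
    then show ?thesis
      using foldr_up[where T = T and Z = "multop a" and js = "[1..<Suc n]", OF n TL L_closed(4)[OF a]]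
      unfolding base foldr_opadd_levelop by (simp only: )
  qed
  show ?thesis
  proof (intro equalityI subsetI)
    fix S assume "S \<in> core_level X n"
    then obtain a U where aU: "a \<in> CK" "\<forall>i\<in>{1..n}. U i \<in> compacts (TP i)"
      and S: "S = foldr (sadd (adjointables (TP n)))
        (map (\<lambda>i. amplify_by X i (n - i) (U i)) [1..<Suc n])
        (amplify_by X 1 (n - 1) (left_op (TP 1) a))"
      unfolding core_level_def by blast
    have "\<exists>T. T \<in> KK i \<and> U i = up i T" if "i \<in> {1..n}" for i
    proof -
      have "U i \<in> up i ` KK i" using aU(2) that compacts_TP[of i] by auto
      then show ?thesis by blast
    qed
    then obtain T where T: "\<And>i. i \<in> {1..n} \<Longrightarrow> T i \<in> KK i \<and> U i = up i (T i)" by metis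
    have "S = up n (levelop a T n)" unfolding S by (rule *[OF aU(1)]) (use T in auto)
    then show "S \<in> up n ` FF n" using FF_I[of a n T] aU T by blast
  next
    fix S assume "S \<in> up n ` FF n"
    then obtain a T where T: "a \<in> CK" "\<forall>i\<in>{1..n}. T i \<in> KK i" "S = up n (levelop a T n)"
      by (auto simp: FF_def)
    have S: "S = foldr (sadd (adjointables (TP n)))
        (map (\<lambda>i. amplify_by X i (n - i) (up i (T i))) [1..<Suc n])
        (amplify_by X 1 (n - 1) (left_op (TP 1) a))"
      unfolding T(3) by (rule *[OF T(1,2), symmetric]) simp
    have "\<forall>i\<in>{1..n}. up i (T i) \<in> compacts (TP i)"
      using T(2) by (simp add: compacts_TP)
    then show "S \<in> core_level X n"
      unfolding core_level_def S mem_Collect_eq using T(1)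
      by (intro exI[of _ a] exI[of _ "\<lambda>i. up i (T i)"] conjI) auto
  qed
qed

end

section \<open>Operations on completions\<close>

context pseudo_metric_on
begin

lemma cauchy_seqs_lipschitz:
  assumes s: "s \<in> cauchy_seqs S d" and t: "t \<in> cauchy_seqs S d"
    and u: "\<And>k. u k \<in> S" and le: "\<And>k l. d (u k) (u l) \<le> K * (d (s k) (s l) + d (t k) (t l))"
  shows "u \<in> cauchy_seqs S d"
proof -
  have sS: "s k \<in> S" and tS: "t k \<in> S" for k
    using cauchy_seqsD[OF s] cauchy_seqsD[OF t] by blast+
  have "\<exists>M. \<forall>k\<ge>M. \<forall>l\<ge>M. d (u k) (u l) < e" if e: "e > 0" for e
  proof -
    define K' where "K' = max K 1"
    have K': "K' > 0" "K \<le> K'" by (auto simp: K'_def)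
    define e' where "e' = e / K' / 2"
    have e': "e' > 0" using e K' by (simp add: e'_def)
    obtain M1 where M1: "\<forall>k\<ge>M1. \<forall>l\<ge>M1. d (s k) (s l) < e'"
      using s e' unfolding cauchy_seqs_def by blast
    obtain M2 where M2: "\<forall>k\<ge>M2. \<forall>l\<ge>M2. d (t k) (t l) < e'"
      using t e' unfolding cauchy_seqs_def by blast
    have "d (u k) (u l) < e" if kl: "k \<ge> max M1 M2" "l \<ge> max M1 M2" for k l
    proof -
      have nn: "0 \<le> d (s k) (s l) + d (t k) (t l)"
        by (intro add_nonneg_nonneg d_nonneg sS tS)
      have "d (u k) (u l) \<le> K * (d (s k) (s l) + d (t k) (t l))" by (rule le)
      also have "\<dots> \<le> K' * (d (s k) (s l) + d (t k) (t l))"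
        using K' nn by (intro mult_right_mono) auto
      also have "\<dots> < K' * (e' + e')"
        using M1[rule_format, of k l] M2[rule_format, of k l] kl K'
        by (intro mult_strict_left_mono add_strict_mono) auto
      also have "\<dots> = e" using K' by (simp add: e'_def)
      finally show ?thesis .
    qed
    then show ?thesis by blast
  qed
  then show ?thesis using u by (auto simp: cauchy_seqs_def)
qed

text \<open>The Lipschitz constant may depend on the sequences, which covers multiplication: it is Lipschitz on
  bounded sets, and Cauchy sequences are bounded.\<close>

lemma clift2_lipschitz:
  assumes closed: "\<And>p q. p \<in> S \<Longrightarrow> q \<in> S \<Longrightarrow> f p q \<in> S"
    and lip: "\<And>s s' t t'. \<lbrakk>s \<in> cauchy_seqs S d; s' \<in> cauchy_seqs S d; t \<in> cauchy_seqs S d;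
        t' \<in> cauchy_seqs S d\<rbrakk> \<Longrightarrow>
      \<exists>K. \<forall>k l. d (f (s k) (t k)) (f (s' l) (t' l)) \<le> K * (d (s k) (s' l) + d (t k) (t' l))"
    and s: "s \<in> cauchy_seqs S d" and t: "t \<in> cauchy_seqs S d"
  shows "(\<lambda>k. f (s k) (t k)) \<in> cauchy_seqs S d"
    and "clift2 S d f (cclass S d s) (cclass S d t) = cclass S d (\<lambda>k. f (s k) (t k))"
proof -
  have cau: "(\<lambda>k. f (s k) (t k)) \<in> cauchy_seqs S d"
  proof -
    obtain K where "\<forall>k l. d (f (s k) (t k)) (f (s l) (t l)) \<le> K * (d (s k) (s l) + d (t k) (t l))"
      using lip[OF s s t t] by blast
    then show ?thesis
      by (intro cauchy_seqs_lipschitz[OF s t]) (auto intro: closed cauchy_seqsD[OF s] cauchy_seqsD[OF t])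
  qed
  then show "(\<lambda>k. f (s k) (t k)) \<in> cauchy_seqs S d" .
  show "clift2 S d f (cclass S d s) (cclass S d t) = cclass S d (\<lambda>k. f (s k) (t k))"
  proof (rule clift2_cclass[OF s t])
    fix s' t' assume rel: "(s, s') \<in> completion_rel S d" "(t, t') \<in> completion_rel S d"
    then have s': "s' \<in> cauchy_seqs S d" and t': "t' \<in> cauchy_seqs S d"
      and ls: "(\<lambda>k. d (s k) (s' k)) \<longlonglongrightarrow> 0" and lt: "(\<lambda>k. d (t k) (t' k)) \<longlonglongrightarrow> 0"
      by (auto simp: completion_rel_def)
    have S': "f (s' k) (t' k) \<in> S" "f (s k) (t k) \<in> S" for k
      by (auto intro: closed cauchy_seqsD[OF s] cauchy_seqsD[OF t] cauchy_seqsD[OF s'] cauchy_seqsD[OF t'])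
    obtain K where K: "\<And>k l. d (f (s k) (t k)) (f (s' l) (t' l)) \<le> K * (d (s k) (s' l) + d (t k) (t' l))"
      using lip[OF s s' t t'] by blast
    have lim: "(\<lambda>k. K * (d (s k) (s' k) + d (t k) (t' k))) \<longlonglongrightarrow> 0"
      by (rule tendsto_mult_right_zero, rule tendsto_add_zero[OF ls lt])
    have "(\<lambda>k. d (f (s k) (t k)) (f (s' k) (t' k))) \<longlonglongrightarrow> 0"
      by (rule tendsto_zero_le[OF lim K d_nonneg[OF S'(2,1)]])
    then show "(\<lambda>k. f (s k) (t k), \<lambda>k. f (s' k) (t' k)) \<in> completion_rel S d"
      using S' by (intro completion_relI[OF cau]) auto
  qed
qed

lemma clift1_lipschitz:
  assumes closed: "\<And>p. p \<in> S \<Longrightarrow> f p \<in> S"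
    and lip: "\<And>p q. p \<in> S \<Longrightarrow> q \<in> S \<Longrightarrow> d (f p) (f q) \<le> K * d p q" and K: "0 \<le> K"
    and s: "s \<in> cauchy_seqs S d"
  shows "(\<lambda>k. f (s k)) \<in> cauchy_seqs S d"
    and "clift1 S d f (cclass S d s) = cclass S d (\<lambda>k. f (s k))"
proof -
  have sS: "s k \<in> S" for k by (rule cauchy_seqsD[OF s])
  have cau: "(\<lambda>k. f (s k)) \<in> cauchy_seqs S d"
  proof (rule cauchy_seqs_lipschitz[OF s s])
    show "f (s k) \<in> S" for k by (rule closed[OF sS])
    fix k l
    have "K * d (s k) (s l) \<le> K * (d (s k) (s l) + d (s k) (s l))"
      using K d_nonneg[OF sS sS] by (intro mult_left_mono) auto
    then show "d (f (s k)) (f (s l)) \<le> K * (d (s k) (s l) + d (s k) (s l))"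
      using lip[OF sS sS] order_trans by blast
  qed
  then show "(\<lambda>k. f (s k)) \<in> cauchy_seqs S d" .
  show "clift1 S d f (cclass S d s) = cclass S d (\<lambda>k. f (s k))"
  proof (rule clift1_cclass[OF pseudo_metric_on_axioms s])
    fix t assume rel: "(s, t) \<in> completion_rel S d"
    then have tS: "t k \<in> S" for k by (auto simp: completion_rel_def cauchy_seqs_def)
    have lim: "(\<lambda>k. K * d (s k) (t k)) \<longlonglongrightarrow> 0"
      by (rule tendsto_mult_right_zero) (use rel in \<open>simp add: completion_rel_def\<close>)
    have "(\<lambda>k. d (f (s k)) (f (t k))) \<longlonglongrightarrow> 0"
      by (rule tendsto_zero_le[OF lim lip[OF sS tS] d_nonneg[OF closed[OF sS] closed[OF tS]]])
    then show "(\<lambda>k. f (s k), \<lambda>k. f (t k)) \<in> completion_rel S d"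
      using closed[OF tS] by (intro completion_relI[OF cau]) auto
  qed
qed

text \<open>The limit along one Cauchy sequence serves for all sequences of its class. The norm and the trace of the
  core are limits of this kind.\<close>

lemma contraction_limit:
  fixes \<phi> :: "'s \<Rightarrow> 'b::complete_space"
  assumes con: "\<And>p q. p \<in> S \<Longrightarrow> q \<in> S \<Longrightarrow> dist (\<phi> p) (\<phi> q) \<le> d p q"
    and s: "s \<in> cauchy_seqs S d"
  shows "(\<lambda>k. \<phi> (s k)) \<longlonglongrightarrow> (THE z. \<forall>t\<in>cclass S d s. (\<lambda>k. \<phi> (t k)) \<longlonglongrightarrow> z)"
proof -
  have sS: "s k \<in> S" for k by (rule cauchy_seqsD[OF s])
  have "Cauchy (\<lambda>k. \<phi> (s k))"
  proof (rule metric_CauchyI)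
    fix e :: real assume "e > 0"
    then obtain M where "\<forall>k\<ge>M. \<forall>l\<ge>M. d (s k) (s l) < e" using s unfolding cauchy_seqs_def by blast
    then show "\<exists>M. \<forall>m\<ge>M. \<forall>n\<ge>M. dist (\<phi> (s m)) (\<phi> (s n)) < e"
      using con[OF sS sS] order_le_less_trans by blast
  qed
  then obtain z where z: "(\<lambda>k. \<phi> (s k)) \<longlonglongrightarrow> z" using Cauchy_convergent convergent_def by blast
  have all: "(\<lambda>k. \<phi> (t k)) \<longlonglongrightarrow> z" if t: "t \<in> cclass S d s" for t
  proof -
    have rel: "(s, t) \<in> completion_rel S d" using t by (simp add: mem_cclass)
    then have tS: "t k \<in> S" for k by (auto simp: completion_rel_def cauchy_seqs_def)
    have lim: "(\<lambda>k. d (s k) (t k)) \<longlonglongrightarrow> 0" using rel by (simp add: completion_rel_def)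
    have "(\<lambda>k. dist (\<phi> (s k)) (\<phi> (t k))) \<longlonglongrightarrow> 0"
      by (rule tendsto_zero_le[OF lim con[OF sS tS] zero_le_dist])
    then have lim: "(\<lambda>k. dist (\<phi> (s k)) (\<phi> (t k)) + dist (\<phi> (s k)) z) \<longlonglongrightarrow> 0"
      by (rule tendsto_add_zero) (rule tendsto_dist_iff[THEN iffD1, OF z])
    have "(\<lambda>k. dist (\<phi> (t k)) z) \<longlonglongrightarrow> 0"
      by (rule tendsto_zero_le[OF lim _ zero_le_dist]) (rule dist_triangle3)
    then show ?thesis by (rule tendsto_dist_iff[THEN iffD2])
  qed
  have "(THE z. \<forall>t\<in>cclass S d s. (\<lambda>k. \<phi> (t k)) \<longlonglongrightarrow> z) = z"
    using all cclass_self[OF s] z LIMSEQ_unique by (intro the_equality) blast+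
  then show ?thesis using z by simp
qed

end

section \<open>The core\<close>

context branch_measure
begin

lemma down_up: "1 \<le> n \<Longrightarrow> T \<in> L n \<Longrightarrow> down n (up n T) = T"
  by (rule extensionalityI[of _ CK])
    (auto simp: down_def up_cls L_extensional uncls_cls L_CK)

abbreviation CP where "CP \<equiv> cp_carrier X"
abbreviation cdist where "cdist \<equiv> cp_dist X"

lemma CP_iff: "(n, S) \<in> CP \<longleftrightarrow> 1 \<le> n \<and> (\<exists>T\<in>FF n. S = up n T)"
  by (auto simp: cp_carrier_def core_level_eq)

lemma CP_I: "1 \<le> n \<Longrightarrow> T \<in> FF n \<Longrightarrow> (n, up n T) \<in> CP"
  by (auto simp: CP_iff)

lemma CP_cases:
  assumes "p \<in> CP"
  obtains n T where "p = (n, up n T)" "1 \<le> n" "T \<in> FF n"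
  using assms by (cases p) (auto simp: CP_iff)

lemma cp_raise_up: "1 \<le> n \<Longrightarrow> n \<le> m \<Longrightarrow> T \<in> L n \<Longrightarrow> cp_raise X m (n, up n T) = up m T"
  by (simp add: cp_raise_def amplify_by_up)

lemma opdist_mono: "n \<le> m \<Longrightarrow> T \<in> L n \<Longrightarrow> S \<in> L n \<Longrightarrow> opdist m T S = opdist n T S"
  by (intro nrm_mono L_closed)

lemma cp_ops:
  assumes n: "1 \<le> n" and m: "1 \<le> m" and T: "T \<in> FF n" and S: "S \<in> FF m"
  shows "cp_add X (n, up n T) (m, up m S) = (max n m, up (max n m) (opadd T S))"
    "cp_mult X (n, up n T) (m, up m S) = (max n m, up (max n m) (opmult T S))"
    "cp_scale X c (n, up n T) = (n, up n (opscale c T))"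
    "cp_star X (n, up n T) = (n, up n (adj n T))"
    "cp_norm X (n, up n T) = nrm n T"
proof -
  have *: "T \<in> L n" "S \<in> L m" using T S FF_L by auto
  then have **: "T \<in> L (max n m)" "S \<in> L (max n m)" using L_mono[of n "max n m" T] L_mono[of m "max n m" S] by auto
  have k: "1 \<le> max n m" using n by simp
  note r = cp_raise_up[OF n _ *(1), of "max n m"] cp_raise_up[OF m _ *(2), of "max n m"]
  show "cp_add X (n, up n T) (m, up m S) = (max n m, up (max n m) (opadd T S))"
    by (simp add: cp_add_def Let_def r sadd_TP[OF k **])
  show "cp_mult X (n, up n T) (m, up m S) = (max n m, up (max n m) (opmult T S))"
    by (simp add: cp_mult_def Let_def r smult_TP[OF k **])
  show "cp_scale X c (n, up n T) = (n, up n (opscale c T))"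
    by (simp add: cp_scale_def sscale_TP[OF n *(1)])
  show "cp_star X (n, up n T) = (n, up n (adj n T))"
    by (simp add: cp_star_def sstar_TP[OF n *(1)])
  show "cp_norm X (n, up n T) = nrm n T"
    by (simp add: cp_norm_def snorm_TP[OF n *(1)])
qed

lemma cdist_eq:
  assumes n: "1 \<le> n" and m: "1 \<le> m" and T: "T \<in> FF n" and S: "S \<in> FF m" and k: "n \<le> k" "m \<le> k"
  shows "cdist (n, up n T) (m, up m S) = opdist k T S"
proof -
  have *: "T \<in> L n" "S \<in> L m" using T S FF_L by auto
  then have **: "T \<in> L (max n m)" "S \<in> L (max n m)" using L_mono[of n "max n m" T] L_mono[of m "max n m" S] by auto
  have mx: "1 \<le> max n m" using n by simp
  note r = cp_raise_up[OF n _ *(1), of "max n m"] cp_raise_up[OF m _ *(2), of "max n m"]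
  have "cdist (n, up n T) (m, up m S) = opdist (max n m) T S"
    by (simp add: cp_dist_def Let_def r sdist_TP[OF mx **])
  also have "\<dots> = opdist k T S" using k by (intro opdist_mono[symmetric] **) auto
  finally show ?thesis .
qed

text \<open>The operations on pairs move them to a common level. This provides one for finitely many pairs, and the
  operators on \<open>C(K)\<close> that they stand for.\<close>

lemma CP_common:
  assumes "finite A" "A \<subseteq> CP"
  shows "\<exists>M\<ge>1. \<exists>op. \<forall>p\<in>A. 1 \<le> fst p \<and> fst p \<le> M \<and> p = (fst p, up (fst p) (op p)) \<and>
    op p \<in> FF (fst p) \<and> op p \<in> FF M \<and> op p \<in> L M"
proof -
  define M where "M = Max (insert 1 (fst ` A))"
  have M: "1 \<le> M" "\<And>p. p \<in> A \<Longrightarrow> fst p \<le> M" using assms(1) by (auto simp: M_def)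
  have "\<exists>T. 1 \<le> fst p \<and> p = (fst p, up (fst p) T) \<and> T \<in> FF (fst p)" if "p \<in> A" for p
  proof -
    have "p \<in> CP" using that assms(2) by blast
    then obtain n T where "p = (n, up n T)" "1 \<le> n" "T \<in> FF n" by (rule CP_cases)
    then show ?thesis by (intro exI[of _ T]) simp
  qed
  then obtain op where op: "\<And>p. p \<in> A \<Longrightarrow> 1 \<le> fst p \<and> p = (fst p, up (fst p) (op p)) \<and> op p \<in> FF (fst p)"
    by metis
  have FM: "op p \<in> FF M" if "p \<in> A" for p using op[OF that] M(2)[OF that] FF_mono by blast
  show ?thesis
  proof (intro exI[of _ M] conjI exI[of _ op] ballI)
    fix p assume p: "p \<in> A"
    show "1 \<le> fst p" "p = (fst p, up (fst p) (op p))" "op p \<in> FF (fst p)" using op[OF p] by blast+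
    show "fst p \<le> M" by (rule M(2)[OF p])
    show "op p \<in> FF M" by (rule FM[OF p])
    then show "op p \<in> L M" by (rule FF_L)
  qed (rule M(1))
qed

lemma core_pseudo_metric: "pseudo_metric_on CP cdist"
proof
  fix p q r assume pqr: "p \<in> CP" "q \<in> CP" "r \<in> CP"
  obtain M op where op: "\<And>x. x \<in> {p, q, r} \<Longrightarrow> 1 \<le> fst x \<and> fst x \<le> M \<and> x = (fst x, up (fst x) (op x)) \<and>
      op x \<in> FF (fst x) \<and> op x \<in> FF M \<and> op x \<in> L M"
    using CP_common[of "{p, q, r}"] pqr by auto
  have dist: "cdist x y = opdist M (op x) (op y)" if "x \<in> {p, q, r}" "y \<in> {p, q, r}" for x y
    using op[OF that(1)] op[OF that(2)] cdist_eq[of "fst x" "fst y" "op x" "op y" M] by metis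
  show "cdist p p = 0" using dist[of p p] op[of p] by (simp add: opdist_refl)
  show "cdist p q = cdist q p" using dist[of p q] dist[of q p] op[of p] op[of q] opdist_commute by simp
  show "cdist p r \<le> cdist p q + cdist q r"
    using dist[of p r] dist[of p q] dist[of q r] op[of p] op[of q] op[of r] opdist_triangle by simp
qed

sublocale core: pseudo_metric_on CP cdist by (rule core_pseudo_metric)

lemma CP_closed:
  assumes p: "p \<in> CP" and q: "q \<in> CP"
  shows "cp_add X p q \<in> CP" "cp_mult X p q \<in> CP" "cp_scale X c p \<in> CP" "cp_star X p \<in> CP"
proof -
  obtain n T where nT: "p = (n, up n T)" "1 \<le> n" "T \<in> FF n" using p by (rule CP_cases)
  obtain m S where mS: "q = (m, up m S)" "1 \<le> m" "S \<in> FF m" using q by (rule CP_cases)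
  have T: "T \<in> FF (max n m)" "S \<in> FF (max n m)"
    using nT mS FF_mono[of n "max n m" T] FF_mono[of m "max n m" S] by auto
  have mx: "1 \<le> max n m" using nT by simp
  show "cp_add X p q \<in> CP" "cp_mult X p q \<in> CP" "cp_scale X c p \<in> CP" "cp_star X p \<in> CP"
    unfolding nT(1) mS(1) cp_ops[OF nT(2) mS(2) nT(3) mS(3)]
    by (intro CP_I mx nT FF_opadd FF_opmult FF_opscale FF_adj T)+
qed

text \<open>The trace of an element of the union of the levels, read off on \<open>C(K)\<close>.\<close>

definition trp :: "nat \<times> (('k \<times> 'k \<Rightarrow> complex) tensor \<Rightarrow> ('k \<times> 'k \<Rightarrow> complex) tensor) \<Rightarrow> complex" where
  "trp p = tr (fst p) (down (fst p) (snd p))"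

lemma trp_eq: "1 \<le> n \<Longrightarrow> T \<in> FF n \<Longrightarrow> trp (n, up n T) = tr n T"
  by (simp add: trp_def down_up FF_L)

text \<open>The case of two pairs, with the level at which their sum and product are formed.\<close>

lemma CP_at_level:
  assumes "p \<in> CP" "q \<in> CP"
  obtains M T S n m where "1 \<le> n" "1 \<le> m" "n \<le> M" "m \<le> M" "p = (n, up n T)" "q = (m, up m S)"
    "T \<in> FF n" "S \<in> FF m" "T \<in> FF M" "S \<in> FF M" "T \<in> L M" "S \<in> L M" "M = max n m"
proof -
  obtain n T where nT: "p = (n, up n T)" "1 \<le> n" "T \<in> FF n" using assms(1) by (rule CP_cases)
  obtain m S where mS: "q = (m, up m S)" "1 \<le> m" "S \<in> FF m" using assms(2) by (rule CP_cases)
  have T: "T \<in> FF (max n m)" "S \<in> FF (max n m)"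
    using nT mS FF_mono[of n "max n m" T] FF_mono[of m "max n m" S] by auto
  show thesis
    by (rule that[of n m "max n m" T S]) (use nT mS T FF_L in auto)
qed

lemma trp_ops:
  assumes p: "p \<in> CP" and q: "q \<in> CP"
  shows "trp (cp_add X p q) = trp p + trp q" "trp (cp_mult X p q) = trp (cp_mult X q p)"
    "trp (cp_scale X c p) = c * trp p" "trp (cp_mult X (cp_star X p) p) \<in> \<real>\<^sub>\<ge>\<^sub>0"
    "cmod (trp p) \<le> cp_norm X p" "dist (trp p) (trp q) \<le> cdist p q"
proof -
  obtain M T S n m where *: "1 \<le> n" "1 \<le> m" "n \<le> M" "m \<le> M" "p = (n, up n T)" "q = (m, up m S)"
    "T \<in> FF n" "S \<in> FF m" "T \<in> FF M" "S \<in> FF M" "T \<in> L M" "S \<in> L M" "M = max n m"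
    using CP_at_level[OF p q] .
  have M: "1 \<le> M" using * by simp
  note ops = cp_ops[OF *(1,2,7,8)] cp_ops(2)[OF *(2,1,8,7)]
  have tr: "tr n T = tr M T" "tr m S = tr M S"
    using * by (auto intro!: tr_mono[symmetric] FF_L)
  show "trp (cp_add X p q) = trp p + trp q"
    using * M tr by (simp add: ops trp_eq FF_opadd tr_add del: One_nat_def)
  show "trp (cp_mult X p q) = trp (cp_mult X q p)"
    unfolding *(5,6) ops max.commute[of m n] *(13)[symmetric]
    unfolding trp_eq[OF M FF_opmult[OF *(9,10)]] trp_eq[OF M FF_opmult[OF *(10,9)]]
    by (rule tr_comm[OF *(10,9)])
  show "trp (cp_scale X c p) = c * trp p"
    using * by (simp add: ops trp_eq FF_opscale tr_scale del: One_nat_def)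
  have "cp_mult X (cp_star X p) p = (n, up n (opmult (adj n T) T))"
    using * cp_ops(2)[OF *(1,1) FF_adj[OF *(7)] *(7)] by (simp add: ops)
  then show "trp (cp_mult X (cp_star X p) p) \<in> \<real>\<^sub>\<ge>\<^sub>0"
    using * by (simp add: trp_eq FF_opmult FF_adj tr_pos del: One_nat_def)
  show "cmod (trp p) \<le> cp_norm X p" using * by (simp add: ops trp_eq tr_bound del: One_nat_def)
  have "cdist p q = opdist M T S" unfolding *(5,6) by (rule cdist_eq) (use * in auto)
  then show "dist (trp p) (trp q) \<le> cdist p q"
    using * tr tr_dist[of T M S] by (simp add: trp_eq del: One_nat_def)
qed

lemma cp_estimates:
  assumes p: "p \<in> CP" "p' \<in> CP" and q: "q \<in> CP" "q' \<in> CP"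
  shows "cdist (cp_add X p q) (cp_add X p' q') \<le> cdist p p' + cdist q q'"
    "cdist (cp_mult X p q) (cp_mult X p' q') \<le> cp_norm X p * cdist q q' + cdist p p' * cp_norm X q'"
    "cdist (cp_scale X c p) (cp_scale X c p') \<le> cmod c * cdist p p'"
    "cdist (cp_star X p) (cp_star X p') \<le> cdist p p'"
    "dist (cp_norm X p) (cp_norm X p') \<le> cdist p p'"
    "cp_norm X (cp_add X p (cp_scale X (-1) p')) = cdist p p'"
    "0 \<le> cp_norm X p"
proof -
  define A where "A = {p, p', q, q'}"
  obtain M op where M: "1 \<le> M" and op: "\<And>x. x \<in> A \<Longrightarrow> 1 \<le> fst x \<and> fst x \<le> M \<and>
      x = (fst x, up (fst x) (op x)) \<and> op x \<in> FF (fst x) \<and> op x \<in> FF M \<and> op x \<in> L M"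
    using CP_common[of A] p q by (auto simp: A_def)
  have A: "p \<in> A" "p' \<in> A" "q \<in> A" "q' \<in> A" by (auto simp: A_def)
  have L: "op x \<in> L M" if "x \<in> A" for x using op[OF that] by blast
  have dist: "cdist x y = opdist M (op x) (op y)" if "x \<in> A" "y \<in> A" for x y
    using op[OF that(1)] op[OF that(2)] cdist_eq[of "fst x" "fst y" "op x" "op y" M] by metis
  have norm: "cp_norm X x = nrm M (op x)" if "x \<in> A" for x
  proof -
    have "op x \<in> L (fst x)" using op[OF that] FF_L by blast
    then show ?thesis
      using op[OF that] cp_ops(5)[of "fst x" "fst x" "op x" "op x"] nrm_mono[of "fst x" M "op x"] by metis
  qed
  have binop: "\<exists>m. 1 \<le> m \<and> m \<le> M \<and> cp_add X x y = (m, up m (opadd (op x) (op y))) \<and>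
      cp_mult X x y = (m, up m (opmult (op x) (op y))) \<and>
      opadd (op x) (op y) \<in> FF m \<and> opmult (op x) (op y) \<in> FF m" if "x \<in> A" "y \<in> A" for x y
  proof -
    let ?m = "max (fst x) (fst y)"
    have "op x \<in> FF ?m" "op y \<in> FF ?m"
      using op[OF that(1)] op[OF that(2)] FF_mono[of "fst x" ?m "op x"] FF_mono[of "fst y" ?m "op y"] by auto
    then show ?thesis
      using op[OF that(1)] op[OF that(2)] cp_ops(1,2)[of "fst x" "fst y" "op x" "op y"]
      by (intro exI[of _ ?m]) (auto intro: FF_opadd FF_opmult)
  qed
  obtain m1 where m1: "1 \<le> m1" "m1 \<le> M" "cp_add X p q = (m1, up m1 (opadd (op p) (op q)))"
    "cp_mult X p q = (m1, up m1 (opmult (op p) (op q)))"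
    "opadd (op p) (op q) \<in> FF m1" "opmult (op p) (op q) \<in> FF m1" using binop[OF A(1,3)] by blast
  obtain m2 where m2: "1 \<le> m2" "m2 \<le> M" "cp_add X p' q' = (m2, up m2 (opadd (op p') (op q')))"
    "cp_mult X p' q' = (m2, up m2 (opmult (op p') (op q')))"
    "opadd (op p') (op q') \<in> FF m2" "opmult (op p') (op q') \<in> FF m2" using binop[OF A(2,4)] by blast
  have "cdist (cp_add X p q) (cp_add X p' q') = opdist M (opadd (op p) (op q)) (opadd (op p') (op q'))"
    unfolding m1 m2 by (rule cdist_eq) (use m1 m2 in auto)
  then show "cdist (cp_add X p q) (cp_add X p' q') \<le> cdist p p' + cdist q q'"
    using dist A L opdist_opadd by simp
  have "cdist (cp_mult X p q) (cp_mult X p' q') = opdist M (opmult (op p) (op q)) (opmult (op p') (op q'))"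
    unfolding m1 m2 by (rule cdist_eq) (use m1 m2 in auto)
  also have "\<dots> \<le> opdist M (opmult (op p) (op q)) (opmult (op p) (op q')) +
      opdist M (opmult (op p) (op q')) (opmult (op p') (op q'))"
    using A L by (intro opdist_triangle L_closed) auto
  also have "\<dots> \<le> nrm M (op p) * opdist M (op q) (op q') + opdist M (op p) (op p') * nrm M (op q')"
    using A L by (intro add_mono opdist_left opdist_right) auto
  finally show "cdist (cp_mult X p q) (cp_mult X p' q') \<le> cp_norm X p * cdist q q' + cdist p p' * cp_norm X q'"
    using dist norm A by simp
  have un: "cp_scale X c x = (fst x, up (fst x) (opscale c (op x)))"
    "cp_star X x = (fst x, up (fst x) (adj M (op x)))"
    "opscale c (op x) \<in> FF (fst x)" "adj M (op x) \<in> FF (fst x)" if "x \<in> A" for x c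
  proof -
    have x: "1 \<le> fst x" "fst x \<le> M" "x = (fst x, up (fst x) (op x))" "op x \<in> FF (fst x)"
      using op[OF that] by blast+
    have "adj M (op x) = adj (fst x) (op x)" using x by (intro adj_mono FF_L)
    then show "cp_scale X c x = (fst x, up (fst x) (opscale c (op x)))"
      "cp_star X x = (fst x, up (fst x) (adj M (op x)))"
      "opscale c (op x) \<in> FF (fst x)" "adj M (op x) \<in> FF (fst x)"
      using cp_ops(3,4)[OF x(1,1,4,4)] x FF_opscale FF_adj by metis+
  qed
  have "cdist (cp_scale X c p) (cp_scale X c p') = opdist M (opscale c (op p)) (opscale c (op p'))"
    unfolding un(1)[OF A(1)] un(1)[OF A(2)] using op[OF A(1)] op[OF A(2)] un(3) A
    by (intro cdist_eq) auto
  then show "cdist (cp_scale X c p) (cp_scale X c p') \<le> cmod c * cdist p p'"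
    using dist A L opdist_opscale by simp
  have "cdist (cp_star X p) (cp_star X p') = opdist M (adj M (op p)) (adj M (op p'))"
    unfolding un(2)[OF A(1)] un(2)[OF A(2)] using op[OF A(1)] op[OF A(2)] un(4) A
    by (intro cdist_eq) auto
  then show "cdist (cp_star X p) (cp_star X p') \<le> cdist p p'"
    using dist A L opdist_adj by simp
  show "dist (cp_norm X p) (cp_norm X p') \<le> cdist p p'"
    using nrm_le_opdist[OF L[OF A(1)] L[OF A(2)]] nrm_le_opdist[OF L[OF A(2)] L[OF A(1)]]
      opdist_commute[OF L[OF A(1)] L[OF A(2)]]
    by (simp add: dist_real_def norm dist A)
  show "cp_norm X (cp_add X p (cp_scale X (-1) p')) = cdist p p'"
  proof -
    let ?m = "max (fst p) (fst p')"
    have x: "1 \<le> fst p" "p = (fst p, up (fst p) (op p))" "op p \<in> FF (fst p)" using op[OF A(1)] by blast+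
    have y: "1 \<le> fst p'" "p' = (fst p', up (fst p') (op p'))" "op p' \<in> FF (fst p')" using op[OF A(2)] by blast+
    have "op p \<in> FF ?m" "op p' \<in> FF ?m"
      using x y FF_mono[of "fst p" ?m "op p"] FF_mono[of "fst p'" ?m "op p'"] by auto
    then have F: "opadd (op p) (opscale (-1) (op p')) \<in> FF ?m" by (intro FF_opadd FF_opscale)
    have m: "1 \<le> ?m" using x by simp
    have "cp_add X p (cp_scale X (-1) p') = (?m, up ?m (opadd (op p) (opscale (-1) (op p'))))"
      using cp_ops(1)[OF x(1) y(1) x(3) FF_opscale[OF y(3)]] x(2) un(1)[OF A(2)] by metis
    then have "cp_norm X (cp_add X p (cp_scale X (-1) p')) = opdist ?m (op p) (op p')"
      using cp_ops(5)[OF m m F F] by simp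
    also have "\<dots> = cdist p p'"
      using cdist_eq[OF x(1) y(1) x(3) y(3), of ?m] x(2) y(2) by simp
    finally show ?thesis .
  qed
  show "0 \<le> cp_norm X p" using norm A L nrm_nonneg by simp
qed

lemma core_simps:
  "scarrier (core X) = completion CP cdist"
  "sadd (core X) = clift2 CP cdist (cp_add X)"
  "sscale (core X) c = clift1 CP cdist (cp_scale X c)"
  "smult (core X) = clift2 CP cdist (cp_mult X)"
  "sstar (core X) = clift1 CP cdist (cp_star X)"
  "snorm (core X) P = (THE r. \<forall>s\<in>P. (\<lambda>k. cp_norm X (s k)) \<longlonglongrightarrow> r)"
  by (simp_all add: core_def Let_def)

abbreviation "cauchy \<equiv> cauchy_seqs CP cdist"
abbreviation "cc \<equiv> cclass CP cdist"

lemma snorm_lim: "s \<in> cauchy \<Longrightarrow> (\<lambda>k. cp_norm X (s k)) \<longlonglongrightarrow> snorm (core X) (cc s)"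
  unfolding core_simps by (rule core.contraction_limit) (auto intro: cp_estimates)

lemma cauchy_norm_bounded: "s \<in> cauchy \<Longrightarrow> \<exists>B. \<forall>k. cp_norm X (s k) \<le> B"
proof -
  assume "s \<in> cauchy"
  then have "Bseq (\<lambda>k. cp_norm X (s k))" using snorm_lim convergent_def convergent_imp_Bseq by blast
  then obtain B where "\<And>k. norm (cp_norm X (s k)) \<le> B" unfolding Bseq_def by blast
  then have "cp_norm X (s k) \<le> B" for k by (metis abs_le_D1 real_norm_def)
  then show ?thesis by blast
qed

lemma core_add:
  assumes s: "s \<in> cauchy" and t: "t \<in> cauchy"
  shows "(\<lambda>k. cp_add X (s k) (t k)) \<in> cauchy"
    "sadd (core X) (cc s) (cc t) = cc (\<lambda>k. cp_add X (s k) (t k))"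
proof -
  have lip: "\<exists>K. \<forall>k l. cdist (cp_add X (s k) (t k)) (cp_add X (s' l) (t' l)) \<le>
      K * (cdist (s k) (s' l) + cdist (t k) (t' l))"
    if "s \<in> cauchy" "s' \<in> cauchy" "t \<in> cauchy" "t' \<in> cauchy" for s s' t t'
    using cp_estimates(1)[OF core.cauchy_seqsD[OF that(1)] core.cauchy_seqsD[OF that(2)]
      core.cauchy_seqsD[OF that(3)] core.cauchy_seqsD[OF that(4)]]
    by (intro exI[of _ 1]) simp
  show "(\<lambda>k. cp_add X (s k) (t k)) \<in> cauchy"
    by (rule core.clift2_lipschitz(1)[OF CP_closed(1) lip s t])
  show "sadd (core X) (cc s) (cc t) = cc (\<lambda>k. cp_add X (s k) (t k))"
    unfolding core_simps by (rule core.clift2_lipschitz(2)[OF CP_closed(1) lip s t])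
qed

lemma core_mult:
  assumes s: "s \<in> cauchy" and t: "t \<in> cauchy"
  shows "(\<lambda>k. cp_mult X (s k) (t k)) \<in> cauchy"
    "smult (core X) (cc s) (cc t) = cc (\<lambda>k. cp_mult X (s k) (t k))"
proof -
  have lip: "\<exists>K. \<forall>k l. cdist (cp_mult X (s k) (t k)) (cp_mult X (s' l) (t' l)) \<le>
      K * (cdist (s k) (s' l) + cdist (t k) (t' l))"
    if c: "s \<in> cauchy" "s' \<in> cauchy" "t \<in> cauchy" "t' \<in> cauchy" for s s' t t'
  proof -
    note mem = core.cauchy_seqsD[OF c(1)] core.cauchy_seqsD[OF c(2)] core.cauchy_seqsD[OF c(3)]
      core.cauchy_seqsD[OF c(4)]
    obtain B1 where B1: "\<And>k. cp_norm X (s k) \<le> B1" using cauchy_norm_bounded[OF c(1)] by blast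
    obtain B2 where B2: "\<And>k. cp_norm X (t' k) \<le> B2" using cauchy_norm_bounded[OF c(4)] by blast
    define B where "B = max B1 B2"
    have B: "cp_norm X (s k) \<le> B" "cp_norm X (t' k) \<le> B" for k
      using B1[of k] B2[of k] by (auto simp: B_def)
    have "cdist (cp_mult X (s k) (t k)) (cp_mult X (s' l) (t' l)) \<le>
        B * (cdist (s k) (s' l) + cdist (t k) (t' l))" for k l
    proof -
      have "cdist (cp_mult X (s k) (t k)) (cp_mult X (s' l) (t' l)) \<le>
          cp_norm X (s k) * cdist (t k) (t' l) + cdist (s k) (s' l) * cp_norm X (t' l)"
        by (rule cp_estimates(2)[OF mem])
      also have "\<dots> \<le> B * cdist (t k) (t' l) + cdist (s k) (s' l) * B"
        using B core.d_nonneg mem by (intro add_mono mult_right_mono mult_left_mono) auto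
      finally show ?thesis by (simp add: algebra_simps)
    qed
    then show ?thesis by blast
  qed
  show "(\<lambda>k. cp_mult X (s k) (t k)) \<in> cauchy"
    by (rule core.clift2_lipschitz(1)[OF CP_closed(2) lip s t])
  show "smult (core X) (cc s) (cc t) = cc (\<lambda>k. cp_mult X (s k) (t k))"
    unfolding core_simps by (rule core.clift2_lipschitz(2)[OF CP_closed(2) lip s t])
qed

lemma core_scale:
  assumes s: "s \<in> cauchy"
  shows "(\<lambda>k. cp_scale X c (s k)) \<in> cauchy"
    "sscale (core X) c (cc s) = cc (\<lambda>k. cp_scale X c (s k))"
  unfolding core_simps
  by (rule core.clift1_lipschitz[where K = "cmod c", OF _ _ _ s]; auto intro: CP_closed cp_estimates)+

lemma core_star:
  assumes s: "s \<in> cauchy"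
  shows "(\<lambda>k. cp_star X (s k)) \<in> cauchy"
    "sstar (core X) (cc s) = cc (\<lambda>k. cp_star X (s k))"
  unfolding core_simps
  by (rule core.clift1_lipschitz[where K = 1, OF _ _ _ s]; auto intro: CP_closed cp_estimates)+

lemma core_cases:
  assumes "P \<in> scarrier (core X)"
  obtains s where "s \<in> cauchy" "P = cc s"
  using assms unfolding core_simps by (rule core.completion_cases)

lemma cc_in: "s \<in> cauchy \<Longrightarrow> cc s \<in> scarrier (core X)"
  unfolding core_simps by (rule core.cclass_in)

lemma snorm_nonneg: "s \<in> cauchy \<Longrightarrow> 0 \<le> snorm (core X) (cc s)"
  by (rule LIMSEQ_le_const[OF snorm_lim]) (auto intro: cp_estimates core.cauchy_seqsD)

lemma core_dist_lim:
  assumes s: "s \<in> cauchy" and t: "t \<in> cauchy"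
  shows "(\<lambda>k. cdist (s k) (t k)) \<longlonglongrightarrow> snorm (core X) (sadd (core X) (cc s) (sscale (core X) (-1) (cc t)))"
proof -
  have "(\<lambda>k. cp_norm X (cp_add X (s k) (cp_scale X (-1) (t k)))) \<longlonglongrightarrow>
      snorm (core X) (cc (\<lambda>k. cp_add X (s k) (cp_scale X (-1) (t k))))"
    by (rule snorm_lim[OF core_add(1)[OF s core_scale(1)[OF t]]])
  moreover have "cp_norm X (cp_add X (s k) (cp_scale X (-1) (t k))) = cdist (s k) (t k)" for k
    using core.cauchy_seqsD[OF s] core.cauchy_seqsD[OF t] by (intro cp_estimates(6))
  ultimately show ?thesis
    by (simp add: core_scale(2)[OF t] core_add(2)[OF s core_scale(1)[OF t]])
qed

section \<open>Existence of the trace\<close>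

definition core_trace :: "(nat \<Rightarrow> nat \<times> (('k \<times> 'k \<Rightarrow> complex) tensor \<Rightarrow> ('k \<times> 'k \<Rightarrow> complex) tensor)) set \<Rightarrow> complex" where
  "core_trace = (\<lambda>P\<in>scarrier (core X). THE z. \<forall>s\<in>P. (\<lambda>k. trp (s k)) \<longlonglongrightarrow> z)"

lemma core_trace_lim:
  assumes s: "s \<in> cauchy"
  shows "(\<lambda>k. trp (s k)) \<longlonglongrightarrow> core_trace (cc s)"
proof -
  have "(\<lambda>k. trp (s k)) \<longlonglongrightarrow> (THE z. \<forall>t\<in>cc s. (\<lambda>k. trp (t k)) \<longlonglongrightarrow> z)"
    by (rule core.contraction_limit[OF _ s]) (rule trp_ops(6))
  then show ?thesis using cc_in[OF s] by (simp add: core_trace_def)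
qed

lemma core_trace_eqI: "s \<in> cauchy \<Longrightarrow> (\<lambda>k. trp (s k)) \<longlonglongrightarrow> z \<Longrightarrow> core_trace (cc s) = z"
  using core_trace_lim LIMSEQ_unique by blast

lemma finite_trace_core: "finite_trace (core X) core_trace"
  unfolding finite_trace_def
proof (intro conjI ballI allI exI[of _ 1])
  fix P Q c assume "P \<in> scarrier (core X)"
  then obtain s where s: "s \<in> cauchy" "P = cc s" by (rule core_cases)
  note sS = core.cauchy_seqsD[OF s(1)] and sl = core_trace_lim[OF s(1)]
  show "core_trace (sscale (core X) c P) = c * core_trace P"
    unfolding s(2) core_scale(2)[OF s(1)]
    by (rule core_trace_eqI[OF core_scale(1)[OF s(1)]])
      (simp add: trp_ops(3)[OF sS sS] tendsto_mult_left[OF sl])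
  have "norm (core_trace (cc s)) \<le> snorm (core X) (cc s)"
    by (rule LIMSEQ_le[OF tendsto_norm[OF sl] snorm_lim[OF s(1)]])
      (use trp_ops(5)[OF sS sS] in auto)
  then show "cmod (core_trace P) \<le> 1 * snorm (core X) P" using s by simp
  have "core_trace (cc (\<lambda>k. cp_mult X (cp_star X (s k)) (s k))) \<in> \<real>\<^sub>\<ge>\<^sub>0"
    by (rule Lim_in_closed_set[OF closed_nonneg_Reals_complex _ _
          core_trace_lim[OF core_mult(1)[OF core_star(1)[OF s(1)] s(1)]]])
      (use trp_ops(4)[OF sS sS] in auto)
  then show "core_trace (smult (core X) (sstar (core X) P) P) \<in> \<real>\<^sub>\<ge>\<^sub>0"
    unfolding s(2) core_star(2)[OF s(1)] core_mult(2)[OF core_star(1)[OF s(1)] s(1)] .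
  assume "Q \<in> scarrier (core X)"
  then obtain t where t: "t \<in> cauchy" "Q = cc t" by (rule core_cases)
  note tS = core.cauchy_seqsD[OF t(1)] and tl = core_trace_lim[OF t(1)]
  show "core_trace (sadd (core X) P Q) = core_trace P + core_trace Q"
    unfolding s(2) t(2) core_add(2)[OF s(1) t(1)]
    by (rule core_trace_eqI[OF core_add(1)[OF s(1) t(1)]])
      (simp add: trp_ops(1)[OF sS tS] tendsto_add[OF sl tl])
  show "core_trace (smult (core X) P Q) = core_trace (smult (core X) Q P)"
    unfolding s(2) t(2) core_mult(2)[OF s(1) t(1)] core_mult(2)[OF t(1) s(1)]
    by (rule core_trace_eqI[OF core_mult(1)[OF s(1) t(1)]])
      (use core_trace_lim[OF core_mult(1)[OF t(1) s(1)]] in \<open>simp add: trp_ops(2)[OF sS tS]\<close>)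
qed

abbreviation embed where "embed n T \<equiv> core_embed X n (up n T)"

lemma embed_eq: "embed n T = cc (\<lambda>_. (n, up n T))"
  by (simp add: core_embed_def)

lemma const_cauchy: "1 \<le> n \<Longrightarrow> T \<in> FF n \<Longrightarrow> (\<lambda>_. (n, up n T)) \<in> cauchy"
  by (intro core.const_cauchy CP_I)

lemma core_trace_embed: "1 \<le> n \<Longrightarrow> T \<in> FF n \<Longrightarrow> core_trace (embed n T) = tr n T"
  unfolding embed_eq by (rule core_trace_eqI[OF const_cauchy]) (simp_all add: trp_eq del: One_nat_def)

definition normalized :: "((nat \<Rightarrow> nat \<times> (('k \<times> 'k \<Rightarrow> complex) tensor \<Rightarrow> ('k \<times> 'k \<Rightarrow> complex) tensor)) set \<Rightarrow> complex) \<Rightarrow> bool" where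
  "normalized \<tau> \<longleftrightarrow>
     (\<forall>a\<in>CK. \<tau> (core_embed X 1 (left_op (TP 1) a)) = (LINT x|\<mu>. a x)) \<and>
     (\<forall>i\<ge>1. \<forall>x\<in>mcarrier (TP i). \<forall>y\<in>mcarrier (TP i).
        \<tau> (core_embed X i (theta (TP i) x y)) = 1 / of_nat N ^ i * (LINT z|\<mu>. minner (TP i) y x z))"

lemma normalized_iff:
  "normalized \<tau> \<longleftrightarrow> (\<forall>a\<in>CK. \<tau> (embed 1 (multop a)) = (LINT x|\<mu>. a x)) \<and>
     (\<forall>i\<ge>1. \<forall>u\<in>CK. \<forall>v\<in>CK. \<tau> (embed i (theta (model i) u v)) =
        1 / of_nat N ^ i * (LINT z|\<mu>. minner (model i) v u z))"
proof -
  have 1: "left_op (TP 1) a = up 1 (multop a)" if "a \<in> CK" for a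
    using left_op_TP[OF order_refl that] .
  have 2: "(\<forall>x\<in>mcarrier (TP i). \<forall>y\<in>mcarrier (TP i).
        \<tau> (core_embed X i (theta (TP i) x y)) = 1 / of_nat N ^ i * (LINT z|\<mu>. minner (TP i) y x z)) \<longleftrightarrow>
      (\<forall>u\<in>CK. \<forall>v\<in>CK. \<tau> (embed i (theta (model i) u v)) =
        1 / of_nat N ^ i * (LINT z|\<mu>. minner (model i) v u z))" if i: "i \<ge> 1" for i
    unfolding tensor_carrier[OF i] by (simp add: theta_TP[OF i] tensor_minner[OF _ _ i])
  show ?thesis unfolding normalized_def using 1 2 by simp
qed

lemma normalized_core_trace: "normalized core_trace"
  unfolding normalized_iff
proof (intro conjI ballI allI impI)
  show "core_trace (embed 1 (multop a)) = (LINT x|\<mu>. a x)" if "a \<in> CK" for a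
    using core_trace_embed[of 1 "multop a"] FF_multop[OF that] tr_multop[OF that] by simp
  show "core_trace (embed i (theta (model i) u v)) = 1 / of_nat N ^ i * (LINT z|\<mu>. minner (model i) v u z)"
    if "1 \<le> i" "u \<in> CK" "v \<in> CK" for i u v
    using core_trace_embed[OF that(1) KK_FF[OF that(1) order_refl KK_theta[OF that(2,3)]]]
      tr_theta[OF that(2,3,1)] by simp
qed

section \<open>Uniqueness of the trace\<close>

lemma finite_trace_continuous:
  assumes \<tau>: "finite_trace (core X) \<tau>"
  shows "\<exists>K\<ge>0. \<forall>s\<in>cauchy. \<forall>t\<in>cauchy.
    dist (\<tau> (cc s)) (\<tau> (cc t)) \<le> K * snorm (core X) (sadd (core X) (cc s) (sscale (core X) (-1) (cc t)))"
proof -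
  obtain C where C: "\<And>P. P \<in> scarrier (core X) \<Longrightarrow> cmod (\<tau> P) \<le> C * snorm (core X) P"
    using \<tau> unfolding finite_trace_def by blast
  have "dist (\<tau> (cc s)) (\<tau> (cc t)) \<le>
      \<bar>C\<bar> * snorm (core X) (sadd (core X) (cc s) (sscale (core X) (-1) (cc t)))"
    if s: "s \<in> cauchy" and t: "t \<in> cauchy" for s t
  proof -
    note t' = core_scale[OF t, of "-1"]
    note st = core_add[OF s t'(1)]
    have "\<tau> (sadd (core X) (cc s) (sscale (core X) (-1) (cc t))) = \<tau> (cc s) + (-1) * \<tau> (cc t)"
      using \<tau> cc_in[OF s] cc_in[OF t] cc_in[OF t'(1)] t'(2) unfolding finite_trace_def by metis
    then have "dist (\<tau> (cc s)) (\<tau> (cc t)) =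
        cmod (\<tau> (sadd (core X) (cc s) (sscale (core X) (-1) (cc t))))"
      by (simp add: dist_norm)
    also have "\<dots> \<le> C * snorm (core X) (sadd (core X) (cc s) (sscale (core X) (-1) (cc t)))"
      using C[OF cc_in[OF st(1)]] st(2) t'(2) by simp
    also have "\<dots> \<le> \<bar>C\<bar> * snorm (core X) (sadd (core X) (cc s) (sscale (core X) (-1) (cc t)))"
      using snorm_nonneg[OF st(1)] st(2) t'(2) by (intro mult_right_mono) auto
    finally show ?thesis .
  qed
  then show ?thesis by (intro exI[of _ "\<bar>C\<bar>"]) auto
qed

lemma embed_mono:
  assumes "1 \<le> n" "n \<le> m" "T \<in> FF n"
  shows "embed m T = embed n T"
proof -
  have m: "1 \<le> m" "T \<in> FF m" using assms FF_mono by auto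
  have "cdist (n, up n T) (m, up m T) = opdist m T T"
    using assms m by (intro cdist_eq) auto
  also have "\<dots> = 0" using m FF_L by (simp add: opdist_refl)
  finally have "cdist (n, up n T) (m, up m T) = 0" .
  then have "(\<lambda>_. (n, up n T), \<lambda>_. (m, up m T)) \<in> completion_rel CP cdist"
    using const_cauchy[OF assms(1,3)] CP_I[OF m] by (intro core.completion_relI) auto
  then show ?thesis unfolding embed_eq using core.cclass_eq by metis
qed

lemma embed_opadd:
  assumes "1 \<le> n" "T \<in> FF n" "S \<in> FF n"
  shows "embed n (opadd T S) = sadd (core X) (embed n T) (embed n S)"
  using core_add(2)[OF const_cauchy[OF assms(1,2)] const_cauchy[OF assms(1,3)]]
    cp_ops(1)[OF assms(1,1,2,3)] by (simp add: embed_eq)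

lemma embed_opscale:
  assumes "1 \<le> n" "T \<in> FF n"
  shows "embed n (opscale c T) = sscale (core X) c (embed n T)"
  using core_scale(2)[OF const_cauchy[OF assms], of c] cp_ops(3)[OF assms(1,1,2,2)]
  by (simp add: embed_eq)

lemma finite_trace_embed:
  assumes \<tau>: "finite_trace (core X) \<tau>" and n: "1 \<le> n" and T: "T \<in> FF n"
  shows "S \<in> FF n \<Longrightarrow> \<tau> (embed n (opadd T S)) = \<tau> (embed n T) + \<tau> (embed n S)"
    "\<tau> (embed n (opscale c T)) = c * \<tau> (embed n T)"
proof -
  have mem: "embed n U \<in> scarrier (core X)" if "U \<in> FF n" for U
    unfolding embed_eq by (rule cc_in[OF const_cauchy[OF n that]])
  show "\<tau> (embed n (opadd T S)) = \<tau> (embed n T) + \<tau> (embed n S)" if "S \<in> FF n"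
    using \<tau> mem[OF T] mem[OF that] unfolding embed_opadd[OF n T that] finite_trace_def by blast
  show "\<tau> (embed n (opscale c T)) = c * \<tau> (embed n T)"
    using \<tau> mem[OF T] unfolding embed_opscale[OF n T] finite_trace_def by blast
qed

lemma finite_trace_embed_lim:
  assumes \<tau>: "finite_trace (core X) \<tau>" and n: "1 \<le> n"
    and F: "\<And>k. F k \<in> FF n" and T: "T \<in> FF n" and lim: "(\<lambda>k. opdist n (F k) T) \<longlonglongrightarrow> 0"
  shows "(\<lambda>k. \<tau> (embed n (F k))) \<longlonglongrightarrow> \<tau> (embed n T)"
proof -
  obtain K where K: "\<And>s t. s \<in> cauchy \<Longrightarrow> t \<in> cauchy \<Longrightarrow> dist (\<tau> (cc s)) (\<tau> (cc t)) \<le>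
      K * snorm (core X) (sadd (core X) (cc s) (sscale (core X) (-1) (cc t)))"
    using finite_trace_continuous[OF \<tau>] by blast
  have le: "dist (\<tau> (embed n (F k))) (\<tau> (embed n T)) \<le> K * opdist n (F k) T" for k
  proof -
    have "cdist (n, up n (F k)) (n, up n T) = opdist n (F k) T"
      by (rule cdist_eq[OF n n F T]) auto
    then have "(\<lambda>_::nat. opdist n (F k) T) \<longlonglongrightarrow> snorm (core X) (sadd (core X) (embed n (F k))
        (sscale (core X) (-1) (embed n T)))"
      using core_dist_lim[OF const_cauchy[OF n F] const_cauchy[OF n T], of k] by (simp add: embed_eq)
    then have "snorm (core X) (sadd (core X) (embed n (F k)) (sscale (core X) (-1) (embed n T))) =
        opdist n (F k) T" using LIMSEQ_unique[OF _ tendsto_const] by blast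
    then show ?thesis
      using K[OF const_cauchy[OF n F] const_cauchy[OF n T], of k] by (simp add: embed_eq)
  qed
  have "(\<lambda>k. dist (\<tau> (embed n (F k))) (\<tau> (embed n T))) \<longlonglongrightarrow> 0"
    by (rule tendsto_zero_le[OF tendsto_mult_right_zero[OF lim] le zero_le_dist])
  then show ?thesis by (rule tendsto_dist_iff[THEN iffD2])
qed

text \<open>A trace is prescribed on multiplication operators and on rank-one operators. By linearity and
  continuity it is then determined on compact operators of all levels, hence on the levels \<open>\<F>\<^sup>(\<^sup>n\<^sup>)\<close>.\<close>

lemma normalized_agree_embed:
  assumes \<tau>: "finite_trace (core X) \<tau>" "normalized \<tau>"
    and \<sigma>: "finite_trace (core X) \<sigma>" "normalized \<sigma>"
    and n: "1 \<le> n" and T: "T \<in> FF n"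
  shows "\<tau> (embed n T) = \<sigma> (embed n T)"
  using T
proof (induction rule: FF_induct)
  case (mult a)
  have "embed n (multop a) = embed 1 (multop a)"
    by (rule embed_mono[OF order_refl n FF_multop[OF mult]])
  then show ?case using \<tau>(2) \<sigma>(2) mult by (simp only: normalized_iff)
next
  case (compact i S)
  have fin: "A \<in> FF i" if "A \<in> KK i" for A using KK_FF[OF compact(1) order_refl that] .
  have "S \<in> KK i \<and> \<tau> (embed i S) = \<sigma> (embed i S)"
    using compact(3)
  proof (induction rule: KK_induct)
    case (theta u v)
    then show ?case using \<tau>(2) \<sigma>(2) compact(1) KK_theta by (simp only: normalized_iff)
  next
    case (add A B)
    then show ?case
      using KK_add finite_trace_embed(1)[OF \<tau>(1) compact(1) fin fin, of A B]
        finite_trace_embed(1)[OF \<sigma>(1) compact(1) fin fin, of A B] by simp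
  next
    case (scale c A)
    then show ?case
      using KK_scale finite_trace_embed(2)[OF \<tau>(1) compact(1) fin, of A c]
        finite_trace_embed(2)[OF \<sigma>(1) compact(1) fin, of A c] by simp
  next
    case (lim F A)
    have A: "A \<in> KK i" by (rule KK_lim[of F]) (use lim in \<open>simp_all only: simp_thms\<close>)
    have F: "F k \<in> FF i" for k using lim fin by blast
    have "(\<lambda>k. \<tau> (embed i (F k))) \<longlonglongrightarrow> \<tau> (embed i A)"
      by (rule finite_trace_embed_lim[OF \<tau>(1) compact(1) F fin[OF A] \<open>(\<lambda>k. opdist i (F k) A) \<longlonglongrightarrow> 0\<close>])
    moreover have "(\<lambda>k. \<tau> (embed i (F k))) \<longlonglongrightarrow> \<sigma> (embed i A)"
      using finite_trace_embed_lim[OF \<sigma>(1) compact(1) F fin[OF A] \<open>(\<lambda>k. opdist i (F k) A) \<longlonglongrightarrow> 0\<close>] lim by simp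
    ultimately show ?case using A LIMSEQ_unique by blast
  qed
  then show ?case using embed_mono[OF compact(1,2) fin[OF compact(3)]] by simp
next
  case (add A B)
  then show ?case using finite_trace_embed(1)[OF \<tau>(1) n] finite_trace_embed(1)[OF \<sigma>(1) n] by simp
qed

text \<open>The levels are dense in the core: a class is the limit of the classes of the constant sequences at its
  entries.\<close>

lemma normalized_agree:
  assumes \<tau>: "finite_trace (core X) \<tau>" "normalized \<tau>"
    and \<sigma>: "finite_trace (core X) \<sigma>" "normalized \<sigma>"
    and P: "P \<in> scarrier (core X)"
  shows "\<tau> P = \<sigma> P"
proof -
  obtain s where s: "s \<in> cauchy" "P = cc s" using P by (rule core_cases)
  have sS: "s k \<in> CP" for k by (rule core.cauchy_seqsD[OF s(1)])
  have lim: "(\<lambda>k. \<tau>' (cc (\<lambda>_. s k))) \<longlonglongrightarrow> \<tau>' P" if \<tau>': "finite_trace (core X) \<tau>'" for \<tau>'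
  proof -
    obtain K where K0: "0 \<le> K" and K: "\<And>s t. s \<in> cauchy \<Longrightarrow> t \<in> cauchy \<Longrightarrow> dist (\<tau>' (cc s)) (\<tau>' (cc t)) \<le>
        K * snorm (core X) (sadd (core X) (cc s) (sscale (core X) (-1) (cc t)))"
      using finite_trace_continuous[OF \<tau>'] by blast
    have lim: "(\<lambda>k. snorm (core X) (sadd (core X) (cc s) (sscale (core X) (-1) (cc (\<lambda>_. s k))))) \<longlonglongrightarrow> 0"
    proof (rule LIMSEQ_I)
      fix e :: real assume e: "e > 0"
      then have "e / 2 > 0" by simp
      then obtain M where M: "\<forall>k\<ge>M. \<forall>l\<ge>M. cdist (s k) (s l) < e / 2"
        using s(1) unfolding cauchy_seqs_def by blast
      have "norm (snorm (core X) (sadd (core X) (cc s) (sscale (core X) (-1) (cc (\<lambda>_. s k)))) - 0) < e"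
        if k: "k \<ge> M" for k
      proof -
        note c = core.const_cauchy[OF sS]
        have "snorm (core X) (sadd (core X) (cc s) (sscale (core X) (-1) (cc (\<lambda>_. s k)))) \<le> e / 2"
          by (rule LIMSEQ_le_const2[OF core_dist_lim[OF s(1) c]])
            (use M k in \<open>auto intro!: exI[of _ M] less_imp_le\<close>)
        moreover have "0 \<le> snorm (core X) (sadd (core X) (cc s) (sscale (core X) (-1) (cc (\<lambda>_. s k))))"
          by (rule LIMSEQ_le_const[OF core_dist_lim[OF s(1) c]]) (use core.d_nonneg sS in auto)
        ultimately show ?thesis using e by simp
      qed
      then show "\<exists>M. \<forall>k\<ge>M. norm (snorm (core X) (sadd (core X) (cc s)
          (sscale (core X) (-1) (cc (\<lambda>_. s k)))) - 0) < e" by blast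
    qed
    have le: "dist (\<tau>' (cc (\<lambda>_. s k))) (\<tau>' P) \<le>
        K * snorm (core X) (sadd (core X) (cc s) (sscale (core X) (-1) (cc (\<lambda>_. s k))))" for k
      using K[OF s(1) core.const_cauchy[OF sS], of k] s(2) by (simp add: dist_commute)
    have "(\<lambda>k. dist (\<tau>' (cc (\<lambda>_. s k))) (\<tau>' P)) \<longlonglongrightarrow> 0"
      by (rule tendsto_zero_le[OF tendsto_mult_right_zero[OF lim] le zero_le_dist])
    then show ?thesis by (rule tendsto_dist_iff[THEN iffD2])
  qed
  have "\<tau> (cc (\<lambda>_. s k)) = \<sigma> (cc (\<lambda>_. s k))" for k
  proof -
    obtain n T where "s k = (n, up n T)" "1 \<le> n" "T \<in> FF n" using sS by (rule CP_cases)
    then show ?thesis using normalized_agree_embed[OF \<tau> \<sigma>, of n T] by (simp add: embed_eq)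
  qed
  then show ?thesis using lim[OF \<tau>(1)] lim[OF \<sigma>(1)] LIMSEQ_unique by simp
qed

lemma unique_trace:
  "\<exists>!\<tau>. \<tau> \<in> extensional (scarrier (core X)) \<and> finite_trace (core X) \<tau> \<and> normalized \<tau>"
proof (rule ex1I[of _ core_trace])
  show "core_trace \<in> extensional (scarrier (core X)) \<and> finite_trace (core X) core_trace \<and> normalized core_trace"
    using finite_trace_core normalized_core_trace by (simp add: core_trace_def)
  fix \<tau> assume "\<tau> \<in> extensional (scarrier (core X)) \<and> finite_trace (core X) \<tau> \<and> normalized \<tau>"
  then show "\<tau> = core_trace"
    using normalized_agree[OF _ _ finite_trace_core normalized_core_trace]
    by (intro extensionalityI[of _ "scarrier (core X)"]) (auto simp: core_trace_def)
qed

end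

theorem proposition6p3:
  fixes \<gamma> :: "nat \<Rightarrow> 'k::metric_space \<Rightarrow> 'k" and N :: nat and \<mu> :: "'k measure"
  defines "X \<equiv> self_similar_corr N \<gamma>"
  assumes "compact (UNIV :: 'k set)"
    and "N \<ge> 2"
    and "self_similar_map N \<gamma>"
    and "assumption_A N \<gamma>"
    and "hutchinson_measure N \<gamma> \<mu>"
  shows "\<exists>!\<tau>. \<tau> \<in> extensional (scarrier (core X)) \<and> finite_trace (core X) \<tau> \<and>
           (\<forall>a\<in>CK. \<tau> (core_embed X 1 (left_op (tensor_power X 1) a)) = (LINT x|\<mu>. a x)) \<and>
           (\<forall>i\<ge>1. \<forall>x\<in>mcarrier (tensor_power X i). \<forall>y\<in>mcarrier (tensor_power X i).
              \<tau> (core_embed X i (theta (tensor_power X i) x y)) =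
                1 / of_nat N ^ i * (LINT z|\<mu>. minner (tensor_power X i) y x z))"
proof -
  have "\<exists>h. continuous_on UNIV h \<and> (\<forall>j\<in>{1..N}. \<forall>y. h (\<gamma> j y) = y) \<and>
      (\<forall>y. h -` {y} = (\<lambda>j. \<gamma> j y) ` {1..N})"
    using \<open>assumption_A N \<gamma>\<close> unfolding assumption_A_def by (elim conjE)
  then obtain h where "continuous_on UNIV h \<and> (\<forall>j\<in>{1..N}. \<forall>y. h (\<gamma> j y) = y) \<and>
      (\<forall>y. h -` {y} = (\<lambda>j. \<gamma> j y) ` {1..N})" by (elim exE)
  then have h: "continuous_on UNIV h" "\<And>j y. j \<in> {1..N} \<Longrightarrow> h (\<gamma> j y) = y"
    "\<And>y. h -` {y} = (\<lambda>j. \<gamma> j y) ` {1..N}" by simp_all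
  have cover: "\<exists>j\<in>{1..N}. \<gamma> j (h x) = x" for x
  proof -
    have "x \<in> h -` {h x}" by simp
    then obtain j where "j \<in> {1..N}" "x = \<gamma> j (h x)" unfolding h(3) by blast
    then show ?thesis by (intro bexI[of _ j]) simp_all
  qed
  have cont: "continuous_on UNIV (\<gamma> j)" if j: "j \<in> {1..N}" for j
  proof -
    obtain c where "\<And>x y. dist (\<gamma> j x) (\<gamma> j y) \<le> c * dist x y" "c > 0"
      using \<open>self_similar_map N \<gamma>\<close> j unfolding self_similar_map_def by (meson order_less_le_trans)
    then have "c-lipschitz_on UNIV (\<gamma> j)" by (intro lipschitz_onI) auto
    then show ?thesis by (rule lipschitz_on_continuous_on)
  qed
  have branch: "h x \<notin> branch_set N \<gamma>" if x: "x \<in> branch_set N \<gamma>" for x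
  proof
    assume hx: "h x \<in> branch_set N \<gamma>"
    obtain j where j: "j \<in> {1..N}" "\<gamma> j (h x) = x" using cover by blast
    have "x \<in> orbit_set N \<gamma> (h x) 1"
      unfolding orbit_set_def using j by (auto intro!: exI[of _ "[j]"])
    then have "x \<in> branch_set N \<gamma> \<inter> (\<Union>b\<in>branch_set N \<gamma>. \<Union>k\<in>{1..}. orbit_set N \<gamma> b k)"
      using x hx by auto
    then show False using \<open>assumption_A N \<gamma>\<close> unfolding assumption_A_def by blast
  qed
  interpret branch_measure N \<gamma> h \<mu>
  proof (intro branch_measure.intro branch_system.intro branch_measure_axioms.intro)
    show "prob_space \<mu>" "sets \<mu> = sets borel"
      using \<open>hutchinson_measure N \<gamma> \<mu>\<close> by (auto simp: hutchinson_measure_def)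
    show "(LINT x|\<mu>. a x) = 1 / of_nat N * (\<Sum>j=1..N. LINT x|\<mu>. a (\<gamma> j x))" if "a \<in> CK" for a
      using \<open>hutchinson_measure N \<gamma> \<mu>\<close> that by (auto simp: hutchinson_measure_def)
    show "finite (branch_set N \<gamma>)" using \<open>assumption_A N \<gamma>\<close> by (simp add: assumption_A_def)
  qed (use assms(2,3) h cover cont branch in auto)
  show ?thesis using unique_trace unfolding X_def normalized_def .
qed

end
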